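(* Let $E$ be a metrizable Lusin space, $m$ a positive $\sigma$-finite measure with full support on the Borel $\sigma$-field $\mathcal{B}(E)$, and $(\mathcal{E},D(\mathcal{E}))$ a quasi-regular (not necessarily symmetric) Dirichlet form on $L^2(E;m)$. Let $\mu\in\mathcal{M}_b$. Then $\mu\in\mathcal{M}_{0,b}$ if and only if there exist $f\in L^1(E;m)$ and $\nu\in D(\mathcal{E})^*$ such that for every bounded $u\in D(\mathcal{E})$, $$\langle\mu,\tilde u\rangle=(f,u)+\langle\nu,\tilde u\rangle.$$
   Context: Dirichlet form: $D(\mathcal{E})$ is a dense linear subspace of $L^2(E;m)$ and $\mathcal{E}$ is a bilinear form on it such that its symmetric part $\tilde{\mathcal{E}}(u,v)=\frac12(\mathcal{E}(u,v)+\mathcal{E}(v,u))$ is a nonnegative closed form; with $\mathcal{E}_\alpha(u,v)=\mathcal{E}(u,v)+\alpha\int_E uv\,dm$ (and similarly $\tilde{\mathcal{E}}_\alpha$), the weak sector condition $|\mathcal{E}_1(u,v)|\le K\mathcal{E}_1(u,u)^{1/2}\mathcal{E}_1(v,v)^{1/2}$ holds for some $K$; and for every $u\in D(\mathcal{E})$, $u^+\wedge 1\in D(\mathcal{E})$ and $\mathcal{E}(u+u^+\wedge1,u-u^+\wedge1)\ge0$, $\mathcal{E}(u-u^+\wedge1,u+u^+\wedge1)\ge0$. $D(\mathcal{E})$ is a Hilbert space with inner product $\tilde{\mathcal{E}}_1$, and $D(\mathcal{E})^*$ is its dual. An $\mathcal{E}$-nest is an increasing sequence $\{F_k\}$ of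 closed subsets of $E$ such that $\bigcup_k\{u\in D(\mathcal{E}):u=0\ m\text{-a.e. on }E\setminus F_k\}$ is dense in $D(\mathcal{E})$ for the norm $\mathcal{E}_1(u,u)^{1/2}$. A set $N\subset E$ is $\mathcal{E}$-exceptional if $N\subset\bigcap_k(E\setminus F_k)$ for some $\mathcal{E}$-nest $\{F_k\}$; "$\mathcal{E}$-q.e." means outside an $\mathcal{E}$-exceptional set. A function $f$ is $\mathcal{E}$-quasi-continuous if $f|_{F_k}$ is continuous for every $k$, for some $\mathcal{E}$-nest $\{F_k\}$. The form is quasi-regular if: (i) there is an $\mathcal{E}$-nest of compact sets; (ii) some $\tilde{\mathcal{E}}_1^{1/2}$-dense subset of $D(\mathcal{E})$ consists of elements having $\mathcal{E}$-quasi-continuous $m$-versions; (iii) there are $u_n\in D(\mathcal{E})$, $n\in\mathbb{N}$, with $\mathcal{E}$-quasi-continuous $m$-versions $\tilde u_n$, and an $\mathcal{E}$-exceptional set $N$, such that $\{\tilde u_n\}$ separates the points of $E\setminus N$. For a quasi-regular form every $u\in D(\mathcal{E})$ has an $\mathcal{E}$-quasi-continuous $m$-version, denoted $\tilde u$, unique up to $\mathcal{E}$-q.e. equality. Measures: $\mathcal{M}_b$ is the set of signed Borel measures $\mu$ on $E$ with $|\mu|(E)<\infty$ ($|\mu|$ the total variation measure). A positive measure $\mu$ on $\mathcal{B}(E)$ is $\mathcal{E}$-smooth ($\mu\in S$) if $\mu(B)=0$ for all $\mathcal{E}$-exceptional $B\in\mathcal{B}(E)$ and there is an $\mathcal{E}$-nest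 $\{F_k\}$ of compact sets with $\mu(F_k)<\infty$ for all $k$. $\mathcal{M}_{0,b}=\{\mu\in\mathcal{M}_b:|\mu|\in S\}$. Notation: $\langle\mu,\tilde u\rangle=\int_E\tilde u\,d\mu$, $(f,u)=\int_E fu\,dm$, and $\langle\nu,\tilde u\rangle$ is the value of the functional $\nu\in D(\mathcal{E})^*$ at $u$. The identity is understood to hold for every bounded Borel $\mathcal{E}$-quasi-continuous $m$-version $\tilde u$ of $u$. *)

theory Defs
  imports "HOL-Analysis.Analysis"
begin

section \<open>Lusin spaces\<close>

text \<open>A Lusin space is the image of a Polish space under a continuous bijection. Transporting the
  Polish topology along the bijection, this means that there is a finer Polish topology on the
  same set.\<close>

definition lusin_space :: "'a topology \<Rightarrow> bool" where
  "lusin_space X \<longleftrightarrow>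
     (\<exists>T. topspace T = topspace X \<and> (\<forall>U. openin X U \<longrightarrow> openin T U) \<and>
          completely_metrizable_space T \<and> separable_space T)"

definition full_support :: "'a::topological_space measure \<Rightarrow> bool" where
  "full_support m \<longleftrightarrow> (\<forall>U. open U \<and> U \<noteq> {} \<longrightarrow> emeasure m U > 0)"


section \<open>Dirichlet forms\<close>

text \<open>An element of \<open>L\<^sup>2(E; m)\<close> is represented by all its Borel versions. Accordingly the domain \<open>D\<close>
  of a form is a set of functions that contains, with a function, all Borel functions equal to it
  \<open>m\<close>-a.e., and the form \<open>\<E>\<close> does not distinguish between such functions
  (see \<open>on_classes\<close> below).\<close>

definition L2 :: "'a measure \<Rightarrow> ('a \<Rightarrow> real) set" where
  "L2 m = {u \<in> borel_measurable m. integrable m (\<lambda>x. (u x)\<^sup>2)}"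

type_synonym 'a form = "('a \<Rightarrow> real) \<Rightarrow> ('a \<Rightarrow> real) \<Rightarrow> real"

definition on_classes :: "'a measure \<Rightarrow> ('a \<Rightarrow> real) set \<Rightarrow> 'a form \<Rightarrow> bool" where
  "on_classes m D \<E> \<longleftrightarrow>
     (\<forall>u\<in>D. \<forall>v\<in>borel_measurable m. (AE x in m. v x = u x) \<longrightarrow> v \<in> D) \<and>
     (\<forall>u\<in>D. \<forall>u'\<in>D. \<forall>v\<in>D. \<forall>v'\<in>D. (AE x in m. u' x = u x) \<longrightarrow> (AE x in m. v' x = v x) \<longrightarrow>
        \<E> u' v' = \<E> u v)"

definition linear_subspace :: "('a \<Rightarrow> real) set \<Rightarrow> bool" where
  "linear_subspace D \<longleftrightarrow>
     (\<lambda>x. 0) \<in> D \<and> (\<forall>u\<in>D. \<forall>v\<in>D. (\<lambda>x. u x + v x) \<in> D) \<and> (\<forall>u\<in>D. \<forall>c. (\<lambda>x. c * u x) \<in> D)"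

definition linear_functional :: "('a \<Rightarrow> real) set \<Rightarrow> (('a \<Rightarrow> real) \<Rightarrow> real) \<Rightarrow> bool" where
  "linear_functional D \<nu> \<longleftrightarrow>
     (\<forall>u\<in>D. \<forall>v\<in>D. \<nu> (\<lambda>x. u x + v x) = \<nu> u + \<nu> v) \<and>
     (\<forall>u\<in>D. \<forall>c. \<nu> (\<lambda>x. c * u x) = c * \<nu> u)"

definition bilinear_form :: "('a \<Rightarrow> real) set \<Rightarrow> 'a form \<Rightarrow> bool" where
  "bilinear_form D \<E> \<longleftrightarrow>
     (\<forall>u\<in>D. linear_functional D (\<lambda>v. \<E> u v)) \<and> (\<forall>v\<in>D. linear_functional D (\<lambda>u. \<E> u v))"

definition dense_in_L2 :: "'a measure \<Rightarrow> ('a \<Rightarrow> real) set \<Rightarrow> bool" where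
  "dense_in_L2 m D \<longleftrightarrow>
     (\<forall>f\<in>L2 m. \<forall>\<epsilon>>0. \<exists>u\<in>D. sqrt (\<integral>x. (f x - u x)\<^sup>2 \<partial>m) < \<epsilon>)"

definition sym_part :: "'a form \<Rightarrow> 'a form" where
  "sym_part \<E> u v = (\<E> u v + \<E> v u) / 2"

definition form_plus :: "'a measure \<Rightarrow> 'a form \<Rightarrow> real \<Rightarrow> 'a form" where
  "form_plus m \<E> \<alpha> u v = \<E> u v + \<alpha> * (\<integral>x. u x * v x \<partial>m)"

text \<open>The norm of the inner product \<open>form_plus m (sym_part \<E>) 1\<close>. Since
  \<open>sym_part \<E> u u = \<E> u u\<close>, it is also \<open>sqrt (form_plus m \<E> 1 u u)\<close>.\<close>

definition form_norm :: "'a measure \<Rightarrow> 'a form \<Rightarrow> ('a \<Rightarrow> real) \<Rightarrow> real" where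
  "form_norm m \<E> u = sqrt (form_plus m (sym_part \<E>) 1 u u)"

definition nonneg_form :: "('a \<Rightarrow> real) set \<Rightarrow> 'a form \<Rightarrow> bool" where
  "nonneg_form D \<E> \<longleftrightarrow> (\<forall>u\<in>D. \<E> u u \<ge> 0)"

definition closed_form :: "'a measure \<Rightarrow> ('a \<Rightarrow> real) set \<Rightarrow> 'a form \<Rightarrow> bool" where
  "closed_form m D \<E> \<longleftrightarrow>
     (\<forall>w :: nat \<Rightarrow> 'a \<Rightarrow> real.
        (\<forall>n. w n \<in> D) \<and>
        (\<forall>\<epsilon>>0. \<exists>n0. \<forall>i\<ge>n0. \<forall>j\<ge>n0. form_norm m \<E> (\<lambda>x. w i x - w j x) < \<epsilon>) \<longrightarrow>
        (\<exists>u\<in>D. (\<lambda>n. form_norm m \<E> (\<lambda>x. w n x - u x)) \<longlonglongrightarrow> 0))"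

definition weak_sector :: "'a measure \<Rightarrow> ('a \<Rightarrow> real) set \<Rightarrow> 'a form \<Rightarrow> bool" where
  "weak_sector m D \<E> \<longleftrightarrow>
     (\<exists>K. \<forall>u\<in>D. \<forall>v\<in>D. \<bar>form_plus m \<E> 1 u v\<bar>
        \<le> K * sqrt (form_plus m \<E> 1 u u) * sqrt (form_plus m \<E> 1 v v))"

definition unit_contraction :: "('a \<Rightarrow> real) \<Rightarrow> 'a \<Rightarrow> real" where
  "unit_contraction u x = min (max (u x) 0) 1"

definition dirichlet_form :: "'a measure \<Rightarrow> ('a \<Rightarrow> real) set \<Rightarrow> 'a form \<Rightarrow> bool" where
  "dirichlet_form m D \<E> \<longleftrightarrow>
     D \<subseteq> L2 m \<and> linear_subspace D \<and> dense_in_L2 m D \<and>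
     bilinear_form D \<E> \<and> on_classes m D \<E> \<and>
     nonneg_form D (sym_part \<E>) \<and> closed_form m D (sym_part \<E>) \<and>
     weak_sector m D \<E> \<and>
     (\<forall>u\<in>D. unit_contraction u \<in> D \<and>
        \<E> (\<lambda>x. u x + unit_contraction u x) (\<lambda>x. u x - unit_contraction u x) \<ge> 0 \<and>
        \<E> (\<lambda>x. u x - unit_contraction u x) (\<lambda>x. u x + unit_contraction u x) \<ge> 0)"

definition form_dense :: "'a measure \<Rightarrow> ('a \<Rightarrow> real) set \<Rightarrow> 'a form \<Rightarrow> ('a \<Rightarrow> real) set \<Rightarrow> bool" where
  "form_dense m D \<E> S \<longleftrightarrow>
     S \<subseteq> D \<and> (\<forall>u\<in>D. \<forall>\<epsilon>>0. \<exists>v\<in>S. form_norm m \<E> (\<lambda>x. u x - v x) < \<epsilon>)"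

definition form_dual ::
    "'a measure \<Rightarrow> ('a \<Rightarrow> real) set \<Rightarrow> 'a form \<Rightarrow> (('a \<Rightarrow> real) \<Rightarrow> real) set" where
  "form_dual m D \<E> =
     {\<nu>. linear_functional D \<nu> \<and> (\<exists>C. \<forall>u\<in>D. \<bar>\<nu> u\<bar> \<le> C * form_norm m \<E> u)}"


section \<open>Quasi-regularity\<close>

definition nest ::
    "'a::topological_space measure \<Rightarrow> ('a \<Rightarrow> real) set \<Rightarrow> 'a form \<Rightarrow> (nat \<Rightarrow> 'a set) \<Rightarrow> bool" where
  "nest m D \<E> F \<longleftrightarrow>
     (\<forall>k. closed (F k)) \<and> incseq F \<and>
     form_dense m D \<E> (\<Union>k. {u \<in> D. AE x in m. x \<notin> F k \<longrightarrow> u x = 0})"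

definition exceptional ::
    "'a::topological_space measure \<Rightarrow> ('a \<Rightarrow> real) set \<Rightarrow> 'a form \<Rightarrow> 'a set \<Rightarrow> bool" where
  "exceptional m D \<E> N \<longleftrightarrow> (\<exists>F. nest m D \<E> F \<and> N \<subseteq> (\<Inter>k. - F k))"

definition quasi_continuous ::
    "'a::topological_space measure \<Rightarrow> ('a \<Rightarrow> real) set \<Rightarrow> 'a form \<Rightarrow> ('a \<Rightarrow> real) \<Rightarrow> bool" where
  "quasi_continuous m D \<E> f \<longleftrightarrow> (\<exists>F. nest m D \<E> F \<and> (\<forall>k. continuous_on (F k) f))"

definition qc_version ::
    "'a::topological_space measure \<Rightarrow> ('a \<Rightarrow> real) set \<Rightarrow> 'a form \<Rightarrow> ('a \<Rightarrow> real) \<Rightarrow> ('a \<Rightarrow> real) \<Rightarrow> bool"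
  where "qc_version m D \<E> u g \<longleftrightarrow> quasi_continuous m D \<E> g \<and> (AE x in m. g x = u x)"

definition quasi_regular ::
    "'a::topological_space measure \<Rightarrow> ('a \<Rightarrow> real) set \<Rightarrow> 'a form \<Rightarrow> bool" where
  "quasi_regular m D \<E> \<longleftrightarrow>
     (\<exists>F. nest m D \<E> F \<and> (\<forall>k. compact (F k))) \<and>
     (\<exists>S. form_dense m D \<E> S \<and> (\<forall>u\<in>S. \<exists>g. qc_version m D \<E> u g)) \<and>
     (\<exists>(u :: nat \<Rightarrow> 'a \<Rightarrow> real) g N.
        (\<forall>n. u n \<in> D \<and> qc_version m D \<E> (u n) (g n)) \<and> exceptional m D \<E> N \<and>
        (\<forall>x\<in>-N. \<forall>y\<in>-N. x \<noteq> y \<longrightarrow> (\<exists>n. g n x \<noteq> g n y)))"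


section \<open>Signed and smooth measures\<close>

text \<open>A signed measure of finite total variation takes only finite values, so such measures are
  real-valued set functions, of which only the values on Borel sets matter.\<close>

definition signed_measure :: "('a::topological_space set \<Rightarrow> real) \<Rightarrow> bool" where
  "signed_measure \<mu> \<longleftrightarrow>
     (\<forall>A :: nat \<Rightarrow> 'a set. range A \<subseteq> sets borel \<longrightarrow> disjoint_family A \<longrightarrow>
        (\<lambda>i. \<mu> (A i)) sums \<mu> (\<Union>i. A i))"

text \<open>The positive variation of \<open>\<mu>\<close>. Note that \<open>ennreal\<close> truncates negative values
  to 0, which is harmless since \<open>B = {}\<close> is admitted.\<close>

definition pos_variation :: "('a::topological_space set \<Rightarrow> real) \<Rightarrow> 'a measure" where
  "pos_variation \<mu> =
     measure_of UNIV (sets borel) (\<lambda>A. SUP B\<in>{B \<in> sets borel. B \<subseteq> A}. ennreal (\<mu> B))"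

definition neg_variation :: "('a::topological_space set \<Rightarrow> real) \<Rightarrow> 'a measure" where
  "neg_variation \<mu> = pos_variation (\<lambda>A. - \<mu> A)"

definition total_variation :: "('a::topological_space set \<Rightarrow> real) \<Rightarrow> 'a measure" where
  "total_variation \<mu> =
     measure_of UNIV (sets borel)
       (\<lambda>A. emeasure (pos_variation \<mu>) A + emeasure (neg_variation \<mu>) A)"

definition signed_integral :: "('a::topological_space set \<Rightarrow> real) \<Rightarrow> ('a \<Rightarrow> real) \<Rightarrow> real" where
  "signed_integral \<mu> g = (\<integral>x. g x \<partial>pos_variation \<mu>) - (\<integral>x. g x \<partial>neg_variation \<mu>)"

definition M_b :: "('a::topological_space set \<Rightarrow> real) set" where
  "M_b = {\<mu>. signed_measure \<mu> \<and> emeasure (total_variation \<mu>) UNIV < \<infinity>}"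

definition smooth ::
    "'a::topological_space measure \<Rightarrow> ('a \<Rightarrow> real) set \<Rightarrow> 'a form \<Rightarrow> 'a measure \<Rightarrow> bool" where
  "smooth m D \<E> M \<longleftrightarrow>
     sets M = sets borel \<and>
     (\<forall>B\<in>sets borel. exceptional m D \<E> B \<longrightarrow> emeasure M B = 0) \<and>
     (\<exists>F. nest m D \<E> F \<and> (\<forall>k. compact (F k) \<and> emeasure M (F k) < \<infinity>))"

definition M_0b ::
    "'a::topological_space measure \<Rightarrow> ('a \<Rightarrow> real) set \<Rightarrow> 'a form \<Rightarrow> ('a set \<Rightarrow> real) set" where
  "M_0b m D \<E> = {\<mu> \<in> M_b. smooth m D \<E> (total_variation \<mu>)}"

text \<open>The variations are countably additive, so that the \<open>measure_of\<close> in their definitions yields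
  the stated values.\<close>

lemma sets_variation [simp]:
  "sets (pos_variation \<mu>) = sets borel" "sets (neg_variation \<mu>) = sets borel"
  "sets (total_variation \<mu>) = sets borel"
  using sets.sigma_sets_eq[of borel]
  by (simp_all add: pos_variation_def neg_variation_def total_variation_def)

lemma signed_measure_uminus: "signed_measure \<mu> \<Longrightarrow> signed_measure (\<lambda>A. - \<mu> A)"
  unfolding signed_measure_def by (simp add: sums_minus)

lemma signed_measure_empty:
  fixes \<mu> :: "'a::topological_space set \<Rightarrow> real"
  shows "signed_measure \<mu> \<Longrightarrow> \<mu> {} = 0"
proof -
  assume "signed_measure \<mu>"
  then have "(\<lambda>i. \<mu> (A i)) sums \<mu> (\<Union>i. A i)"
    if "range A \<subseteq> sets borel" "disjoint_family A" for A :: "nat \<Rightarrow> 'a set"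
    using that unfolding signed_measure_def by blast
  from this[of "\<lambda>i. {}"] have "(\<lambda>i::nat. \<mu> {}) sums \<mu> (\<Union>i::nat. {})"
    by (auto simp: disjoint_family_on_def)
  then have "summable (\<lambda>i::nat. \<mu> {})" by (rule sums_summable)
  then show ?thesis by (simp add: summable_const_iff)
qed

lemma signed_measure_Un:
  assumes "signed_measure \<mu>" "A \<in> sets borel" "B \<in> sets borel" "A \<inter> B = {}"
  shows "\<mu> (A \<union> B) = \<mu> A + \<mu> B"
proof -
  let ?X = "binaryset A B"
  have "range ?X \<subseteq> sets borel" using assms by (simp add: range_binaryset_eq)
  moreover have "disjoint_family ?X"
    using assms(4) by (auto simp: disjoint_family_on_def binaryset_def)
  ultimately have "(\<lambda>i. \<mu> (?X i)) sums \<mu> (\<Union>i. ?X i)"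
    using assms(1) unfolding signed_measure_def by blast
  moreover have "(\<lambda>i. \<mu> (?X i)) sums (\<mu> A + \<mu> B)"
    by (rule binaryset_sums) (rule signed_measure_empty[OF assms(1)])
  ultimately show ?thesis
    by (simp add: UN_binaryset_eq sums_unique2)
qed

lemma emeasure_pos_variation:
  assumes \<mu>: "signed_measure \<mu>" and A: "A \<in> sets borel"
  shows "emeasure (pos_variation \<mu>) A = (SUP B\<in>{B \<in> sets borel. B \<subseteq> A}. ennreal (\<mu> B))"
proof -
  define P where "P A = (SUP B\<in>{B \<in> sets borel. B \<subseteq> A}. ennreal (\<mu> B))" for A
  have P_ge: "ennreal (\<mu> B) \<le> P A" if "B \<in> sets borel" "B \<subseteq> A" for A B
    unfolding P_def using that by (auto intro: SUP_upper)
  have P_add: "P A + P A' \<le> P (A \<union> A')" if "A \<inter> A' = {}" for A A'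
  proof -
    have *: "ennreal (\<mu> B) + ennreal (\<mu> B') \<le> P (A \<union> A')"
      if B: "B \<in> sets borel" "B \<subseteq> A" and B': "B' \<in> sets borel" "B' \<subseteq> A'" for B B'
    proof -
      have U: "\<mu> (B \<union> B') = \<mu> B + \<mu> B'"
        using B B' \<open>A \<inter> A' = {}\<close> by (intro signed_measure_Un[OF \<mu>]) auto
      consider "\<mu> B < 0" | "\<mu> B' < 0" | "\<mu> B \<ge> 0" "\<mu> B' \<ge> 0" by linarith
      then show ?thesis
      proof cases
        case 1
        then have "ennreal (\<mu> B) = 0" by (simp add: ennreal_neg)
        then show ?thesis using P_ge[of B' "A \<union> A'"] B' by auto
      next
        case 2
        then have "ennreal (\<mu> B') = 0" by (simp add: ennreal_neg)
        then show ?thesis using P_ge[of B "A \<union> A'"] B by auto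
      next
        case 3
        then have "ennreal (\<mu> B) + ennreal (\<mu> B') = ennreal (\<mu> (B \<union> B'))" using U by simp
        also have "\<dots> \<le> P (A \<union> A')" using B B' by (intro P_ge) auto
        finally show ?thesis .
      qed
    qed
    have ne: "{B \<in> sets borel. B \<subseteq> X} \<noteq> {}" for X :: "'a set" by (rule ex_in_conv[THEN iffD1]) (rule exI[of _ "{}"], simp)
    have "P A + P A' = (SUP B\<in>{B \<in> sets borel. B \<subseteq> A}. ennreal (\<mu> B) + P A')"
      unfolding P_def[of A] using ne by (intro ennreal_SUP_add_left[symmetric]) auto
    also have "\<dots> \<le> P (A \<union> A')"
    proof (rule SUP_least)
      fix B assume B: "B \<in> {B \<in> sets borel. B \<subseteq> A}"
      have "ennreal (\<mu> B) + P A' = (SUP B'\<in>{B \<in> sets borel. B \<subseteq> A'}. ennreal (\<mu> B) + ennreal (\<mu> B'))"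
        unfolding P_def[of A'] using ne by (intro ennreal_SUP_add_right) blast
      also have "\<dots> \<le> P (A \<union> A')" using B by (intro SUP_least *) auto
      finally show "ennreal (\<mu> B) + P A' \<le> P (A \<union> A')" .
    qed
    finally show ?thesis .
  qed
  have P0: "P {} = 0"
  proof -
    have "{B \<in> sets borel. B \<subseteq> {}} = {{} :: 'a set}" by auto
    then show ?thesis by (simp add: P_def signed_measure_empty[OF \<mu>])
  qed
  have P_mono: "P A \<le> P B" if "A \<subseteq> B" for A B
    unfolding P_def using that by (intro SUP_subset_mono) auto
  have "emeasure (pos_variation \<mu>) A = P A"
  proof (rule emeasure_measure_of[OF pos_variation_def[of \<mu>, folded P_def]])
    show "sets borel \<subseteq> Pow (UNIV :: 'a set)" by simp
    show "A \<in> sets (pos_variation \<mu>)" using A by simp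
    show "positive (sets (pos_variation \<mu>)) P" using P0 by (simp add: positive_def)
    show "countably_additive (sets (pos_variation \<mu>)) P"
    proof (rule countably_additiveI)
      fix X :: "nat \<Rightarrow> 'a set"
      assume "range X \<subseteq> sets (pos_variation \<mu>)" and dis: "disjoint_family X"
      then have X: "X i \<in> sets borel" for i by auto
      show "(\<Sum>i. P (X i)) = P (\<Union>i. X i)"
      proof (rule antisym)
        have fin: "(\<Sum>i<n. P (X i)) \<le> P (\<Union>i<n. X i)" for n
        proof (induction n)
          case 0 then show ?case by simp
        next
          case (Suc n)
          have "X i \<inter> X n = {}" if "i < n" for i
            using dis that unfolding disjoint_family_on_def by auto
          then have "(\<Union>i<n. X i) \<inter> X n = {}" by auto
          then have "P (\<Union>i<n. X i) + P (X n) \<le> P ((\<Union>i<n. X i) \<union> X n)" by (rule P_add)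
          also have "(\<Union>i<n. X i) \<union> X n = (\<Union>i<Suc n. X i)" by (auto simp: lessThan_Suc)
          finally show ?case using Suc.IH by (auto intro: order_trans add_right_mono)
        qed
        show "(\<Sum>i. P (X i)) \<le> P (\<Union>i. X i)"
          by (rule suminf_le_const) (auto intro!: order_trans[OF fin] P_mono)
      next
        show "P (\<Union>i. X i) \<le> (\<Sum>i. P (X i))"
          unfolding P_def[of "\<Union>i. X i"]
        proof (rule SUP_least)
          fix B assume "B \<in> {B \<in> sets borel. B \<subseteq> (\<Union>i. X i)}"
          then have B: "B \<in> sets borel" "(\<Union>i. B \<inter> X i) = B" by auto
          have "range (\<lambda>i. B \<inter> X i) \<subseteq> sets borel" using B X by auto
          moreover have "disjoint_family (\<lambda>i. B \<inter> X i)"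
            using dis unfolding disjoint_family_on_def by auto
          ultimately have "(\<lambda>i. \<mu> (B \<inter> X i)) sums \<mu> (\<Union>i. B \<inter> X i)"
            using \<mu> unfolding signed_measure_def by blast
          then have "(\<lambda>n. \<Sum>i<n. \<mu> (B \<inter> X i)) \<longlonglongrightarrow> \<mu> B"
            unfolding B(2) sums_def .
          then have lim: "(\<lambda>n. ennreal (\<Sum>i<n. \<mu> (B \<inter> X i))) \<longlonglongrightarrow> ennreal (\<mu> B)"
            by (rule tendsto_ennrealI)
          have "ennreal (\<Sum>i<n. \<mu> (B \<inter> X i)) \<le> (\<Sum>i. P (X i))" for n
          proof -
            have "ennreal (\<Sum>i<n. \<mu> (B \<inter> X i)) \<le> ennreal (\<Sum>i<n. max 0 (\<mu> (B \<inter> X i)))"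
              by (intro ennreal_leI sum_mono) simp
            also have "\<dots> = (\<Sum>i<n. ennreal (max 0 (\<mu> (B \<inter> X i))))"
              by (simp add: sum_ennreal)
            also have "\<dots> = (\<Sum>i<n. ennreal (\<mu> (B \<inter> X i)))"
              by (simp only: ennreal_max_0)
            also have "\<dots> \<le> (\<Sum>i<n. P (X i))" using B X by (intro sum_mono P_ge) auto
            also have "\<dots> \<le> (\<Sum>i. P (X i))" by (rule sum_le_suminf) auto
            finally show ?thesis .
          qed
          then show "ennreal (\<mu> B) \<le> (\<Sum>i. P (X i))"
            by (intro LIMSEQ_le_const2[OF lim]) auto
        qed
      qed
    qed
  qed
  then show ?thesis by (simp add: P_def)
qed

lemma emeasure_total_variation:
  assumes "A \<in> sets borel"
  shows "emeasure (total_variation \<mu>) A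
           = emeasure (pos_variation \<mu>) A + emeasure (neg_variation \<mu>) A"
proof (rule emeasure_measure_of[OF total_variation_def[of \<mu>]])
  show "sets borel \<subseteq> Pow (UNIV :: 'a set)" by simp
  show "A \<in> sets (total_variation \<mu>)" using assms by simp
  show "positive (sets (total_variation \<mu>))
      (\<lambda>A. emeasure (pos_variation \<mu>) A + emeasure (neg_variation \<mu>) A)"
    by (simp add: positive_def)
  show "countably_additive (sets (total_variation \<mu>))
      (\<lambda>A. emeasure (pos_variation \<mu>) A + emeasure (neg_variation \<mu>) A)"
    by (auto simp: countably_additive_def suminf_add[symmetric] suminf_emeasure)
qed

end

(* Everything depends only on the symmetric part of the form, that is, on the Hilbert space D with
   inner product a = E~_1, on which the unit contraction operates.

   If the representation holds and B is an exceptional Borel set, then the indicator of B is a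
   quasi-continuous version of 0, so mu(B) = 0.

   Conversely, let M be one of the two variations of mu, and send each bounded u in D to its
   quasi-continuous version in L^2(M). Since M charges no exceptional set, this map is closable, so
   its adjoint is densely defined: there are k_n -> 1 in L^2(M) such that each k_n M is a bounded
   functional on D. The (alpha+1)-potential w of (k_{n+1} - k_n) M gives
   (k_{n+1} - k_n) M = alpha w m + a(w, .), where alpha w is bounded in L^1(m) by the total mass of
   the left-hand side and |w| -> 0 as alpha -> infinity. Choosing alpha large for each n and
   summing over n yields M = f m + nu. *)

theory Submission
  imports Defs
begin

section \<open>Semi-inner products on spaces of functions\<close>

text \<open>Closability rests on a Borel-Cantelli argument for capacities: versions of functions of
  norm at most 4^-n tend to 0 outside an exceptional set. To recognise such a set one must exhibit a
  nest, hence prove a density statement about all of D. A gauge \<open>e\<close> reduces this to one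
  function: increasing closed sets form a nest as soon as functions of arbitrarily small norm
  dominate \<open>e\<close> off some of them. The L^1 bound on \<alpha> w comes from testing the
  equation of w with w clipped to [-\<delta>, \<delta>] and dividing by \<delta>, an approximate
  sign of w. The contraction property makes the pairing of w with its clipping nonnegative, so that
  only the mass of the measure remains on the other side. The equation may be tested only with
  functions that have a bounded quasi-continuous version. As w is merely a limit of such functions,
  it enters as a test function through its approximants. Rates are geometric throughout: k_n -> 1 at
  rate 2^-n in L^2(M) makes the masses of the increments summable, because M is finite, and so the
  L^1 parts can be summed.\<close>

lemma quadratic_nonneg_imp:
  fixes p b q :: real
  assumes "\<And>t. 0 \<le> p + 2 * t * b + t\<^sup>2 * q" "0 \<le> q"
  shows "b\<^sup>2 \<le> p * q"
proof (cases "q = 0")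
  case True
  have "b = 0"
  proof (rule ccontr)
    assume "b \<noteq> 0"
    \<comment> \<open>At this t the affine function p + 2 t b takes the value -1.\<close>
    then show False using assms(1)[of "- (p + 1) / (2 * b)"] True by (simp add: field_simps)
  qed
  then show ?thesis using True by simp
next
  case False
  then have "q > 0" using assms(2) by simp
  then have "0 \<le> p - b\<^sup>2 / q"
    using assms(1)[of "- b / q"] by (simp add: power2_eq_square field_simps)
  then show ?thesis using \<open>q > 0\<close> by (simp add: field_simps)
qed

text \<open>This version of Riesz representation needs no completeness, and with \<open>\<epsilon> \<rightarrow> 0\<close> the
  vectors \<open>x\<close> form a Cauchy family, since their defects bound their mutual distances.\<close>

lemma approximate_riesz:
  fixes B :: "'v \<Rightarrow> 'v \<Rightarrow> real" and l :: "'v \<Rightarrow> real"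
  assumes ne: "z \<in> X" and cl: "\<And>x y t. x \<in> X \<Longrightarrow> y \<in> X \<Longrightarrow> add x t y \<in> X"
    and B: "\<And>x y t. x \<in> X \<Longrightarrow> y \<in> X \<Longrightarrow>
      B (add x t y) (add x t y) = B x x + 2 * t * B x y + t\<^sup>2 * B y y"
    and pos: "\<And>x. x \<in> X \<Longrightarrow> 0 \<le> B x x"
    and l: "\<And>x y t. x \<in> X \<Longrightarrow> y \<in> X \<Longrightarrow> l (add x t y) = l x + t * l y"
    and bnd: "\<And>x. x \<in> X \<Longrightarrow> \<bar>l x\<bar> \<le> C * sqrt (B x x)"
    and e: "0 < (e::real)"
  shows "\<exists>x\<in>X. \<forall>y\<in>X. \<bar>B x y - l y\<bar> \<le> e * sqrt (B y y)"
proof -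
  \<comment> \<open>An exact minimiser of this energy would represent l. The defect enters the
    discriminant squared, so a gap of e^2 above the infimum yields the defect e.\<close>
  define Q where "Q x = B x x - 2 * l x" for x
  have lb: "- C\<^sup>2 \<le> Q x" if "x \<in> X" for x
  proof -
    have "0 \<le> (sqrt (B x x) - C)\<^sup>2" by simp
    then have "0 \<le> B x x - 2 * (C * sqrt (B x x)) + C\<^sup>2"
      using pos[OF that] by (simp add: power2_diff algebra_simps)
    then show ?thesis using bnd[OF that] unfolding Q_def by linarith
  qed
  have bb: "bdd_below (Q ` X)" using lb by (auto intro!: bdd_belowI)
  define S where "S = Inf (Q ` X)"
  have "\<exists>q\<in>Q ` X. q < S + e\<^sup>2"
    unfolding S_def using ne e by (intro cInf_lessD) auto
  then obtain x where x: "x \<in> X" "Q x < S + e\<^sup>2" by auto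
  show ?thesis
  proof (intro bexI[OF _ x(1)] ballI)
    fix y assume y: "y \<in> X"
    have "0 \<le> e\<^sup>2 + 2 * t * (B x y - l y) + t\<^sup>2 * B y y" for t
    proof -
      have "S \<le> Q (add x t y)"
        unfolding S_def using bb cl[OF x(1) y] by (intro cInf_lower) auto
      also have "\<dots> = Q x + 2 * t * (B x y - l y) + t\<^sup>2 * B y y"
        unfolding Q_def using B[OF x(1) y] l[OF x(1) y] by (simp add: algebra_simps)
      finally show ?thesis using x(2) by linarith
    qed
    then have "(B x y - l y)\<^sup>2 \<le> e\<^sup>2 * B y y"
      by (rule quadratic_nonneg_imp) (rule pos[OF y])
    then have "sqrt ((B x y - l y)\<^sup>2) \<le> sqrt (e\<^sup>2 * B y y)"
      by (rule real_sqrt_le_mono)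
    then show "\<bar>B x y - l y\<bar> \<le> e * sqrt (B y y)"
      using e by (simp add: real_sqrt_mult)
  qed
qed

text \<open>Only positive semidefinite: vectors are functions and not classes, so the norms of L^2
  and of D vanish on functions that are zero almost everywhere.\<close>

locale semi_inner =
  fixes V :: "('a \<Rightarrow> real) set" and B :: "('a \<Rightarrow> real) \<Rightarrow> ('a \<Rightarrow> real) \<Rightarrow> real"
  assumes subspace: "linear_subspace V" and bilinear: "bilinear_form V B"
    and sym: "\<And>u v. u \<in> V \<Longrightarrow> v \<in> V \<Longrightarrow> B u v = B v u"
    and nonneg: "\<And>u. u \<in> V \<Longrightarrow> 0 \<le> B u u"
begin

definition N :: "('a \<Rightarrow> real) \<Rightarrow> real" where
  "N u = sqrt (B u u)"

lemma zero [simp]: "(\<lambda>x. 0) \<in> V"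
  and add [simp]: "u \<in> V \<Longrightarrow> v \<in> V \<Longrightarrow> (\<lambda>x. u x + v x) \<in> V"
  and scale [simp]: "u \<in> V \<Longrightarrow> (\<lambda>x. c * u x) \<in> V"
  using subspace unfolding linear_subspace_def by blast+

lemma uminus [simp]: "u \<in> V \<Longrightarrow> (\<lambda>x. - u x) \<in> V"
  using scale[of u "-1"] by simp

lemma diff [simp]: "u \<in> V \<Longrightarrow> v \<in> V \<Longrightarrow> (\<lambda>x. u x - v x) \<in> V"
  using add[of u "\<lambda>x. - v x"] by simp

lemma divide [simp]: "u \<in> V \<Longrightarrow> (\<lambda>x. u x / c) \<in> V"
  using scale[of u "1 / c"] by simp

lemma sum [simp]: "(\<And>i. i < (n::nat) \<Longrightarrow> u i \<in> V) \<Longrightarrow> (\<lambda>x. \<Sum>i<n. u i x) \<in> V"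
  by (induction n) simp_all

lemma B_add1: "u \<in> V \<Longrightarrow> v \<in> V \<Longrightarrow> w \<in> V \<Longrightarrow> B (\<lambda>x. u x + v x) w = B u w + B v w"
  and B_scale1: "u \<in> V \<Longrightarrow> w \<in> V \<Longrightarrow> B (\<lambda>x. c * u x) w = c * B u w"
  and B_add2: "u \<in> V \<Longrightarrow> v \<in> V \<Longrightarrow> w \<in> V \<Longrightarrow> B w (\<lambda>x. u x + v x) = B w u + B w v"
  and B_scale2: "u \<in> V \<Longrightarrow> w \<in> V \<Longrightarrow> B w (\<lambda>x. c * u x) = c * B w u"
  using bilinear unfolding bilinear_form_def linear_functional_def by blast+

lemma B_uminus1: "u \<in> V \<Longrightarrow> w \<in> V \<Longrightarrow> B (\<lambda>x. - u x) w = - B u w"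
  and B_uminus2: "u \<in> V \<Longrightarrow> w \<in> V \<Longrightarrow> B w (\<lambda>x. - u x) = - B w u"
  using B_scale1[of u w "-1"] B_scale2[of u w "-1"] by simp_all

lemma B_diff1: "u \<in> V \<Longrightarrow> v \<in> V \<Longrightarrow> w \<in> V \<Longrightarrow> B (\<lambda>x. u x - v x) w = B u w - B v w"
  and B_diff2: "u \<in> V \<Longrightarrow> v \<in> V \<Longrightarrow> w \<in> V \<Longrightarrow> B w (\<lambda>x. u x - v x) = B w u - B w v"
  using B_add1[of u "\<lambda>x. - v x" w] B_add2[of u "\<lambda>x. - v x" w] B_uminus1[of v w] B_uminus2[of v w]
  by simp_all

lemma B_zero: "u \<in> V \<Longrightarrow> B (\<lambda>x. 0) u = 0" "u \<in> V \<Longrightarrow> B u (\<lambda>x. 0) = 0"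
  using B_scale1[of u u 0] B_scale2[of u u 0] by simp_all

lemma B_sum1:
  assumes "\<And>i. i < (n::nat) \<Longrightarrow> u i \<in> V" "w \<in> V"
  shows "B (\<lambda>x. \<Sum>i<n. u i x) w = (\<Sum>i<n. B (u i) w)"
  using assms by (induction n) (simp_all add: B_zero B_add1)

lemmas B_simps = B_add1 B_add2 B_scale1 B_scale2 B_uminus1 B_uminus2 B_diff1 B_diff2 B_zero

lemma B_expand:
  assumes "u \<in> V" "v \<in> V"
  shows "B (\<lambda>x. u x + t * v x) (\<lambda>x. u x + t * v x) = B u u + 2 * t * B u v + t\<^sup>2 * B v v"
  using assms by (simp add: B_simps sym[of v u] power2_eq_square algebra_simps)

lemma N_nonneg [simp]: "u \<in> V \<Longrightarrow> 0 \<le> N u" and N_sq: "u \<in> V \<Longrightarrow> (N u)\<^sup>2 = B u u"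
  unfolding N_def using nonneg by auto

lemma cauchy_schwarz:
  assumes "u \<in> V" "v \<in> V" shows "\<bar>B u v\<bar> \<le> N u * N v"
proof -
  have "0 \<le> B u u + 2 * t * B u v + t\<^sup>2 * B v v" for t
    using nonneg[of "\<lambda>x. u x + t * v x"] B_expand[OF assms] assms by simp
  then have "(B u v)\<^sup>2 \<le> B u u * B v v"
    by (rule quadratic_nonneg_imp) (rule nonneg[OF assms(2)])
  then have "sqrt ((B u v)\<^sup>2) \<le> sqrt (B u u * B v v)" by (rule real_sqrt_le_mono)
  then show ?thesis by (simp add: N_def real_sqrt_mult)
qed

lemma N_scale: "u \<in> V \<Longrightarrow> N (\<lambda>x. c * u x) = \<bar>c\<bar> * N u"
  unfolding N_def by (simp add: B_simps real_sqrt_mult flip: mult.assoc)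

lemma N_uminus: "u \<in> V \<Longrightarrow> N (\<lambda>x. - u x) = N u"
  using N_scale[of u "-1"] by simp

lemma N_zero [simp]: "N (\<lambda>x. 0) = 0"
  using N_scale[of "\<lambda>x. 0" 0] by simp

lemma N_triangle:
  assumes "u \<in> V" "v \<in> V" shows "N (\<lambda>x. u x + v x) \<le> N u + N v"
proof (rule power2_le_imp_le)
  have "(N (\<lambda>x. u x + v x))\<^sup>2 = (N u)\<^sup>2 + 2 * B u v + (N v)\<^sup>2"
    using assms B_expand[of u v 1] by (simp add: N_sq)
  also have "\<dots> \<le> (N u + N v)\<^sup>2"
    using cauchy_schwarz[OF assms] by (simp add: power2_sum)
  finally show "(N (\<lambda>x. u x + v x))\<^sup>2 \<le> (N u + N v)\<^sup>2" .
qed (use assms in simp)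

lemma N_triangle_diff:
  assumes "u \<in> V" "v \<in> V" shows "N (\<lambda>x. u x - v x) \<le> N u + N v"
  using N_triangle[of u "\<lambda>x. - v x"] N_uminus[of v] assms by simp

lemma N_diff_commute: "u \<in> V \<Longrightarrow> v \<in> V \<Longrightarrow> N (\<lambda>x. u x - v x) = N (\<lambda>x. v x - u x)"
  using N_uminus[of "\<lambda>x. u x - v x"] by simp

lemma N_triangle3:
  assumes "u \<in> V" "v \<in> V" "w \<in> V"
  shows "N (\<lambda>x. u x - w x) \<le> N (\<lambda>x. u x - v x) + N (\<lambda>x. v x - w x)"
  using N_triangle[of "\<lambda>x. u x - v x" "\<lambda>x. v x - w x"] assms by simp

lemma N_le_add_diff:
  assumes "u \<in> V" "v \<in> V" shows "N u \<le> N v + N (\<lambda>x. u x - v x)"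
  using N_triangle[of v "\<lambda>x. u x - v x"] assms by simp

lemma N_sum:
  assumes "\<And>i. i < (n::nat) \<Longrightarrow> u i \<in> V"
  shows "N (\<lambda>x. \<Sum>i<n. u i x) \<le> (\<Sum>i<n. N (u i))"
  using assms
proof (induction n)
  case (Suc n)
  have "N (\<lambda>x. \<Sum>i<Suc n. u i x) = N (\<lambda>x. (\<Sum>i<n. u i x) + u n x)" by simp
  also have "\<dots> \<le> N (\<lambda>x. \<Sum>i<n. u i x) + N (u n)" using Suc.prems by (intro N_triangle) auto
  also have "\<dots> \<le> (\<Sum>i<Suc n. N (u i))" using Suc by simp
  finally show ?case .
qed simp

text \<open>The parallelogram law, in the form which shows that almost minimisers over a set closed
  under midpoints lie close to each other.\<close>

lemma midpoint_expand:
  assumes "u \<in> V" "v \<in> V"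
  shows "B (\<lambda>x. (u x + v x) / 2) (\<lambda>x. (u x + v x) / 2)
    = B u u / 2 + B v v / 2 - B (\<lambda>x. u x - v x) (\<lambda>x. u x - v x) / 4"
proof -
  define s where "s x = u x + v x" for x
  have s: "s \<in> V" using assms unfolding s_def by simp
  have "B (\<lambda>x. (1/2) * s x) (\<lambda>x. (1/2) * s x) = B s s / 4"
    using s by (simp only: B_scale1 B_scale2 scale)
  moreover have "B s s = B u u + 2 * B u v + B v v"
    unfolding s_def using B_expand[OF assms, of 1] by simp
  moreover have "B (\<lambda>x. u x - v x) (\<lambda>x. u x - v x) = B u u - 2 * B u v + B v v"
    using B_expand[OF assms, of "-1"] by simp
  ultimately show ?thesis unfolding s_def by (simp add: field_simps)
qed

lemma N_midpoint:
  assumes "u \<in> V" "v \<in> V"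
  shows "(N (\<lambda>x. (u x + v x) / 2))\<^sup>2 \<le> (N u)\<^sup>2 / 2 + (N v)\<^sup>2 / 2"
  using midpoint_expand[OF assms] nonneg[of "\<lambda>x. u x - v x"] assms
    N_sq[of "\<lambda>x. (u x + v x) / 2"] by (simp add: N_sq)

text \<open>First variation: 2 B p q is the right derivative at t = 0 of the squared norm along the
  ray. If a norm-decreasing map sends the whole ray to p, this yields a sign condition on the
  form.\<close>

lemma B_nonneg_if_N_minimal:
  assumes "p \<in> V" "q \<in> V" "\<And>t. 0 < t \<Longrightarrow> N p \<le> N (\<lambda>x. p x + t * q x)"
  shows "0 \<le> B p q"
proof (rule ccontr)
  assume "\<not> 0 \<le> B p q"
  then have neg: "B p q < 0" by simp
  \<comment> \<open>Small enough for the linear term to beat the quadratic one; the 1 covers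
    \<open>B q q = 0\<close>.\<close>
  define t where "t = - B p q / (B q q + 1)"
  have q: "0 \<le> B q q" using nonneg assms by simp
  have t: "0 < t" using neg q unfolding t_def by (simp add: divide_neg_pos)
  have "(N p)\<^sup>2 \<le> (N (\<lambda>x. p x + t * q x))\<^sup>2"
    using assms(3)[OF t] assms(1) by (intro power_mono) auto
  then have "0 \<le> t * (2 * B p q + t * B q q)"
    using B_expand[OF assms(1,2), of t] N_sq[of p] N_sq[of "\<lambda>x. p x + t * q x"] assms(1,2)
    by (simp add: power2_eq_square algebra_simps)
  then have "0 \<le> 2 * B p q + t * B q q" using t by (simp add: zero_le_mult_iff)
  moreover have "t * B q q \<le> t * (B q q + 1)" using t by simp
  moreover have "t * (B q q + 1) = - B p q" using q unfolding t_def by simp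
  ultimately show False using neg by linarith
qed

lemma B_tendsto:
  assumes "\<And>n. u n \<in> V" "w \<in> V" "v \<in> V" "(\<lambda>n. N (\<lambda>x. u n x - w x)) \<longlonglongrightarrow> 0"
  shows "(\<lambda>n. B (u n) v) \<longlonglongrightarrow> B w v"
proof -
  have "(\<lambda>n. B (u n) v - B w v) \<longlonglongrightarrow> 0"
  proof (rule Lim_null_comparison)
    show "\<forall>\<^sub>F n in sequentially. norm (B (u n) v - B w v) \<le> N (\<lambda>x. u n x - w x) * N v"
      using assms cauchy_schwarz[of "\<lambda>x. u _ x - w x" v] by (simp add: B_diff1)
    show "(\<lambda>n. N (\<lambda>x. u n x - w x) * N v) \<longlonglongrightarrow> 0" using tendsto_mult_left_zero[OF assms(4)] .
  qed
  then show ?thesis by (simp add: LIM_zero_iff)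
qed

lemma N_tendsto:
  assumes "\<And>n. u n \<in> V" "w \<in> V" "(\<lambda>n. N (\<lambda>x. u n x - w x)) \<longlonglongrightarrow> 0"
  shows "(\<lambda>n. N (u n)) \<longlonglongrightarrow> N w"
proof -
  have "(\<lambda>n. N (u n) - N w) \<longlonglongrightarrow> 0"
  proof (rule Lim_null_comparison[OF _ assms(3)])
    have "\<bar>N (u n) - N w\<bar> \<le> N (\<lambda>x. u n x - w x)" for n
      using N_le_add_diff[OF assms(1,2), of n] N_le_add_diff[OF assms(2,1), of n]
        N_diff_commute[OF assms(1,2), of n] by linarith
    then show "\<forall>\<^sub>F n in sequentially. norm (N (u n) - N w) \<le> N (\<lambda>x. u n x - w x)" by simp
  qed
  then show ?thesis by (simp add: LIM_zero_iff)
qed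

end


section \<open>Square integrable functions\<close>

lemma L2_measurable: "u \<in> L2 M \<Longrightarrow> u \<in> borel_measurable M"
  and L2_square: "u \<in> L2 M \<Longrightarrow> integrable M (\<lambda>x. (u x)\<^sup>2)"
  by (auto simp: L2_def)

lemma L2_mult:
  assumes "u \<in> L2 M" "v \<in> L2 M" shows "integrable M (\<lambda>x. u x * v x)"
proof (rule Bochner_Integration.integrable_bound)
  show "integrable M (\<lambda>x. (u x)\<^sup>2 + (v x)\<^sup>2)" using assms by (intro Bochner_Integration.integrable_add L2_square)
  show "(\<lambda>x. u x * v x) \<in> borel_measurable M"
    using assms by (intro borel_measurable_times L2_measurable)
  have "\<bar>a * b\<bar> \<le> a\<^sup>2 + b\<^sup>2" for a b :: real
  proof -
    have "2 * (\<bar>a\<bar> * \<bar>b\<bar>) \<le> a\<^sup>2 + b\<^sup>2" using sum_squares_bound[of "\<bar>a\<bar>" "\<bar>b\<bar>"] by simp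
    moreover have "0 \<le> \<bar>a\<bar> * \<bar>b\<bar>" by simp
    ultimately show ?thesis unfolding abs_mult by linarith
  qed
  then show "AE x in M. norm (u x * v x) \<le> norm ((u x)\<^sup>2 + (v x)\<^sup>2)" by simp
qed

lemma L2_bound:
  assumes "v \<in> L2 M" "u \<in> borel_measurable M" "AE x in M. \<bar>u x\<bar> \<le> \<bar>v x\<bar>"
  shows "u \<in> L2 M"
proof -
  have "integrable M (\<lambda>x. (u x)\<^sup>2)"
    using assms
    by (intro Bochner_Integration.integrable_bound[OF L2_square[OF assms(1)]])
       (auto simp: abs_le_square_iff elim!: eventually_mono)
  then show ?thesis using assms by (simp add: L2_def)
qed

lemma L2_linear: "linear_subspace (L2 M)"
  unfolding linear_subspace_def
proof (intro conjI ballI allI)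
  show "(\<lambda>x. 0) \<in> L2 M" by (simp add: L2_def)
  fix u assume u: "u \<in> L2 M"
  show "(\<lambda>x. c * u x) \<in> L2 M" for c
    using u by (auto simp: L2_def power_mult_distrib)
  fix v assume v: "v \<in> L2 M"
  have "integrable M (\<lambda>x. (u x)\<^sup>2 + (v x)\<^sup>2 + 2 * (u x * v x))"
    using u v by (intro Bochner_Integration.integrable_add integrable_mult_right L2_square L2_mult)
  then show "(\<lambda>x. u x + v x) \<in> L2 M"
    using u v by (auto simp: L2_def power2_sum algebra_simps)
qed

interpretation L2: semi_inner "L2 M" "\<lambda>u v. \<integral>x. u x * v x \<partial>M" for M
proof (unfold_locales)
  show "bilinear_form (L2 M) (\<lambda>u v. \<integral>x. u x * v x \<partial>M)"
    unfolding bilinear_form_def linear_functional_def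
    by (auto simp: distrib_left distrib_right L2_mult mult.assoc mult.left_commute)
qed (auto simp: L2_linear mult.commute)

abbreviation l2norm :: "'a measure \<Rightarrow> ('a \<Rightarrow> real) \<Rightarrow> real" where
  "l2norm \<equiv> L2.N"

lemma l2norm_eq: "l2norm M u = sqrt (\<integral>x. (u x)\<^sup>2 \<partial>M)"
  unfolding L2.N_def by (simp add: power2_eq_square)

lemma l2norm_power2: "(l2norm M u)\<^sup>2 = (\<integral>x. (u x)\<^sup>2 \<partial>M)"
  unfolding l2norm_eq by simp

lemma l2norm_mono:
  assumes "v \<in> L2 M" "u \<in> borel_measurable M" "AE x in M. \<bar>u x\<bar> \<le> \<bar>v x\<bar>"
  shows "l2norm M u \<le> l2norm M v"
  unfolding l2norm_eq using assms L2_bound[OF assms]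
  by (intro real_sqrt_le_mono integral_mono_AE L2_square)
     (auto simp: abs_le_square_iff elim!: eventually_mono)

lemma l2norm_eq_0_AE:
  assumes "u \<in> L2 M" "l2norm M u = 0" shows "AE x in M. u x = 0"
proof -
  have "(\<integral>x. (u x)\<^sup>2 \<partial>M) = 0" using assms(2) by (simp add: l2norm_eq)
  then have "AE x in M. (u x)\<^sup>2 = 0"
    using integral_nonneg_eq_0_iff_AE[OF L2_square[OF assms(1)]] by simp
  then show ?thesis by simp
qed

lemma l2norm_dominated:
  assumes u: "u \<in> L2 M" and f: "\<And>n. f n \<in> borel_measurable M"
    and le: "\<And>n. AE x in M. \<bar>f n x\<bar> \<le> \<bar>u x\<bar>" and lim: "AE x in M. (\<lambda>n. f n x) \<longlonglongrightarrow> 0"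
  shows "(\<lambda>n. l2norm M (f n)) \<longlonglongrightarrow> 0"
proof -
  have "(\<lambda>n. \<integral>x. (f n x)\<^sup>2 \<partial>M) \<longlonglongrightarrow> (\<integral>x. 0 \<partial>M)"
  proof (rule integral_dominated_convergence[where w="\<lambda>x. (u x)\<^sup>2"])
    show "AE x in M. (\<lambda>n. (f n x)\<^sup>2) \<longlonglongrightarrow> 0"
      using lim by eventually_elim (auto intro!: tendsto_eq_intros)
    show "AE x in M. norm ((f n x)\<^sup>2) \<le> (u x)\<^sup>2" for n
      using le[of n] by eventually_elim (simp add: abs_le_square_iff)
  qed (use u f in \<open>auto simp: L2_def\<close>)
  then have "(\<lambda>n. sqrt (\<integral>x. (f n x)\<^sup>2 \<partial>M)) \<longlonglongrightarrow> sqrt 0"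
    by (intro tendsto_real_sqrt) simp
  then show ?thesis by (simp add: l2norm_eq)
qed

lemma (in sigma_finite_measure) obtain_positive_L2:
  obtains \<phi> :: "'a \<Rightarrow> real" where "\<And>x. 0 < \<phi> x" "\<phi> \<in> L2 M"
proof -
  obtain \<phi> :: "'a \<Rightarrow> real" where \<phi>: "\<phi> \<in> borel_measurable M" "\<And>x. 0 < \<phi> x" "\<And>x. \<phi> x \<le> 1"
    "integrable M \<phi>" using obtain_positive_integrable_function by blast
  have "\<bar>(\<phi> x)\<^sup>2\<bar> \<le> \<bar>\<phi> x\<bar>" for x
    using \<phi>(2,3)[of x] by (simp add: power2_eq_square mult_left_le)
  then have "integrable M (\<lambda>x. (\<phi> x)\<^sup>2)"
    using \<phi>(1) by (intro Bochner_Integration.integrable_bound[OF \<phi>(4)]) auto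
  then show thesis using that[of \<phi>] \<phi>(1,2) by (simp add: L2_def)
qed

text \<open>Take a strictly positive \<open>\<phi> \<in> L\<^sup>2\<close>: its restriction to the set in question is bounded by \<open>\<bar>\<phi> - v\<bar>\<close>
  for all \<open>v\<close> vanishing there.\<close>

lemma (in sigma_finite_measure) AE_not_if_dense_vanish:
  assumes P: "Measurable.pred M P"
    and dense: "\<And>\<phi> \<epsilon>. \<phi> \<in> L2 M \<Longrightarrow> 0 < \<epsilon> \<Longrightarrow>
      \<exists>v\<in>L2 M. l2norm M (\<lambda>x. \<phi> x - v x) < \<epsilon> \<and> (AE x in M. P x \<longrightarrow> v x = 0)"
  shows "AE x in M. \<not> P x"
proof -
  obtain \<phi> where \<phi>: "\<And>x. 0 < \<phi> x" "\<phi> \<in> L2 M" using obtain_positive_L2 by blast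
  let ?g = "\<lambda>x. if P x then \<phi> x else 0"
  have gm: "?g \<in> borel_measurable M" using P L2_measurable[OF \<phi>(2)] by measurable
  have gL: "?g \<in> L2 M" by (rule L2_bound[OF \<phi>(2) gm]) auto
  have "l2norm M ?g \<le> 0 + \<epsilon>" if \<epsilon>: "0 < \<epsilon>" for \<epsilon>
  proof -
    obtain v where v: "v \<in> L2 M" "l2norm M (\<lambda>x. \<phi> x - v x) < \<epsilon>" "AE x in M. P x \<longrightarrow> v x = 0"
      using dense[OF \<phi>(2) \<epsilon>] by blast
    have "l2norm M ?g \<le> l2norm M (\<lambda>x. \<phi> x - v x)"
    proof (rule l2norm_mono[OF L2.diff[OF \<phi>(2) v(1)] gm])
      show "AE x in M. \<bar>?g x\<bar> \<le> \<bar>\<phi> x - v x\<bar>" using v(3) by eventually_elim auto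
    qed
    then show ?thesis using v(2) by simp
  qed
  then have "l2norm M ?g \<le> 0" by (rule field_le_epsilon)
  then have "l2norm M ?g = 0" using gL by (simp add: antisym)
  from l2norm_eq_0_AE[OF gL this] show ?thesis
    by eventually_elim (use \<phi>(1) in \<open>auto simp: less_le split: if_splits\<close>)
qed


section \<open>The symmetric part of a Dirichlet form\<close>

locale dirichlet_space =
  fixes m :: "'a measure" and D :: "('a \<Rightarrow> real) set" and \<E> :: "'a form"
  assumes dirichlet: "dirichlet_form m D \<E>"
begin

abbreviation a :: "('a \<Rightarrow> real) \<Rightarrow> ('a \<Rightarrow> real) \<Rightarrow> real" where
  "a \<equiv> form_plus m (sym_part \<E>) 1"

lemma D_L2: "u \<in> D \<Longrightarrow> u \<in> L2 m"
  using dirichlet unfolding dirichlet_form_def by blast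

lemma D_measurable: "u \<in> D \<Longrightarrow> u \<in> borel_measurable m"
  using D_L2 L2_measurable by blast

lemma a_eq: "a u v = sym_part \<E> u v + (\<integral>x. u x * v x \<partial>m)"
  unfolding form_plus_def by simp

lemma sym_part_nonneg: "u \<in> D \<Longrightarrow> 0 \<le> sym_part \<E> u u"
  using dirichlet unfolding dirichlet_form_def nonneg_form_def by blast

sublocale A: semi_inner D a
proof unfold_locales
  show D: "linear_subspace D" using dirichlet unfolding dirichlet_form_def by blast
  have E: "bilinear_form D \<E>" using dirichlet unfolding dirichlet_form_def by blast
  show "bilinear_form D a"
    using E unfolding bilinear_form_def linear_functional_def a_eq sym_part_def
    by (auto simp: distrib_left distrib_right L2_mult D_L2 mult.assoc mult.left_commute
        add_divide_distrib)
  show "a u v = a v u" for u v by (simp add: a_eq sym_part_def mult.commute add.commute)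
  show "0 \<le> a u u" if "u \<in> D" for u using sym_part_nonneg[OF that] by (simp add: a_eq)
qed

abbreviation nrm :: "('a \<Rightarrow> real) \<Rightarrow> real" where
  "nrm \<equiv> A.N"

lemma form_norm_eq: "form_norm m \<E> = nrm"
  by (simp add: fun_eq_iff form_norm_def A.N_def)

lemma l2norm_le: "u \<in> D \<Longrightarrow> l2norm m u \<le> nrm u"
  unfolding A.N_def L2.N_def by (simp add: a_eq sym_part_nonneg)

lemma D_cong:
  assumes "u \<in> D" "v \<in> borel_measurable m" "AE x in m. v x = u x"
  shows "v \<in> D"
  using dirichlet assms unfolding dirichlet_form_def on_classes_def by blast

lemma a_cong:
  assumes u: "u \<in> D" "u' \<in> borel_measurable m" "AE x in m. u' x = u x"
    and v: "v \<in> D" "v' \<in> borel_measurable m" "AE x in m. v' x = v x"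
  shows "a u' v' = a u v"
proof -
  note D = D_cong[OF u] D_cong[OF v]
  have E: "\<E> f' g' = \<E> f g" if "f \<in> D" "g \<in> D" "f' \<in> D" "g' \<in> D"
    "AE x in m. f' x = f x" "AE x in m. g' x = g x" for f g f' g'
    using dirichlet that unfolding dirichlet_form_def on_classes_def by blast
  have "sym_part \<E> u' v' = sym_part \<E> u v"
    unfolding sym_part_def using E[of u v u' v'] E[of v u v' u'] u v D by simp
  moreover have "(\<integral>x. u' x * v' x \<partial>m) = (\<integral>x. u x * v x \<partial>m)"
  proof (rule integral_cong_AE)
    show "AE x in m. u' x * v' x = u x * v x" using u(3) v(3) by eventually_elim simp
  qed (use u v D_measurable in auto)
  ultimately show ?thesis by (simp add: a_eq)
qed

lemma nrm_cong:
  assumes "u \<in> D" "v \<in> borel_measurable m" "AE x in m. v x = u x"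
  shows "nrm v = nrm u"
  unfolding A.N_def using a_cong[OF assms assms] by simp

section \<open>Completeness of D and consequences of weak type\<close>

lemma complete:
  assumes "\<And>n. w n \<in> D"
    and "\<And>e. 0 < e \<Longrightarrow> \<exists>k. \<forall>i\<ge>k. \<forall>j\<ge>k. nrm (\<lambda>x. w i x - w j x) < e"
  shows "\<exists>u\<in>D. (\<lambda>n. nrm (\<lambda>x. w n x - u x)) \<longlonglongrightarrow> 0"
proof -
  have "closed_form m D (sym_part \<E>)" using dirichlet unfolding dirichlet_form_def by blast
  moreover have "form_norm m (sym_part \<E>) = nrm"
    by (simp add: fun_eq_iff form_norm_def A.N_def form_plus_def sym_part_def)
  ultimately show ?thesis using assms unfolding closed_form_def by auto
qed

lemma l2norm_tendsto:
  assumes "\<And>n. w n \<in> D" "u \<in> D" "(\<lambda>n. nrm (\<lambda>x. w n x - u x)) \<longlonglongrightarrow> 0"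
  shows "(\<lambda>n. l2norm m (\<lambda>x. w n x - u x)) \<longlonglongrightarrow> 0"
  by (rule Lim_null_comparison[OF _ assms(3)])
     (use assms in \<open>auto intro!: always_eventually l2norm_le simp: D_L2\<close>)

text \<open>Minimise \<open>\<parallel>x\<parallel>\<^sup>2 + n \<parallel>x - u\<parallel>\<^sup>2\<close> (second norm in \<open>L\<^sup>2\<close>) over \<open>S\<close>: the minima increase with \<open>n\<close> and
  are bounded by \<open>C\<^sup>2\<close>, so by the parallelogram identity almost minimisers form a Cauchy sequence.
  This replaces weak compactness and Mazur's lemma.\<close>

lemma weak_closure:
  assumes S: "S \<subseteq> D" and mid: "\<And>x y. x \<in> S \<Longrightarrow> y \<in> S \<Longrightarrow> (\<lambda>t. (x t + y t) / 2) \<in> S"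
    and u: "u \<in> L2 m"
    and C: "0 \<le> C"
    and approx: "\<And>\<eta>. 0 < \<eta> \<Longrightarrow> \<exists>x\<in>S. nrm x \<le> C \<and> l2norm m (\<lambda>t. x t - u t) < \<eta>"
  shows "u \<in> D" "nrm u \<le> C" "\<And>e. 0 < e \<Longrightarrow> \<exists>x\<in>S. nrm (\<lambda>t. u t - x t) < e"
proof -
  define d where "d x = (l2norm m (\<lambda>t. x t - u t))\<^sup>2" for x
  define Q where "Q n x = (nrm x)\<^sup>2 + real n * d x" for n x
  define V where "V n = Inf (Q n ` S)" for n
  have SD: "x \<in> D" if "x \<in> S" for x using that S by blast
  have SL [simp]: "x \<in> L2 m" if "x \<in> S" for x using that S D_L2 by blast
  have Q0: "0 \<le> Q n x" for n x unfolding Q_def d_def by simp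
  have bb: "bdd_below (Q n ` S)" for n using Q0 by (auto intro!: bdd_belowI)
  have ne: "S \<noteq> {}" using approx[of 1] by auto
  have V_le: "V n \<le> Q n x" if "x \<in> S" for n x
    unfolding V_def using that bb by (intro cInf_lower) auto
  have V_C: "V n \<le> C\<^sup>2" for n
  proof (rule field_le_epsilon)
    fix e :: real assume e: "0 < e"
    obtain x where x: "x \<in> S" "nrm x \<le> C" "l2norm m (\<lambda>t. x t - u t) < sqrt (e / (real n + 1))"
      using approx[of "sqrt (e / (real n + 1))"] e by auto
    have "d x \<le> (sqrt (e / (real n + 1)))\<^sup>2"
      unfolding d_def using x u by (intro power_mono) auto
    then have "d x \<le> e / (real n + 1)" using e by simp
    then have "real n * d x \<le> real n * (e / (real n + 1))" by (rule mult_left_mono) simp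
    also have "\<dots> \<le> e" using e by (simp add: field_simps)
    finally have "Q n x \<le> C\<^sup>2 + e"
      unfolding Q_def using x SD by (intro add_mono power_mono) auto
    then show "V n \<le> C\<^sup>2 + e" using V_le[OF x(1), of n] by linarith
  qed
  have Q_mono: "Q n x \<le> Q k x" if "n \<le> k" for n k x
    unfolding Q_def d_def using that by (intro add_mono mult_right_mono) auto
  have V_mono: "V n \<le> V k" if "n \<le> k" for n k
    unfolding V_def[of k] using ne
    by (intro cInf_greatest) (auto intro: order_trans[OF V_le Q_mono[OF that]])
  have "\<exists>x\<in>S. Q n x < V n + 1 / (real n + 1)" for n
  proof -
    have "\<exists>q\<in>Q n ` S. q < V n + 1 / (real n + 1)"
      unfolding V_def using ne by (intro cInf_lessD) auto
    then show ?thesis by auto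
  qed
  then obtain x where x: "\<And>n. x n \<in> S" "\<And>n. Q n (x n) < V n + 1 / (real n + 1)" by metis
  have xD [simp]: "x n \<in> D" for n using x SD by blast
  have conv: "convergent V"
    using incseq_convergent[of V "C\<^sup>2"] V_mono V_C unfolding incseq_def convergent_def by metis
  \<comment> \<open>Parallelogram law for \<open>nrm\<close> and convexity of \<open>d\<close> at
    the midpoint, whose cost is at least \<open>V n\<close>. The element \<open>x k\<close> is
    almost optimal for the larger weight k, and lowering the weight to n only decreases its
    cost.\<close>
  have key: "(nrm (\<lambda>t. x n t - x k t))\<^sup>2 \<le> 2 * (V k - V n) + 4 / (real n + 1)" if "n \<le> k" for n k
  proof -
    let ?z = "\<lambda>t. (x n t + x k t) / 2"
    have zS: "?z \<in> S" using mid x by blast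
    have "(nrm ?z)\<^sup>2 = (nrm (x n))\<^sup>2 / 2 + (nrm (x k))\<^sup>2 / 2 - (nrm (\<lambda>t. x n t - x k t))\<^sup>2 / 4"
      using A.midpoint_expand[of "x n" "x k"] SD[OF zS] by (simp add: A.N_sq)
    moreover have "d ?z \<le> d (x n) / 2 + d (x k) / 2"
    proof -
      let ?p = "\<lambda>t. x n t - u t" and ?q = "\<lambda>t. x k t - u t"
      have pq: "?p \<in> L2 m" "?q \<in> L2 m" using u x by auto
      have "(\<lambda>t. ?z t - u t) = (\<lambda>t. (?p t + ?q t) / 2)" by (auto simp: field_simps)
      then have "d ?z = (l2norm m (\<lambda>t. (?p t + ?q t) / 2))\<^sup>2" unfolding d_def by presburger
      also have "\<dots> \<le> (l2norm m ?p)\<^sup>2 / 2 + (l2norm m ?q)\<^sup>2 / 2"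
        by (rule L2.N_midpoint[OF pq])
      finally show ?thesis unfolding d_def .
    qed
    then have "real n * d ?z \<le> real n * d (x n) / 2 + real n * d (x k) / 2"
      using mult_left_mono[of "d ?z" "d (x n) / 2 + d (x k) / 2" "real n"]
      by (simp add: distrib_left)
    ultimately have "Q n ?z \<le> Q n (x n) / 2 + Q n (x k) / 2 - (nrm (\<lambda>t. x n t - x k t))\<^sup>2 / 4"
      unfolding Q_def by (simp add: add_divide_distrib)
    moreover have "V n \<le> Q n ?z" using V_le zS by blast
    moreover have "Q n (x k) \<le> V k + 1 / (real k + 1)"
      using Q_mono[OF that, of "x k"] x(2)[of k] by linarith
    moreover have "1 / (real k + 1) \<le> 1 / (real n + 1)" using that by (intro divide_left_mono) auto
    ultimately show ?thesis using x(2)[of n] by simp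
  qed
  have "\<exists>w\<in>D. (\<lambda>n. nrm (\<lambda>t. x n t - w t)) \<longlonglongrightarrow> 0"
  proof (rule complete)
    fix e :: real assume e: "0 < e"
    have e2: "0 < e\<^sup>2 / 4" using e by simp
    from conv obtain k1 where k1: "\<And>i j. k1 \<le> i \<Longrightarrow> k1 \<le> j \<Longrightarrow> \<bar>V i - V j\<bar> < e\<^sup>2 / 4"
      using e2 unfolding Cauchy_convergent_iff[symmetric] Cauchy_def dist_real_def by metis
    obtain k2 :: nat where k2: "8 / e\<^sup>2 < real k2" using reals_Archimedean2 by blast
    have *: "nrm (\<lambda>t. x i t - x j t) < e" if "i \<le> j" "max k1 k2 \<le> i" for i j
    proof (rule power2_less_imp_less)
      have "8 / e\<^sup>2 < real i + 1" using k2 that by linarith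
      then have "4 / (real i + 1) < e\<^sup>2 / 2" using e by (simp add: field_simps)
      moreover have "\<bar>V j - V i\<bar> < e\<^sup>2 / 4" using that by (intro k1) auto
      moreover have "X < E" if "q < E / 2" "\<bar>y\<bar> < E / 4" "X \<le> 2 * y + q" for X E q y :: real
        using that by linarith
      ultimately show "(nrm (\<lambda>t. x i t - x j t))\<^sup>2 < e\<^sup>2" using key[OF that(1)] by blast
    qed (use e in simp)
    have "nrm (\<lambda>t. x i t - x j t) < e" if "max k1 k2 \<le> i" "max k1 k2 \<le> j" for i j
      using *[of i j] *[of j i] that A.N_diff_commute[of "x i" "x j"] by (cases "i \<le> j") auto
    then show "\<exists>k. \<forall>i\<ge>k. \<forall>j\<ge>k. nrm (\<lambda>t. x i t - x j t) < e" by blast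
  qed simp
  then obtain w where w: "w \<in> D" "(\<lambda>n. nrm (\<lambda>t. x n t - w t)) \<longlonglongrightarrow> 0" by blast
  have inv: "(\<lambda>n. 1 / (real n + 1)) \<longlonglongrightarrow> 0"
    using LIMSEQ_inverse_real_of_nat by (simp add: inverse_eq_divide add.commute)
  have lim_u: "(\<lambda>n. l2norm m (\<lambda>t. x n t - u t)) \<longlonglongrightarrow> 0"
  proof -
    \<comment> \<open>The cost stays below C^2 + 1, so the penalty weight n forces
      \<open>d (x n)\<close> down like 1/n.\<close>
    have "(\<lambda>n. d (x n)) \<longlonglongrightarrow> 0"
    proof (rule Lim_null_comparison)
      have "d (x n) \<le> (C\<^sup>2 + 1) * (1 / real n)" if "0 < n" for n
      proof -
        have "real n * d (x n) \<le> Q n (x n)" unfolding Q_def by simp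
        also have "\<dots> \<le> C\<^sup>2 + 1 / (real n + 1)" using V_C[of n] x(2)[of n] by linarith
        also have "\<dots> \<le> C\<^sup>2 + 1" by simp
        finally show ?thesis using that by (simp add: field_simps)
      qed
      then show "\<forall>\<^sub>F n in sequentially. norm (d (x n)) \<le> (C\<^sup>2 + 1) * (1 / real n)"
        by (intro eventually_mono[OF eventually_gt_at_top[of 0]]) (simp add: d_def)
      show "(\<lambda>n. (C\<^sup>2 + 1) * (1 / real n)) \<longlonglongrightarrow> 0"
        using tendsto_mult_right_zero[OF lim_1_over_n] .
    qed
    then have "(\<lambda>n. sqrt (d (x n))) \<longlonglongrightarrow> sqrt 0" by (rule tendsto_real_sqrt)
    then show ?thesis unfolding d_def using u x(1) by simp
  qed
  \<comment> \<open>The almost minimisers converge to w in \<open>nrm\<close> and to u in L^2, so w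
    is a version of u.\<close>
  have "l2norm m (\<lambda>t. u t - w t) \<le> l2norm m (\<lambda>t. x n t - u t) + l2norm m (\<lambda>t. x n t - w t)" for n
    using L2.N_triangle3[of u m "x n" w] L2.N_diff_commute[of u m "x n"] u w x D_L2 by simp
  then have "l2norm m (\<lambda>t. u t - w t) \<le> 0 + 0"
    by (intro LIMSEQ_le_const[OF tendsto_add[OF lim_u l2norm_tendsto[OF xD w]]]) auto
  then have "l2norm m (\<lambda>t. u t - w t) = 0"
    using L2.N_nonneg[of "\<lambda>t. u t - w t" m] u w D_L2 by (simp add: antisym)
  then have AE: "AE t in m. u t = w t"
    using l2norm_eq_0_AE[of "\<lambda>t. u t - w t" m] u w D_L2 by simp
  show uD: "u \<in> D" using D_cong[OF w(1) L2_measurable[OF u] AE] .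
  have *: "nrm (\<lambda>t. x n t - u t) = nrm (\<lambda>t. x n t - w t)" for n
  proof (rule nrm_cong)
    show "(\<lambda>t. x n t - u t) \<in> borel_measurable m" using D_measurable[OF A.diff[OF xD uD]] .
    show "AE t in m. x n t - u t = x n t - w t" using AE by eventually_elim simp
  qed (use w in simp)
  have lim: "(\<lambda>n. nrm (\<lambda>t. x n t - u t)) \<longlonglongrightarrow> 0" unfolding * by (rule w)
  show "\<exists>x\<in>S. nrm (\<lambda>t. u t - x t) < e" if "0 < e" for e
  proof -
    have "\<forall>\<^sub>F n in sequentially. nrm (\<lambda>t. x n t - u t) < e" using lim that by (rule order_tendstoD)
    then obtain n where "nrm (\<lambda>t. x n t - u t) < e" by (auto simp: eventually_sequentially)
    then show ?thesis using x(1)[of n] A.N_diff_commute[OF xD uD, of n] by auto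
  qed
  have "(nrm u)\<^sup>2 \<le> C\<^sup>2 + 0"
  proof (rule LIMSEQ_le)
    show "(\<lambda>n. (nrm (x n))\<^sup>2) \<longlonglongrightarrow> (nrm u)\<^sup>2"
      by (intro tendsto_power A.N_tendsto[OF xD uD lim])
    show "(\<lambda>n. C\<^sup>2 + 1 / (real n + 1)) \<longlonglongrightarrow> C\<^sup>2 + 0" by (intro tendsto_intros inv)
    have "(nrm (x n))\<^sup>2 \<le> Q n (x n)" for n unfolding Q_def d_def by simp
    then have "(nrm (x n))\<^sup>2 \<le> C\<^sup>2 + 1 / (real n + 1)" for n
      using V_C[of n] x(2)[of n] by (smt (verit))
    then show "\<exists>k. \<forall>n\<ge>k. (nrm (x n))\<^sup>2 \<le> C\<^sup>2 + 1 / (real n + 1)" by blast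
  qed
  then show "nrm u \<le> C" using C by (simp add: power2_le_iff_abs_le uD)
qed

text \<open>On balls of D, smallness in L^2 makes the functional \<open>a w\<close> small from
  above. Otherwise the convex set of all x with \<eta> \<le> a w x would contain bounded elements
  arbitrarily near 0 in L^2, hence by \<open>weak_closure\<close> elements arbitrarily near 0 in D,
  where Cauchy-Schwarz makes \<open>a w x\<close> small.\<close>

lemma weakly_null:
  assumes w: "w \<in> D" and "0 < \<eta>" "0 \<le> C"
  shows "\<exists>\<theta>>0. \<forall>x\<in>D. nrm x \<le> C \<longrightarrow> l2norm m x < \<theta> \<longrightarrow> a w x < \<eta>"
proof (rule ccontr)
  assume neg: "\<not> ?thesis"
  define S where "S = {x \<in> D. \<eta> \<le> a w x}"
  have SD: "S \<subseteq> D" unfolding S_def by blast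
  have "\<exists>x\<in>S. nrm (\<lambda>t. 0 - x t) < \<eta> / (nrm w + 1)"
  proof (rule weak_closure(3)[OF SD _ L2.zero \<open>0 \<le> C\<close>])
    fix x y assume "x \<in> S" "y \<in> S"
    then have xy: "x \<in> D" "y \<in> D" "\<eta> \<le> a w x" "\<eta> \<le> a w y" unfolding S_def by auto
    have "a w (\<lambda>t. (1/2) * (x t + y t)) = (1/2) * (a w x + a w y)"
      using xy w by (simp only: A.B_scale2 A.B_add2 A.add)
    then show "(\<lambda>t. (x t + y t) / 2) \<in> S" using xy unfolding S_def by simp
  next
    fix \<theta> :: real assume "0 < \<theta>"
    then obtain x where "x \<in> D" "nrm x \<le> C" "l2norm m x < \<theta>" "\<not> a w x < \<eta>" using neg by blast
    then show "\<exists>x\<in>S. nrm x \<le> C \<and> l2norm m (\<lambda>t. x t - 0) < \<theta>" unfolding S_def by auto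
  next
    show "0 < \<eta> / (nrm w + 1)" using assms A.N_nonneg[OF w] by (simp add: add_nonneg_pos)
  qed
  then obtain x where x: "x \<in> D" "\<eta> \<le> a w x" "nrm x < \<eta> / (nrm w + 1)"
    unfolding S_def by (auto simp: A.N_uminus)
  have "a w x \<le> nrm w * nrm x" using A.cauchy_schwarz[OF w x(1)] by linarith
  also have "\<dots> \<le> (nrm w + 1) * nrm x" using x by (intro mult_right_mono) auto
  also have "\<dots> < \<eta>" using x(3) A.N_nonneg[OF w] by (simp add: pos_less_divide_eq mult.commute)
  finally show False using x(2) by simp
qed

lemma series_converges:
  assumes w: "\<And>i. w i \<in> D" and s: "summable (\<lambda>i. nrm (w i))"
  shows "\<exists>W\<in>D. (\<lambda>n. nrm (\<lambda>x. (\<Sum>i<n. w i x) - W x)) \<longlonglongrightarrow> 0"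
proof -
  define p where "p n x = (\<Sum>i<n. w i x)" for n x
  have pD [simp]: "p n \<in> D" for n unfolding p_def using w by (intro A.sum) simp
  have diff: "nrm (\<lambda>x. p j x - p i x) \<le> (\<Sum>l=i..<j. nrm (w l))" if "i \<le> j" for i j
    using that
  proof (induction j rule: dec_induct)
    case base then show ?case by simp
  next
    case (step j)
    have "nrm (\<lambda>x. p (Suc j) x - p i x) \<le> nrm (\<lambda>x. p (Suc j) x - p j x) + nrm (\<lambda>x. p j x - p i x)"
      by (rule A.N_triangle3) auto
    also have "(\<lambda>x. p (Suc j) x - p j x) = w j" by (auto simp: p_def)
    finally show ?case using step by simp
  qed
  have "\<exists>W\<in>D. (\<lambda>n. nrm (\<lambda>x. p n x - W x)) \<longlonglongrightarrow> 0"
  proof (rule complete)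
    fix e :: real assume "0 < e"
    then obtain k where k: "\<And>i j. k \<le> i \<Longrightarrow> norm (\<Sum>l=i..<j. nrm (w l)) < e"
      using s unfolding summable_Cauchy by blast
    have *: "nrm (\<lambda>x. p j x - p i x) < e" if "i \<le> j" "k \<le> i" for i j
      using diff[OF that(1)] k[OF that(2), of j] by (simp add: abs_less_iff)
    have "nrm (\<lambda>x. p i x - p j x) < e" if "k \<le> i" "k \<le> j" for i j
      using *[of i j] *[of j i] that A.N_diff_commute[of "p i" "p j"] by (cases "i \<le> j") auto
    then show "\<exists>k. \<forall>i\<ge>k. \<forall>j\<ge>k. nrm (\<lambda>x. p i x - p j x) < e" by blast
  qed simp
  then show ?thesis unfolding p_def .
qed

text \<open>The countable subadditivity of capacity: one function of controlled norm dominates all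
  terms. Domination holds only almost everywhere, since convergence in D controls the partial sums
  only in L^2.\<close>

lemma dominated_series:
  assumes w: "\<And>i. w i \<in> D" "\<And>i x. 0 \<le> w i x" and s: "summable (\<lambda>i. nrm (w i))"
  shows "\<exists>W\<in>D. nrm W \<le> (\<Sum>i. nrm (w i)) \<and> (AE x in m. \<forall>i. w i x \<le> W x)"
proof -
  define p where "p n x = (\<Sum>i<n. w i x)" for n x
  have pD [simp]: "p n \<in> D" for n unfolding p_def using w by (intro A.sum) simp
  obtain W where W: "W \<in> D" "(\<lambda>n. nrm (\<lambda>x. p n x - W x)) \<longlonglongrightarrow> 0"
    using series_converges[OF w(1) s] unfolding p_def by blast
  have "nrm (p n) \<le> (\<Sum>i. nrm (w i))" for n
  proof -
    have "nrm (p n) \<le> (\<Sum>i<n. nrm (w i))" unfolding p_def using w by (intro A.N_sum) simp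
    also have "\<dots> \<le> (\<Sum>i. nrm (w i))" using s w by (intro sum_le_suminf) auto
    finally show ?thesis .
  qed
  then have 1: "nrm W \<le> (\<Sum>i. nrm (w i))"
    by (intro LIMSEQ_le_const2[OF A.N_tendsto[OF pD W]]) auto
  have "AE x in m. w i x \<le> W x" for i
  proof -
    \<comment> \<open>For n > i the partial sum \<open>p n\<close> dominates \<open>w i\<close>, so
      the excess of \<open>w i\<close> over W is at most the distance from \<open>p n\<close> to W,
      which tends to 0 in L^2.\<close>
    let ?f = "\<lambda>x. max (w i x - W x) 0"
    have dD: "(\<lambda>x. w i x - W x) \<in> D" using w(1) W(1) by (rule A.diff)
    have fL: "?f \<in> L2 m"
    proof (rule L2_bound[OF D_L2[OF dD]])
      show "?f \<in> borel_measurable m" using D_measurable[OF dD] by (intro borel_measurable_max) auto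
    qed (simp add: max_def)
    have "l2norm m ?f \<le> l2norm m (\<lambda>x. p n x - W x)" if "Suc i \<le> n" for n
    proof (rule l2norm_mono)
      have "w i x \<le> p n x" for x
        unfolding p_def using that w(2) by (intro member_le_sum) auto
      then have "\<bar>max (w i x - W x) 0\<bar> \<le> \<bar>p n x - W x\<bar>" for x
        using that by (simp add: max_def) (meson abs_ge_self diff_right_mono order_trans)
      then show "AE x in m. \<bar>?f x\<bar> \<le> \<bar>p n x - W x\<bar>" by simp
      show "(\<lambda>x. p n x - W x) \<in> L2 m" using W by (intro D_L2 A.diff) simp_all
    qed (rule L2_measurable[OF fL])
    then have "l2norm m ?f \<le> 0"
      by (intro LIMSEQ_le_const[OF l2norm_tendsto[OF pD W]]) auto
    then have "l2norm m ?f = 0" using fL by (simp add: antisym)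
    then have "AE x in m. ?f x = 0" using l2norm_eq_0_AE[OF fL] by simp
    then show ?thesis by eventually_elim (simp add: max_def split: if_splits)
  qed
  then show ?thesis using W(1) 1 by (auto simp: AE_all_countable)
qed

text \<open>X is any linear subspace, so the representing vector is only found in its closure; the
  approximants s in X are returned because w itself need not be an admissible test vector. For
  \<alpha> > 0 this solves the resolvent equation; a bound on l in \<open>nrm\<close> is also one in
  the larger norm of the shifted form.\<close>

lemma riesz:
  assumes X: "X \<subseteq> D" "(\<lambda>x. 0) \<in> X" "\<And>u v t. u \<in> X \<Longrightarrow> v \<in> X \<Longrightarrow> (\<lambda>x. u x + t * v x) \<in> X"
    and l: "\<And>u v t. u \<in> X \<Longrightarrow> v \<in> X \<Longrightarrow> l (\<lambda>x. u x + t * v x) = l u + t * l v"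
    and bnd: "\<And>u. u \<in> X \<Longrightarrow> \<bar>l u\<bar> \<le> C * nrm u" and C: "0 \<le> C" and \<alpha>: "0 \<le> \<alpha>"
  obtains w s where "w \<in> D" "\<And>v. v \<in> X \<Longrightarrow> a w v + \<alpha> * (\<integral>x. w x * v x \<partial>m) = l v"
    "\<And>n::nat. s n \<in> X" "(\<lambda>n. nrm (\<lambda>x. s n x - w x)) \<longlonglongrightarrow> 0"
proof -
  interpret B: semi_inner D "\<lambda>u v. a u v + \<alpha> * (\<integral>x. u x * v x \<partial>m)"
  proof unfold_locales
    show "linear_subspace D" by (rule A.subspace)
    show "bilinear_form D (\<lambda>u v. a u v + \<alpha> * (\<integral>x. u x * v x \<partial>m))"
      unfolding bilinear_form_def linear_functional_def
      by (simp add: A.B_simps L2.B_simps D_L2) (simp add: algebra_simps)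
    show "a u v + \<alpha> * (\<integral>x. u x * v x \<partial>m) = a v u + \<alpha> * (\<integral>x. v x * u x \<partial>m)"
      if "u \<in> D" "v \<in> D" for u v using A.sym[OF that] by (simp add: mult.commute)
    show "0 \<le> a u u + \<alpha> * (\<integral>x. u x * u x \<partial>m)" if "u \<in> D" for u
      using A.nonneg[OF that] \<alpha> by simp
  qed
  have NB: "nrm u \<le> B.N u" for u
    unfolding A.N_def B.N_def using \<alpha> by (intro real_sqrt_le_mono) simp
  define b where "b u v = a u v + \<alpha> * (\<integral>x. u x * v x \<partial>m)" for u v
  have N_b: "sqrt (b u u) = B.N u" for u unfolding b_def B.N_def ..
  have "\<exists>x\<in>X. \<forall>y\<in>X. \<bar>b x y - l y\<bar> \<le> (1/2)^n * sqrt (b y y)" for n :: nat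
  proof (rule approximate_riesz[where add="\<lambda>u t v x. u x + t * v x" and C=C and B=b])
    show "(\<lambda>x. 0) \<in> X" by (rule X)
    show "b (\<lambda>z. x z + t * y z) (\<lambda>z. x z + t * y z) = b x x + 2 * t * b x y + t\<^sup>2 * b y y"
      if "x \<in> X" "y \<in> X" for x y t
      unfolding b_def using that X(1) by (intro B.B_expand) auto
    show "0 \<le> b x x" if "x \<in> X" for x unfolding b_def using that X(1) by (intro B.nonneg) auto
    show "\<bar>l x\<bar> \<le> C * sqrt (b x x)" if "x \<in> X" for x
      using bnd[OF that] mult_left_mono[OF NB C, of x] unfolding N_b by simp
  qed (use X l in auto)
  then have "\<forall>n. \<exists>x. x \<in> X \<and> (\<forall>y\<in>X. \<bar>b x y - l y\<bar> \<le> (1/2)^n * B.N y)"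
    unfolding N_b by blast
  from choice[OF this] obtain s where s: "\<And>n. s n \<in> X"
    "\<And>n y. y \<in> X \<Longrightarrow> \<bar>b (s n) y - l y\<bar> \<le> (1/2)^n * B.N y" by blast
  have sD [simp]: "s n \<in> D" for n using s X by blast
  have close: "nrm (\<lambda>x. s i x - s j x) \<le> (1/2)^i + (1/2)^j" for i j
  proof -
    let ?y = "\<lambda>x. s i x - s j x"
    have "(\<lambda>x. s i x + (- 1) * s j x) \<in> X" by (intro X(3) s(1))
    then have y: "?y \<in> X" by simp
    then have yD: "?y \<in> D" using X by blast
    have "(B.N ?y)\<^sup>2 = b (s i) ?y - b (s j) ?y"
      using B.N_sq[OF yD] B.B_diff1[OF sD sD yD, of i j] by (simp add: b_def)
    also have "\<dots> \<le> ((1/2)^i + (1/2)^j) * B.N ?y"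
      using s(2)[OF y, of i] s(2)[OF y, of j] by (simp add: distrib_right)
    finally have "B.N ?y * B.N ?y \<le> ((1/2)^i + (1/2)^j) * B.N ?y" by (simp add: power2_eq_square)
    then have "B.N ?y \<le> (1/2)^i + (1/2)^j"
      using B.N_nonneg[OF yD] by (cases "B.N ?y = 0") (auto simp: mult_le_cancel_right)
    then show ?thesis using NB[of ?y] by linarith
  qed
  have half: "(\<lambda>n. (1/2 :: real)^n) \<longlonglongrightarrow> 0" by (rule LIMSEQ_power_zero) simp
  have "\<exists>w\<in>D. (\<lambda>n. nrm (\<lambda>x. s n x - w x)) \<longlonglongrightarrow> 0"
  proof (rule complete)
    fix e :: real assume "0 < e"
    then have "\<forall>\<^sub>F n in sequentially. (1/2 :: real)^n < e / 2"
      using half by (intro order_tendstoD) auto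
    then obtain k where k: "\<And>n. k \<le> n \<Longrightarrow> (1/2 :: real)^n < e / 2"
      by (auto simp: eventually_sequentially)
    have "nrm (\<lambda>x. s i x - s j x) < e" if "k \<le> i" "k \<le> j" for i j
      using close[of i j] k[OF that(1)] k[OF that(2)] by linarith
    then show "\<exists>k. \<forall>i\<ge>k. \<forall>j\<ge>k. nrm (\<lambda>x. s i x - s j x) < e" by blast
  qed simp
  then obtain w where w: "w \<in> D" "(\<lambda>n. nrm (\<lambda>x. s n x - w x)) \<longlonglongrightarrow> 0" by blast
  have "a w v + \<alpha> * (\<integral>x. w x * v x \<partial>m) = l v" if v: "v \<in> X" for v
  proof -
    have vD: "v \<in> D" using v X by blast
    have "(\<lambda>n. b (s n) v) \<longlonglongrightarrow> a w v + \<alpha> * (\<integral>x. w x * v x \<partial>m)"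
      unfolding b_def using w vD
      by (intro tendsto_intros A.B_tendsto L2.B_tendsto l2norm_tendsto) (auto simp: D_L2)
    moreover have "(\<lambda>n. b (s n) v - l v) \<longlonglongrightarrow> 0"
      by (rule Lim_null_comparison[of _ "\<lambda>n. (1/2)^n * B.N v"])
         (use s(2)[OF v] tendsto_mult_left_zero[OF half] in auto)
    then have "(\<lambda>n. b (s n) v) \<longlonglongrightarrow> l v" by (simp add: LIM_zero_iff)
    ultimately show ?thesis by (rule LIMSEQ_unique)
  qed
  then show ?thesis using that w s(1) by blast
qed

end


section \<open>Contractions\<close>

context dirichlet_space
begin

text \<open>Adding the two inequalities of the Dirichlet property cancels the antisymmetric part of
  the form and leaves the difference of the energies of u and of its contraction. The L^2 part
  decreases pointwise.\<close>

lemma unit_contraction: "u \<in> D \<Longrightarrow> unit_contraction u \<in> D \<and> nrm (unit_contraction u) \<le> nrm u"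
proof
  assume u: "u \<in> D"
  interpret S: semi_inner D "sym_part \<E>"
  proof unfold_locales
    show "linear_subspace D" by (rule A.subspace)
    show "bilinear_form D (sym_part \<E>)"
      using dirichlet unfolding dirichlet_form_def bilinear_form_def linear_functional_def sym_part_def
      by (auto simp: distrib_left add_divide_distrib)
    show "sym_part \<E> u v = sym_part \<E> v u" for u v by (simp add: sym_part_def add.commute)
  qed (rule sym_part_nonneg)
  let ?U = "unit_contraction u"
  have UD: "?U \<in> D"
    and *: "0 \<le> \<E> (\<lambda>x. u x + ?U x) (\<lambda>x. u x - ?U x)" "0 \<le> \<E> (\<lambda>x. u x - ?U x) (\<lambda>x. u x + ?U x)"
    using dirichlet u unfolding dirichlet_form_def by blast+
  show "?U \<in> D" by (rule UD)
  have "0 \<le> sym_part \<E> (\<lambda>x. u x + ?U x) (\<lambda>x. u x - ?U x)"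
    using * unfolding sym_part_def by simp
  then have 1: "sym_part \<E> ?U ?U \<le> sym_part \<E> u u"
    using u UD S.sym[OF u UD] by (simp add: S.B_simps)
  have "l2norm m ?U \<le> l2norm m u"
    by (rule l2norm_mono[OF D_L2[OF u] D_measurable[OF UD]]) (auto simp: unit_contraction_def)
  then have "(\<integral>x. ?U x * ?U x \<partial>m) \<le> (\<integral>x. u x * u x \<partial>m)" unfolding L2.N_def by simp
  with 1 show "nrm ?U \<le> nrm u" unfolding A.N_def by (simp add: a_eq)
qed

lemma truncate:
  assumes u: "u \<in> D" and c: "0 < c"
  shows "(\<lambda>x. min (max (u x) 0) c) \<in> D" "nrm (\<lambda>x. min (max (u x) 0) c) \<le> nrm u"
proof -
  let ?v = "\<lambda>x. (1/c) * u x"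
  have v: "?v \<in> D" using u by (rule A.scale)
  have eq: "(\<lambda>x. min (max (u x) 0) c) = (\<lambda>x. c * unit_contraction ?v x)"
    using c by (auto simp: unit_contraction_def fun_eq_iff min_def max_def field_simps)
  note U = unit_contraction[OF v]
  show "(\<lambda>x. min (max (u x) 0) c) \<in> D" unfolding eq using U by (intro A.scale) simp
  have "nrm (\<lambda>x. min (max (u x) 0) c) = c * nrm (unit_contraction ?v)"
    unfolding eq using U c A.N_scale[of "unit_contraction ?v" c] by simp
  also have "\<dots> \<le> c * nrm ?v" using U c by simp
  also have "\<dots> = nrm u" using A.N_scale[OF u, of "1/c"] c by simp
  finally show "nrm (\<lambda>x. min (max (u x) 0) c) \<le> nrm u" .
qed

text \<open>The truncations of u at heights n + 1 have norm at most \<open>nrm u\<close> and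
  converge to the positive part in L^2, so \<open>weak_closure\<close> applies.\<close>

lemma pos_part:
  assumes u: "u \<in> D"
  shows "(\<lambda>x. max (u x) 0) \<in> D" "nrm (\<lambda>x. max (u x) 0) \<le> nrm u"
proof -
  note uL = D_L2[OF u] and um = L2_measurable[OF D_L2[OF u]]
  have pL: "(\<lambda>x. max (u x) 0) \<in> L2 m"
    by (rule L2_bound[OF uL]) (use um in auto)
  have "(\<lambda>n. l2norm m (\<lambda>x. min (max (u x) 0) (real (Suc n)) - max (u x) 0)) \<longlonglongrightarrow> 0"
  proof (rule l2norm_dominated[OF uL])
    show "(\<lambda>x. min (max (u x) 0) (real (Suc n)) - max (u x) 0) \<in> borel_measurable m" for n
      using um by measurable
    show "AE x in m. (\<lambda>n. min (max (u x) 0) (real (Suc n)) - max (u x) 0) \<longlonglongrightarrow> 0"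
    proof (rule AE_I2)
      fix x
      obtain k :: nat where "u x < real k" using reals_Archimedean2 by blast
      then have "\<forall>n\<ge>k. min (max (u x) 0) (real (Suc n)) - max (u x) 0 = 0" by auto
      then show "(\<lambda>n. min (max (u x) 0) (real (Suc n)) - max (u x) 0) \<longlonglongrightarrow> 0"
        by (intro tendsto_eventually) (auto simp: eventually_sequentially)
    qed
  qed (auto simp: min_def max_def)
  note null = this
  have lim: "\<exists>n. l2norm m (\<lambda>x. min (max (u x) 0) (real (Suc n)) - max (u x) 0) < \<eta>"
    if "0 < \<eta>" for \<eta>
  proof -
    from order_tendstoD(2)[OF null that] show ?thesis by (auto simp: eventually_sequentially)
  qed
  have approx: "\<exists>x\<in>D. nrm x \<le> nrm u \<and> l2norm m (\<lambda>t. x t - max (u t) 0) < \<eta>" if \<eta>: "0 < \<eta>" for \<eta>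
  proof -
    obtain n where "l2norm m (\<lambda>x. min (max (u x) 0) (real (Suc n)) - max (u x) 0) < \<eta>"
      using lim[OF \<eta>] by blast
    then show ?thesis
      using truncate[OF u, of "real (Suc n)"]
      by (intro bexI[of _ "\<lambda>x. min (max (u x) 0) (real (Suc n))"]) auto
  qed
  have mid: "(\<lambda>t. (x t + y t) / 2) \<in> D" if "x \<in> D" "y \<in> D" for x y
    using that by (intro A.divide A.add)
  show "(\<lambda>x. max (u x) 0) \<in> D" "nrm (\<lambda>x. max (u x) 0) \<le> nrm u"
    by (rule weak_closure[OF subset_refl mid pL A.N_nonneg[OF u] approx]; assumption)+
qed

text \<open>Positive and negative part pair nonpositively. For p = max u 0 and q = u - p, every p +
  t q with t > 0 has positive part p, so \<open>pos_part\<close> makes \<open>nrm p\<close> minimal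
  on this ray and a p q is nonnegative.\<close>

lemma a_pos_part:
  assumes u: "u \<in> D"
  shows "(nrm (\<lambda>x. max (u x) 0))\<^sup>2 \<le> a u (\<lambda>x. max (u x) 0)"
proof -
  let ?p = "\<lambda>x. max (u x) 0" and ?q = "\<lambda>x. u x - max (u x) 0"
  have p: "?p \<in> D" by (rule pos_part[OF u])
  have q: "?q \<in> D" using u p by (rule A.diff)
  have "0 \<le> a ?p ?q"
  proof (rule A.B_nonneg_if_N_minimal[OF p q])
    fix t :: real assume t: "0 < t"
    have "max (?p x + t * ?q x) 0 = ?p x" for x
      using t by (cases "u x \<le> 0") (auto simp: max_def mult_le_0_iff)
    then have eq: "(\<lambda>x. max (?p x + t * ?q x) 0) = ?p" by (rule ext)
    have "(\<lambda>x. ?p x + t * ?q x) \<in> D" using p q by (intro A.add A.scale)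
    from pos_part(2)[OF this] show "nrm ?p \<le> nrm (\<lambda>x. ?p x + t * ?q x)" unfolding eq .
  qed
  then show ?thesis using u p by (simp add: A.B_diff2 A.sym[of ?p u] A.N_sq)
qed

text \<open>The same variation as for the positive part: truncation to [0, c] sends the whole ray
  from the truncated function p in direction u - p to p.\<close>

lemma a_truncate:
  assumes u: "u \<in> D" and c: "0 < c"
  shows "0 \<le> a u (\<lambda>x. min (max (u x) 0) c)"
proof -
  let ?p = "\<lambda>x. min (max (u x) 0) c" and ?q = "\<lambda>x. u x - min (max (u x) 0) c"
  have p: "?p \<in> D" by (rule truncate[OF u c])
  have q: "?q \<in> D" using u p by (rule A.diff)
  have "0 \<le> a ?p ?q"
  proof (rule A.B_nonneg_if_N_minimal[OF p q])
    fix t :: real assume t: "0 < t"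
    have "min (max (?p x + t * ?q x) 0) c = ?p x" for x
    proof -
      consider "u x \<le> 0" | "0 < u x" "u x \<le> c" | "c < u x" by linarith
      then show ?thesis
      proof cases
        case 1
        then have "t * u x \<le> 0" using t by (simp add: mult_le_0_iff)
        then show ?thesis using 1 c by (simp add: max_def min_def)
      next
        case 2
        then show ?thesis using c by (simp add: max_def min_def)
      next
        case 3
        then have "0 < t * (u x - c)" using t by simp
        then show ?thesis using 3 c by (simp add: max_def min_def)
      qed
    qed
    then have eq: "(\<lambda>x. min (max (?p x + t * ?q x) 0) c) = ?p" by (rule ext)
    have "(\<lambda>x. ?p x + t * ?q x) \<in> D" using p q by (intro A.add A.scale)
    from truncate(2)[OF this c] show "nrm ?p \<le> nrm (\<lambda>x. ?p x + t * ?q x)" unfolding eq .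
  qed
  then have "a ?p ?p \<le> a u ?p" using u p by (simp add: A.B_diff2 A.sym[of ?p u])
  then show ?thesis using A.nonneg[OF p] by simp
qed

text \<open>The clipped function is the difference of the truncations of u and -u, whence the factor
  2. The third claim is the positivity behind the L^1 bound: u pairs nonnegatively with its
  approximate sign.\<close>

lemma clip:
  assumes u: "u \<in> D" and c: "0 < c"
  shows "(\<lambda>x. max (min (u x) c) (- c)) \<in> D" "nrm (\<lambda>x. max (min (u x) c) (- c)) \<le> 2 * nrm u"
    "0 \<le> a u (\<lambda>x. max (min (u x) c) (- c))"
proof -
  have mu: "(\<lambda>x. - u x) \<in> D" using u by (rule A.uminus)
  let ?p = "\<lambda>x. min (max (u x) 0) c" and ?q = "\<lambda>x. min (max (- u x) 0) c"
  note p = truncate[OF u c] and q = truncate[OF mu c]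
  have eq: "(\<lambda>x. max (min (u x) c) (- c)) = (\<lambda>x. ?p x - ?q x)"
    using c by (auto simp: fun_eq_iff)
  show "(\<lambda>x. max (min (u x) c) (- c)) \<in> D" unfolding eq using p q by (intro A.diff)
  show "nrm (\<lambda>x. max (min (u x) c) (- c)) \<le> 2 * nrm u"
    unfolding eq using A.N_triangle_diff[OF p(1) q(1)] p(2) q(2) A.N_uminus[OF u] by linarith
  have "a u (\<lambda>x. ?p x - ?q x) = a u ?p - a u ?q" by (rule A.B_diff2[OF p(1) q(1) u])
  moreover have "a (\<lambda>x. - u x) ?q = - a u ?q" by (rule A.B_uminus1[OF u q(1)])
  ultimately show "0 \<le> a u (\<lambda>x. max (min (u x) c) (- c))"
    unfolding eq using a_truncate[OF u c] a_truncate[OF mu c] by linarith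
qed

lemma abs_value:
  assumes u: "u \<in> D"
  shows "(\<lambda>x. \<bar>u x\<bar>) \<in> D" "nrm (\<lambda>x. \<bar>u x\<bar>) \<le> 2 * nrm u"
proof -
  have mu: "(\<lambda>x. - u x) \<in> D" using u by (rule A.uminus)
  note p = pos_part[OF u] and q = pos_part[OF mu]
  have eq: "(\<lambda>x. \<bar>u x\<bar>) = (\<lambda>x. max (u x) 0 + max (- u x) 0)" by (auto simp: fun_eq_iff)
  show "(\<lambda>x. \<bar>u x\<bar>) \<in> D" unfolding eq using p(1) q(1) by (rule A.add)
  show "nrm (\<lambda>x. \<bar>u x\<bar>) \<le> 2 * nrm u"
    unfolding eq using A.N_triangle[OF p(1) q(1)] p(2) q(2) A.N_uminus[OF u] by linarith
qed


section \<open>Gauges\<close>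

text \<open>A gauge tests nests: a set is small if some function of small norm dominates the gauge on it.\<close>

definition is_gauge :: "('a \<Rightarrow> real) \<Rightarrow> bool" where
  "is_gauge e \<longleftrightarrow> e \<in> D \<and> (\<forall>x. e x \<le> 1) \<and>
     (\<forall>u\<in>D. (\<forall>x. 0 \<le> u x) \<longrightarrow> (\<forall>\<eta>>0. \<exists>c\<ge>0. \<exists>z\<in>D. nrm z \<le> nrm u \<and>
        l2norm m (\<lambda>x. z x - u x) < \<eta> \<and> (AE x in m. 0 \<le> z x \<and> z x \<le> c * e x)))"

text \<open>The gauge is \<open>min h 1\<close> for the 1-potential \<open>h\<close> of a strictly positive \<open>\<phi> \<in> L\<^sup>2\<close>. Taking the
  minimum with the 1-excessive function \<open>n h\<close> does not increase the norm.\<close>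

lemma gauge_exists:
  assumes "sigma_finite_measure m"
  obtains e where "is_gauge e"
proof -
  interpret sigma_finite_measure m by fact
  obtain \<phi> where \<phi>: "\<And>x. 0 < \<phi> x" and \<phi>L: "\<phi> \<in> L2 m" using obtain_positive_L2 by blast
  have \<phi>m: "\<phi> \<in> borel_measurable m" by (rule L2_measurable[OF \<phi>L])
  obtain h s where h: "h \<in> D" "\<And>v. v \<in> D \<Longrightarrow> a h v + 0 * (\<integral>x. h x * v x \<partial>m) = (\<integral>x. \<phi> x * v x \<partial>m)"
    "\<And>n::nat. s n \<in> D" "(\<lambda>n. nrm (\<lambda>x. s n x - h x)) \<longlonglongrightarrow> 0"
  proof (rule riesz[of D "\<lambda>v. \<integral>x. \<phi> x * v x \<partial>m" "l2norm m \<phi>" 0])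
    show "(\<lambda>x. u x + t * v x) \<in> D" if "u \<in> D" "v \<in> D" for u v t
      using that by (intro A.add A.scale)
    show "(\<integral>x. \<phi> x * (u x + t * v x) \<partial>m) = (\<integral>x. \<phi> x * u x \<partial>m) + t * (\<integral>x. \<phi> x * v x \<partial>m)"
      if "u \<in> D" "v \<in> D" for u v t
      using L2.B_add2[OF D_L2[OF that(1)] D_L2[OF A.scale[OF that(2)]] \<phi>L]
        L2.B_scale2[OF D_L2[OF that(2)] \<phi>L] by simp
    show "\<bar>\<integral>x. \<phi> x * u x \<partial>m\<bar> \<le> l2norm m \<phi> * nrm u" if "u \<in> D" for u
      using L2.cauchy_schwarz[OF \<phi>L D_L2[OF that]]
        mult_left_mono[OF l2norm_le[OF that] L2.N_nonneg[OF \<phi>L]] by linarith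
  qed (use \<phi>L in auto)
  have ah: "a h v = (\<integral>x. \<phi> x * v x \<partial>m)" if "v \<in> D" for v using h(2)[OF that] by simp
  have ah_nonneg: "0 \<le> a h v" if "v \<in> D" "\<And>x. 0 \<le> v x" for v
    unfolding ah[OF that(1)] using that(2) \<phi> by (intro Bochner_Integration.integral_nonneg) (simp add: less_imp_le)
  \<comment> \<open>Tested with the negative part of h, the equation of h has a nonnegative
    right-hand side, while by \<open>a_pos_part\<close> its left-hand side is at most minus the
    squared norm of that part.\<close>
  have h_nonneg: "AE x in m. 0 \<le> h x"
  proof -
    let ?p = "\<lambda>x. max (- h x) 0"
    have mh: "(\<lambda>x. - h x) \<in> D" using h(1) by (rule A.uminus)
    have p: "?p \<in> D" by (rule pos_part[OF mh])
    have "0 \<le> a h ?p" using p by (rule ah_nonneg) simp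
    then have "(nrm ?p)\<^sup>2 \<le> 0" using a_pos_part[OF mh] A.B_uminus1[OF h(1) p] by linarith
    then have "nrm ?p = 0" by simp
    then have "l2norm m ?p = 0" using l2norm_le[OF p] L2.N_nonneg[OF D_L2[OF p]] by linarith
    from l2norm_eq_0_AE[OF D_L2[OF p] this] show ?thesis
      by eventually_elim (simp add: max_def split: if_splits)
  qed
  \<comment> \<open>The excess of v over n h, so that v - f n v is the minimum of v and n h.\<close>
  define f where "f n v x = max (v x - real n * h x) 0" for n v x
  have f0: "0 \<le> f n v x" for n v x unfolding f_def by simp
  have fD: "f n v \<in> D" and f_a: "(nrm (f n v))\<^sup>2 \<le> a v (f n v) - real n * a h (f n v)" if v: "v \<in> D" for n v
  proof -
    have g: "(\<lambda>x. v x - real n * h x) \<in> D" using v h(1) by (intro A.diff A.scale)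
    show fD: "f n v \<in> D" unfolding f_def by (rule pos_part[OF g])
    have "(nrm (f n v))\<^sup>2 \<le> a (\<lambda>x. v x - real n * h x) (f n v)"
      using a_pos_part[OF g] unfolding f_def .
    also have "\<dots> = a v (f n v) - real n * a h (f n v)"
      using A.B_diff1[OF v A.scale[OF h(1)] fD] A.B_scale1[OF h(1) fD] by simp
    finally show "(nrm (f n v))\<^sup>2 \<le> a v (f n v) - real n * a h (f n v)" .
  qed
  \<comment> \<open>Where h \<le> 0, the excess \<open>f n v\<close> is at least v for every n.
    Hence n times the integral of \<phi> v over this set is at most n a h (f n v), which
    \<open>f_a\<close> bounds independently of n.\<close>
  have D_null: "AE x in m. h x \<le> 0 \<longrightarrow> v x = 0" if v: "v \<in> D" "\<And>x. 0 \<le> v x" for v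
  proof -
    let ?g = "\<lambda>x. \<phi> x * (if h x \<le> 0 then v x else 0)"
    have hm: "h \<in> borel_measurable m" "v \<in> borel_measurable m"
      using h(1) v(1) by (auto intro: L2_measurable D_L2)
    have "integrable m (\<lambda>x. \<phi> x * v x)" by (rule L2_mult[OF \<phi>L D_L2[OF v(1)]])
    then have gi: "integrable m ?g"
      by (rule Bochner_Integration.integrable_bound) (use hm \<phi>m in auto)
    have g0: "0 \<le> ?g x" for x using v(2) \<phi> by (simp add: less_imp_le)
    have "real n * (\<integral>x. ?g x \<partial>m) \<le> (nrm v)\<^sup>2" for n
    proof -
      let ?f = "f n v"
      have "(\<integral>x. ?g x \<partial>m) \<le> (\<integral>x. \<phi> x * ?f x \<partial>m)"
      proof (rule integral_mono[OF gi L2_mult[OF \<phi>L D_L2[OF fD[OF v(1)]]]])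
        fix x
        have "(if h x \<le> 0 then v x else 0) \<le> ?f x"
          unfolding f_def using mult_nonneg_nonpos[of "real n" "h x"] by (auto simp: max_def)
        then show "?g x \<le> \<phi> x * ?f x" using \<phi>[of x] by (intro mult_left_mono) auto
      qed
      then have "real n * (\<integral>x. ?g x \<partial>m) \<le> real n * a h ?f"
        unfolding ah[OF fD[OF v(1)]] by (intro mult_left_mono) auto
      also have "\<dots> \<le> a v ?f - (nrm ?f)\<^sup>2" using f_a[OF v(1), of n] by simp
      also have "\<dots> \<le> nrm v * nrm ?f - (nrm ?f)\<^sup>2"
        using A.cauchy_schwarz[OF v(1) fD[OF v(1)], of n] by simp
      also have "\<dots> \<le> (nrm v)\<^sup>2"
      proof -
        have "0 \<le> (nrm v - nrm ?f)\<^sup>2" by simp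
        moreover have "0 \<le> nrm v * nrm ?f" using v(1) fD by simp
        ultimately show ?thesis by (simp add: power2_diff)
      qed
      finally show ?thesis .
    qed
    then have "(\<integral>x. ?g x \<partial>m) \<le> 0"
      by (metis ex_less_of_nat_mult not_le)
    moreover have "0 \<le> (\<integral>x. ?g x \<partial>m)" by (intro Bochner_Integration.integral_nonneg g0)
    ultimately have "(\<integral>x. ?g x \<partial>m) = 0" by (rule antisym)
    then have "AE x in m. ?g x = 0" using integral_nonneg_eq_0_iff_AE[OF gi] g0 by simp
    then show ?thesis by eventually_elim (use \<phi> in \<open>auto simp: less_le split: if_splits\<close>)
  qed
  have D_null': "AE x in m. h x \<le> 0 \<longrightarrow> v x = 0" if v: "v \<in> D" for v
    using D_null[OF abs_value(1)[OF v]] by simp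
  have h_pos: "AE x in m. 0 < h x"
  proof -
    have "AE x in m. \<not> h x \<le> 0"
    proof (rule AE_not_if_dense_vanish)
      show "Measurable.pred m (\<lambda>x. h x \<le> 0)" using D_measurable[OF h(1)] by measurable
      fix \<psi> :: "'a \<Rightarrow> real" and \<epsilon> :: real
      assume \<psi>: "\<psi> \<in> L2 m" "0 < \<epsilon>"
      have "dense_in_L2 m D" using dirichlet unfolding dirichlet_form_def by blast
      then obtain v where "v \<in> D" "l2norm m (\<lambda>x. \<psi> x - v x) < \<epsilon>"
        using \<psi> unfolding dense_in_L2_def l2norm_eq by blast
      then show "\<exists>v\<in>L2 m. l2norm m (\<lambda>x. \<psi> x - v x) < \<epsilon> \<and> (AE x in m. h x \<le> 0 \<longrightarrow> v x = 0)"
        using D_null' D_L2 by blast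
    qed
    then show ?thesis by (simp add: not_le)
  qed
  define e where "e x = min (max (h x) 0) 1" for x
  have "is_gauge e"
    unfolding is_gauge_def
  proof (intro conjI ballI allI impI)
    show "e \<in> D" unfolding e_def by (rule truncate[OF h(1)]) simp
    show "e x \<le> 1" for x unfolding e_def by simp
    fix v :: "'a \<Rightarrow> real" and \<eta> :: real
    assume v: "v \<in> D" and v0: "\<forall>x. 0 \<le> v x" and \<eta>: "0 < \<eta>"
    define y where "y n x = v x - f (Suc n) v x" for n x
    \<comment> \<open>With e = min h 1 almost everywhere, (n + 1) e is the minimum of (n + 1) h and
      n + 1; the second truncation supplies the latter. \<open>Suc n\<close> keeps the height
      positive, as \<open>truncate\<close> requires.\<close>
    define z where "z n x = min (max (y n x) 0) (real (Suc n))" for n x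
    have yD: "y n \<in> D" for n unfolding y_def using v fD by (intro A.diff)
    \<comment> \<open>Since \<open>a h ?f\<close> is nonnegative, \<open>f_a\<close> gives a v f
      \<ge> |f|^2, so the expansion of |v - f|^2 is at most |v|^2 - |f|^2.\<close>
    have y_le: "nrm (y n) \<le> nrm v" for n
    proof (rule power2_le_imp_le)
      let ?f = "f (Suc n) v"
      have "(nrm (y n))\<^sup>2 = (nrm v)\<^sup>2 - 2 * a v ?f + (nrm ?f)\<^sup>2"
      proof -
        have "y n = (\<lambda>x. v x - ?f x)" by (simp add: y_def fun_eq_iff)
        then have "a (y n) (y n) = a v v - 2 * a v ?f + a ?f ?f"
          using A.B_expand[OF v fD[OF v], of "-1" "Suc n"] by simp
        then show ?thesis using A.N_sq[OF v] A.N_sq[OF fD[OF v]] A.N_sq[OF yD] by simp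
      qed
      moreover have "0 \<le> real (Suc n) * a h ?f"
        using ah_nonneg[OF fD[OF v] f0] by (intro mult_nonneg_nonneg) auto
      ultimately show "(nrm (y n))\<^sup>2 \<le> (nrm v)\<^sup>2"
        using f_a[OF v, of "Suc n"] zero_le_power2[of "nrm ?f"] by linarith
    qed (use v in simp)
    have zD: "z n \<in> D" and z_le: "nrm (z n) \<le> nrm v" for n
      unfolding z_def using truncate[OF yD, of "real (Suc n)" n] y_le[of n] by auto
    have y_eq: "y n x = min (v x) (real (Suc n) * h x)" for n x
      unfolding y_def f_def by auto
    have "(\<lambda>n. l2norm m (\<lambda>x. z n x - v x)) \<longlonglongrightarrow> 0"
    proof (rule l2norm_dominated[OF D_L2[OF v]])
      show "(\<lambda>x. z n x - v x) \<in> borel_measurable m" for n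
        using zD v by (intro L2_measurable D_L2 A.diff)
      show "AE x in m. \<bar>z n x - v x\<bar> \<le> \<bar>v x\<bar>" for n
      proof (rule AE_I2)
        fix x
        have "0 \<le> min (max (min c t) 0) k \<and> min (max (min c t) 0) k \<le> c"
          if "0 \<le> c" "0 \<le> k" for c t k :: real
          using that by (auto simp: min_def max_def)
        then have "0 \<le> z n x" "z n x \<le> v x" using v0 unfolding z_def y_eq by auto
        then show "\<bar>z n x - v x\<bar> \<le> \<bar>v x\<bar>" by linarith
      qed
      show "AE x in m. (\<lambda>n. z n x - v x) \<longlonglongrightarrow> 0"
        using h_pos
      proof eventually_elim
        fix x assume hx: "0 < h x"
        obtain k :: nat where k: "v x < real k" "v x / h x < real k"
          using reals_Archimedean2[of "max (v x) (v x / h x)"] by auto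
        have "z n x - v x = 0" if "k \<le> n" for n
        proof -
          have "v x < real (Suc n)" "v x / h x < real (Suc n)" using k that by auto
          then show ?thesis using v0 hx unfolding z_def y_eq by (auto simp: divide_less_eq)
        qed
        then show "(\<lambda>n. z n x - v x) \<longlonglongrightarrow> 0"
          by (intro tendsto_eventually) (auto simp: eventually_sequentially)
      qed
    qed
    then have "\<forall>\<^sub>F n in sequentially. l2norm m (\<lambda>x. z n x - v x) < \<eta>"
      using \<eta> by (rule order_tendstoD)
    then obtain n where n: "l2norm m (\<lambda>x. z n x - v x) < \<eta>" by (auto simp: eventually_sequentially)
    have "AE x in m. 0 \<le> z n x \<and> z n x \<le> real (Suc n) * e x"
      using h_nonneg
    proof eventually_elim
      fix x assume hx: "0 \<le> h x"
      then have "e x = min (h x) 1" unfolding e_def by simp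
      then have "real (Suc n) * e x = min (real (Suc n) * h x) (real (Suc n))"
        by (simp add: min_mult_distrib_left)
      moreover have "0 \<le> min (max (min c t) 0) k \<and> min (max (min c t) 0) k \<le> min t k"
        if "0 \<le> c" "0 \<le> t" "0 \<le> k" for c t k :: real
        using that by (auto simp: min_def max_def)
      ultimately show "0 \<le> z n x \<and> z n x \<le> real (Suc n) * e x"
        using hx v0 unfolding z_def y_eq by simp
    qed
    then show "\<exists>c\<ge>0. \<exists>z\<in>D. nrm z \<le> nrm v \<and> l2norm m (\<lambda>x. z x - v x) < \<eta> \<and>
        (AE x in m. 0 \<le> z x \<and> z x \<le> c * e x)"
      using zD z_le n by (intro exI[of _ "real (Suc n)"] conjI bexI[of _ "z n"]) auto
  qed
  then show thesis by (rule that)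
qed

end


section \<open>Nests and quasi-continuous functions\<close>

locale topological_dirichlet_space = dirichlet_space m D \<E>
  for m :: "'a::topological_space measure" and D :: "('a \<Rightarrow> real) set" and \<E> :: "'a form" +
  assumes sets_m: "sets m = sets borel" and sigma_finite: "sigma_finite_measure m"
begin

section \<open>The gauge criterion for nests\<close>

definition e :: "'a \<Rightarrow> real" where
  "e = (SOME e. is_gauge e)"

lemma gauge_e: "is_gauge e"
proof -
  obtain e' where "is_gauge e'" using gauge_exists[OF sigma_finite] by blast
  then show ?thesis unfolding e_def by (rule someI[of is_gauge])
qed

lemma e_D: "e \<in> D" and e_le_1: "e x \<le> 1"
  using gauge_e unfolding is_gauge_def by auto

lemma gauge_approx:
  assumes "u \<in> D" "\<And>x. 0 \<le> u x" "0 < \<eta>"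
  obtains c z where "0 \<le> c" "z \<in> D" "nrm z \<le> nrm u" "l2norm m (\<lambda>x. z x - u x) < \<eta>"
    "AE x in m. 0 \<le> z x \<and> z x \<le> c * e x"
  using gauge_e assms unfolding is_gauge_def by blast

text \<open>Some v vanishing off \<open>F k\<close> is close to e in D, and e - v is a small
  function that agrees with e off \<open>F k\<close>.\<close>

lemma nest_gauge:
  assumes "nest m D \<E> F" "0 < \<eta>"
  shows "\<exists>k. \<exists>w\<in>D. nrm w < \<eta> \<and> (AE x in m. x \<notin> F k \<longrightarrow> e x \<le> w x)"
proof -
  have "form_dense m D \<E> (\<Union>k. {u \<in> D. AE x in m. x \<notin> F k \<longrightarrow> u x = 0})"
    using assms(1) unfolding nest_def by blast
  then obtain v k where v: "v \<in> D" "AE x in m. x \<notin> F k \<longrightarrow> v x = 0" "nrm (\<lambda>x. e x - v x) < \<eta>"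
    using e_D assms(2) unfolding form_dense_def form_norm_eq by blast
  from v(2) have "AE x in m. x \<notin> F k \<longrightarrow> e x \<le> e x - v x" by eventually_elim auto
  then show ?thesis using v e_D A.diff[OF e_D v(1)] by blast
qed

text \<open>The converse of \<open>nest_gauge\<close>. A nonnegative u is close in L^2 to some z
  \<le> c e; if w dominates e off \<open>G k\<close>, the positive part of z - c w vanishes there.
  This approximates u only in L^2, but with bounded norm, so \<open>weak_closure\<close> gives
  approximation in D.\<close>

lemma nest_if_gauge_small:
  assumes closed: "\<And>k. closed (G k)" and inc: "incseq G"
    and small: "\<And>\<eta>. 0 < \<eta> \<Longrightarrow> \<exists>k. \<exists>w\<in>D. nrm w < \<eta> \<and> (AE x in m. x \<notin> G k \<longrightarrow> e x \<le> w x)"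
  shows "nest m D \<E> G"
proof -
  define S where "S = (\<Union>k. {u \<in> D. AE x in m. x \<notin> G k \<longrightarrow> u x = 0})"
  have S_lin: "(\<lambda>x. s * u x + t * v x) \<in> S" if uv: "u \<in> S" "v \<in> S" for u v s t
  proof -
    obtain k l where k: "u \<in> D" "AE x in m. x \<notin> G k \<longrightarrow> u x = 0"
      and l: "v \<in> D" "AE x in m. x \<notin> G l \<longrightarrow> v x = 0" using uv unfolding S_def by blast
    have G: "G k \<subseteq> G (max k l)" "G l \<subseteq> G (max k l)" using inc unfolding incseq_def by auto
    have "AE x in m. x \<notin> G (max k l) \<longrightarrow> s * u x + t * v x = 0"
      using k(2) l(2) by eventually_elim (use G in auto)
    moreover have "(\<lambda>x. s * u x + t * v x) \<in> D" using k(1) l(1) by (intro A.add A.scale)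
    ultimately show ?thesis unfolding S_def by blast
  qed
  have SD: "S \<subseteq> D" unfolding S_def by blast
  have pos: "\<exists>x\<in>S. nrm (\<lambda>t. u t - x t) < \<epsilon>"
    if u: "u \<in> D" "\<And>x. 0 \<le> u x" and \<epsilon>: "0 < \<epsilon>" for u \<epsilon>
  proof (rule weak_closure(3)[OF SD _ D_L2[OF u(1)] _ _ \<epsilon>])
    show "(\<lambda>t. (x t + y t) / 2) \<in> S" if "x \<in> S" "y \<in> S" for x y
      using S_lin[OF that, of "1/2" "1/2"] by (simp add: add_divide_distrib)
    show "0 \<le> nrm u + 1" using u(1) by (intro add_nonneg_nonneg A.N_nonneg) auto
    fix \<eta> :: real assume \<eta>: "0 < \<eta>"
    obtain c z where z: "0 \<le> c" "z \<in> D" "nrm z \<le> nrm u" "l2norm m (\<lambda>x. z x - u x) < \<eta> / 2"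
      "AE x in m. 0 \<le> z x \<and> z x \<le> c * e x"
      by (rule gauge_approx[OF u half_gt_zero[OF \<eta>]])
    \<comment> \<open>The 1 keeps the norm of the approximant below \<open>nrm u + 1\<close>; \<eta>
      / 2 is the share of c w in the L^2 error, the other half being that of z.\<close>
    have "0 < min 1 (\<eta> / 2) / (c + 1)" using \<eta> z(1) by simp
    then obtain k w where w: "w \<in> D" "nrm w < min 1 (\<eta> / 2) / (c + 1)"
      "AE x in m. x \<notin> G k \<longrightarrow> e x \<le> w x" using small by blast
    have cw: "c * nrm w \<le> min 1 (\<eta> / 2)"
    proof -
      have "c * nrm w \<le> (c + 1) * nrm w" using w(1) by (intro mult_right_mono) auto
      also have "\<dots> \<le> min 1 (\<eta> / 2)" using w(2) z(1) by (simp add: pos_less_divide_eq mult.commute)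
      finally show ?thesis .
    qed
    have cwD: "(\<lambda>x. c * w x) \<in> D" using w(1) by (rule A.scale)
    have cwN: "nrm (\<lambda>x. c * w x) \<le> min 1 (\<eta> / 2)" using cw z(1) A.N_scale[OF w(1), of c] by simp
    have g: "(\<lambda>x. z x - c * w x) \<in> D" using z(2) cwD by (rule A.diff)
    let ?x = "\<lambda>x. max (z x - c * w x) 0"
    note x = pos_part[OF g]
    have "AE x in m. x \<notin> G k \<longrightarrow> ?x x = 0"
      using z(5) w(3)
    proof eventually_elim
      fix x assume *: "0 \<le> z x \<and> z x \<le> c * e x" "x \<notin> G k \<longrightarrow> e x \<le> w x"
      show "x \<notin> G k \<longrightarrow> ?x x = 0"
      proof
        assume "x \<notin> G k"
        then have "c * e x \<le> c * w x" using * z(1) by (intro mult_left_mono) auto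
        then show "?x x = 0" using * by simp
      qed
    qed
    then have "?x \<in> S" using x(1) unfolding S_def by blast
    moreover have "nrm ?x \<le> nrm u + 1"
      using x(2) A.N_triangle_diff[OF z(2) cwD] cwN z(3) by linarith
    moreover have "l2norm m (\<lambda>t. ?x t - u t) < \<eta>"
    proof -
      have "l2norm m (\<lambda>t. ?x t - z t) \<le> l2norm m (\<lambda>x. c * w x)"
      proof (rule l2norm_mono[OF D_L2[OF cwD] L2_measurable[OF D_L2[OF A.diff[OF x(1) z(2)]]]])
        show "AE t in m. \<bar>?x t - z t\<bar> \<le> \<bar>c * w t\<bar>" using z(5) by eventually_elim auto
      qed
      then have "l2norm m (\<lambda>t. ?x t - z t) \<le> \<eta> / 2" using l2norm_le[OF cwD] cwN by linarith
      then show ?thesis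
        using L2.N_triangle3[OF D_L2[OF x(1)] D_L2[OF z(2)] D_L2[OF u(1)]] z(4) by linarith
    qed
    ultimately show "\<exists>x\<in>S. nrm x \<le> nrm u + 1 \<and> l2norm m (\<lambda>t. x t - u t) < \<eta>" by blast
  qed
  have "\<exists>v\<in>S. nrm (\<lambda>x. u x - v x) < \<epsilon>" if u: "u \<in> D" and \<epsilon>: "0 < \<epsilon>" for u \<epsilon>
  proof -
    let ?p = "\<lambda>x. max (u x) 0" and ?q = "\<lambda>x. max (- u x) 0"
    have pq: "?p \<in> D" "?q \<in> D" using pos_part(1)[OF u] pos_part(1)[OF A.uminus[OF u]] by auto
    obtain v where v: "v \<in> S" "nrm (\<lambda>x. ?p x - v x) < \<epsilon> / 2" using pos[OF pq(1), of "\<epsilon> / 2"] \<epsilon> by auto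
    obtain w where w: "w \<in> S" "nrm (\<lambda>x. ?q x - w x) < \<epsilon> / 2" using pos[OF pq(2), of "\<epsilon> / 2"] \<epsilon> by auto
    have vw: "v \<in> D" "w \<in> D" using v w SD by auto
    have "(\<lambda>x. u x - (v x - w x)) = (\<lambda>x. (?p x - v x) - (?q x - w x))" by (auto simp: fun_eq_iff)
    then have "nrm (\<lambda>x. u x - (v x - w x)) \<le> nrm (\<lambda>x. ?p x - v x) + nrm (\<lambda>x. ?q x - w x)"
      using A.N_triangle_diff[OF A.diff[OF pq(1) vw(1)] A.diff[OF pq(2) vw(2)]] by simp
    then show ?thesis
      using v w S_lin[OF v(1) w(1), of 1 "-1"] by (intro bexI[of _ "\<lambda>x. v x - w x"]) auto
  qed
  then have "form_dense m D \<E> S" using SD unfolding form_dense_def form_norm_eq by blast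
  then show ?thesis using closed inc unfolding nest_def S_def by blast
qed

lemma nest_UNIV: "nest m D \<E> (\<lambda>k. UNIV)"
  by (rule nest_if_gauge_small) (auto simp: incseq_def intro!: bexI[of _ "\<lambda>x. 0"])

text \<open>In terms of the gauge, an intersection costs only the sum of two dominating functions.
  Absolute values let each summand dominate alone; they cost a factor 2 each, hence \<eta> /
  4.\<close>

lemma nest_Int:
  assumes F: "nest m D \<E> F" and G: "nest m D \<E> G"
  shows "nest m D \<E> (\<lambda>k. F k \<inter> G k)"
proof (rule nest_if_gauge_small)
  have FG: "closed (F k)" "closed (G k)" "incseq F" "incseq G" for k
    using F G unfolding nest_def by auto
  show "closed (F k \<inter> G k)" for k using FG by (intro closed_Int)
  show inc: "incseq (\<lambda>k. F k \<inter> G k)" using FG(3,4) unfolding incseq_def by blast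
  fix \<eta> :: real assume "0 < \<eta>"
  then have \<eta>: "0 < \<eta> / 4" by simp
  obtain k v where v: "v \<in> D" "nrm v < \<eta> / 4" "AE x in m. x \<notin> F k \<longrightarrow> e x \<le> v x"
    using nest_gauge[OF F \<eta>] by blast
  obtain l w where w: "w \<in> D" "nrm w < \<eta> / 4" "AE x in m. x \<notin> G l \<longrightarrow> e x \<le> w x"
    using nest_gauge[OF G \<eta>] by blast
  let ?u = "\<lambda>x. \<bar>v x\<bar> + \<bar>w x\<bar>"
  note av = abs_value[OF v(1)] and aw = abs_value[OF w(1)]
  have FG': "F k \<subseteq> F (max k l)" "G l \<subseteq> G (max k l)" using FG(3,4) unfolding incseq_def by auto
  have "nrm ?u < \<eta>" using A.N_triangle[OF av(1) aw(1)] av(2) aw(2) v(2) w(2) by linarith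
  moreover have "AE x in m. x \<notin> F (max k l) \<inter> G (max k l) \<longrightarrow> e x \<le> ?u x"
    using v(3) w(3) by eventually_elim (use FG' in \<open>auto simp: abs_if split: if_splits\<close>)
  ultimately show "\<exists>k. \<exists>w\<in>D. nrm w < \<eta> \<and> (AE x in m. x \<notin> F k \<inter> G k \<longrightarrow> e x \<le> w x)"
    using A.add[OF av(1) aw(1)] by blast
qed

text \<open>D is dense in L^2, and the members of D that vanish off some \<open>F k\<close> are
  dense in D; all of these vanish on the intersection of the complements. That intersection is
  Borel, while N may not be.\<close>

lemma exceptional_AE:
  assumes "exceptional m D \<E> N"
  shows "AE x in m. x \<notin> N"
proof -
  obtain F where F: "nest m D \<E> F" "N \<subseteq> (\<Inter>k. - F k)"
    using assms unfolding exceptional_def by blast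
  let ?N = "\<Inter>k. - F k"
  have "closed (F k)" for k using F(1) unfolding nest_def by blast
  then have N: "?N \<in> sets m" unfolding sets_m by (intro sets.countable_INT) auto
  interpret sigma_finite_measure m by (rule sigma_finite)
  have "AE x in m. \<not> x \<in> ?N"
  proof (rule AE_not_if_dense_vanish)
    show "Measurable.pred m (\<lambda>x. x \<in> ?N)" using N by (rule pred_sets2) measurable
    fix \<phi> :: "'a \<Rightarrow> real" and \<epsilon> :: real
    assume \<phi>: "\<phi> \<in> L2 m" and \<epsilon>: "0 < \<epsilon>"
    have "dense_in_L2 m D" using dirichlet unfolding dirichlet_form_def by blast
    then obtain u where u: "u \<in> D" "l2norm m (\<lambda>x. \<phi> x - u x) < \<epsilon> / 2"
      using \<phi> half_gt_zero[OF \<epsilon>] unfolding dense_in_L2_def l2norm_eq by blast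
    obtain v k where v: "v \<in> D" "AE x in m. x \<notin> F k \<longrightarrow> v x = 0" "nrm (\<lambda>x. u x - v x) < \<epsilon> / 2"
      using F(1) u(1) half_gt_zero[OF \<epsilon>] unfolding nest_def form_dense_def form_norm_eq by blast
    note uv = D_L2[OF u(1)] D_L2[OF v(1)]
    have "l2norm m (\<lambda>x. \<phi> x - v x) < \<epsilon>"
      using L2.N_triangle3[OF \<phi> uv] l2norm_le[OF A.diff[OF u(1) v(1)]] u(2) v(3) by linarith
    moreover have "AE x in m. x \<in> ?N \<longrightarrow> v x = 0" using v(2) by eventually_elim auto
    ultimately show "\<exists>v\<in>L2 m. l2norm m (\<lambda>x. \<phi> x - v x) < \<epsilon> \<and> (AE x in m. x \<in> ?N \<longrightarrow> v x = 0)"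
      using uv(2) by blast
  qed
  then show ?thesis by eventually_elim (use F(2) in auto)
qed

text \<open>The graph of the passage to quasi-continuous versions, a relation because versions are
  not unique. Boundedness of g makes v essentially bounded, so these are the pairs over which the
  representation ranges.\<close>

definition bqc :: "('a \<Rightarrow> real) \<Rightarrow> ('a \<Rightarrow> real) \<Rightarrow> bool" where
  "bqc v g \<longleftrightarrow> v \<in> D \<and> g \<in> borel_measurable borel \<and> bounded (range g) \<and> qc_version m D \<E> v g"

lemma bqc_D: "bqc v g \<Longrightarrow> v \<in> D"
  and bqc_measurable: "bqc v g \<Longrightarrow> g \<in> borel_measurable borel"
  and bqc_qc: "bqc v g \<Longrightarrow> qc_version m D \<E> v g"
  unfolding bqc_def by auto

lemma bqc_bounded:
  assumes "bqc v g" obtains C where "0 \<le> C" "\<And>x. \<bar>g x\<bar> \<le> C"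
proof -
  obtain C where "\<forall>y\<in>range g. norm y \<le> C" using assms unfolding bqc_def bounded_iff by blast
  then show thesis using that[of "max C 0"] by (auto simp: le_max_iff_disj)
qed

lemma bqcI:
  assumes "v \<in> D" "g \<in> borel_measurable borel" "\<And>x. \<bar>g x\<bar> \<le> C"
    "nest m D \<E> F" "\<And>k. continuous_on (F k) g" "AE x in m. g x = v x"
  shows "bqc v g"
  unfolding bqc_def qc_version_def quasi_continuous_def bounded_iff using assms by auto

lemma bqc_zero: "bqc (\<lambda>x. 0) (\<lambda>x. 0)"
  by (rule bqcI[OF _ _ _ nest_UNIV]) auto

lemma bqc_linear:
  assumes u: "bqc u g" and v: "bqc v h"
  shows "bqc (\<lambda>x. u x + t * v x) (\<lambda>x. g x + t * h x)"
proof -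
  obtain F where F: "nest m D \<E> F" "\<And>k. continuous_on (F k) g" "AE x in m. g x = u x"
    using u unfolding bqc_def qc_version_def quasi_continuous_def by blast
  obtain G where G: "nest m D \<E> G" "\<And>k. continuous_on (G k) h" "AE x in m. h x = v x"
    using v unfolding bqc_def qc_version_def quasi_continuous_def by blast
  obtain C where C: "0 \<le> C" "\<And>x. \<bar>g x\<bar> \<le> C" using bqc_bounded[OF u] by blast
  obtain C' where C': "0 \<le> C'" "\<And>x. \<bar>h x\<bar> \<le> C'" using bqc_bounded[OF v] by blast
  show ?thesis
  proof (rule bqcI[OF _ _ _ nest_Int[OF F(1) G(1)]])
    show "(\<lambda>x. u x + t * v x) \<in> D" using u v by (intro A.add A.scale bqc_D)
    show "(\<lambda>x. g x + t * h x) \<in> borel_measurable borel"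
      using bqc_measurable[OF u] bqc_measurable[OF v] by measurable
    have "\<bar>g x + t * h x\<bar> \<le> \<bar>g x\<bar> + \<bar>t * h x\<bar>" for x by (rule abs_triangle_ineq)
    also have "\<bar>g x\<bar> + \<bar>t * h x\<bar> \<le> C + \<bar>t\<bar> * C'" for x
      unfolding abs_mult using C C' by (intro add_mono mult_left_mono) auto
    finally show "\<bar>g x + t * h x\<bar> \<le> C + \<bar>t\<bar> * C'" for x .
    show "continuous_on (F k \<inter> G k) (\<lambda>x. g x + t * h x)" for k
      using continuous_on_subset[OF F(2), of "F k \<inter> G k" k]
        continuous_on_subset[OF G(2), of "F k \<inter> G k" k]
      by (intro continuous_intros) auto
    show "AE x in m. g x + t * h x = u x + t * v x" using F(3) G(3) by eventually_elim simp
  qed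
qed

lemma bqc_diff: "bqc u g \<Longrightarrow> bqc v h \<Longrightarrow> bqc (\<lambda>x. u x - v x) (\<lambda>x. g x - h x)"
  using bqc_linear[of u g v h "-1"] by simp

lemma bqc_clip:
  assumes u: "bqc u g" and c: "0 < c"
  shows "bqc (\<lambda>x. max (min (u x) c) (- c)) (\<lambda>x. max (min (g x) c) (- c))"
proof -
  obtain F where F: "nest m D \<E> F" "\<And>k. continuous_on (F k) g" "AE x in m. g x = u x"
    using u unfolding bqc_def qc_version_def quasi_continuous_def by blast
  show ?thesis
  proof (rule bqcI[OF _ _ _ F(1)])
    show "(\<lambda>x. max (min (u x) c) (- c)) \<in> D" using bqc_D[OF u] c by (rule clip)
    show "(\<lambda>x. max (min (g x) c) (- c)) \<in> borel_measurable borel"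
      using bqc_measurable[OF u] by measurable
    show "\<bar>max (min (g x) c) (- c)\<bar> \<le> c" for x using c by auto
    show "continuous_on (F k) (\<lambda>x. max (min (g x) c) (- c))" for k
      using F(2) by (intro continuous_on_max continuous_on_min continuous_on_const)
    show "AE x in m. max (min (g x) c) (- c) = max (min (u x) c) (- c)"
      using F(3) by eventually_elim simp
  qed
qed

text \<open>The sets \<open>{\<bar>g n\<bar> > 2\<^sup>-\<^sup>n}\<close> have capacity at most \<open>4\<^sup>n \<parallel>v n\<parallel>\<^sup>2\<close>. Intersecting their complements with
  suitable members of the nests of the \<open>g n\<close> makes them closed.\<close>

lemma limsup_exceptional:
  fixes v g :: "nat \<Rightarrow> 'a \<Rightarrow> real"
  assumes v: "\<And>n. v n \<in> D" "\<And>n. nrm (v n) \<le> (1/4)^n" and g: "\<And>n. qc_version m D \<E> (v n) (g n)"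
  shows "exceptional m D \<E> {x. \<forall>k. \<exists>n\<ge>k. (1/2)^n < \<bar>g n x\<bar>}"
proof -
  have "\<exists>F. nest m D \<E> F \<and> (\<forall>k. continuous_on (F k) (g n))" for n
    using g[of n] unfolding qc_version_def quasi_continuous_def by blast
  then obtain F where F: "\<And>n. nest m D \<E> (F n)" "\<And>n k. continuous_on (F n k) (g n)" by metis
  have Fcl: "closed (F n k)" for n k using F(1)[of n] unfolding nest_def by blast
  \<comment> \<open>The pair consists of an index into the nest of \<open>g n\<close> and a function
    dominating e off the corresponding set. Norm 2^-(n + k) keeps the total small after summing over
    n and lets it tend to 0 in k.\<close>
  define P where "P n k p \<longleftrightarrow> snd p \<in> D \<and> nrm (snd p) < (1/2)^(n + k) \<and>
    (AE x in m. x \<notin> F n (fst p) \<longrightarrow> e x \<le> snd p x)" for n k p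
  have "\<exists>p. P n k p" for n k
    using nest_gauge[OF F(1)[of n], of "(1/2)^(n + k)"] unfolding P_def by auto
  then obtain p where p: "\<And>n k. P n k (p n k)" by metis
  define L w where "L n k = fst (p n k)" and "w n k = snd (p n k)" for n k
  have w: "w n k \<in> D" "nrm (w n k) < (1/2)^(n + k)"
    "AE x in m. x \<notin> F n (L n k) \<longrightarrow> e x \<le> w n k x" for n k
    using p[of n k] unfolding P_def L_def w_def by auto
  define H where "H k = (\<Inter>n\<in>{k..}. {x \<in> F n (L n k). \<bar>g n x\<bar> \<le> (1/2)^n})" for k
  \<comment> \<open>The unions enforce monotonicity: \<open>H\<close> need not increase, because the
    indices \<open>L n k\<close> are chosen independently for different k.\<close>
  define G where "G k = (\<Union>j\<le>k. H j)" for k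
  have H: "closed (H k)" for k
    unfolding H_def
  proof (intro closed_INT ballI)
    fix n
    have "{x \<in> F n (L n k). \<bar>g n x\<bar> \<le> (1/2)^n} = g n -` {- ((1/2)^n)..(1/2)^n} \<inter> F n (L n k)"
      by (auto simp: abs_le_iff)
    then show "closed {x \<in> F n (L n k). \<bar>g n x\<bar> \<le> (1/2)^n}"
      using closed_vimage_Int[OF closed_atLeastAtMost F(2) Fcl] by simp
  qed
  have W: "\<exists>W\<in>D. nrm W \<le> 8 * (1/2)^k \<and> (AE x in m. x \<notin> H k \<longrightarrow> e x \<le> W x)" for k
  proof -
    \<comment> \<open>Outside \<open>H k\<close> some n = i + k fails: if |g n| > 2^-n, the first
      summand is almost everywhere at least 1 and so dominates e; if the point leaves
      \<open>F n (L n k)\<close>, the second one does.\<close>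
    define y where "y i x = 2^(i + k) * \<bar>v (i + k) x\<bar> + \<bar>w (i + k) k x\<bar>" for i x
    note av = abs_value[OF v(1)] and aw = abs_value[OF w(1)]
    have yD: "y i \<in> D" for i unfolding y_def using av(1) aw(1) by (intro A.add A.scale)
    have y0: "0 \<le> y i x" for i x unfolding y_def by simp
    \<comment> \<open>Both summands contribute 2 * 2^-(i + k), the 2 being the cost of
      \<open>abs_value\<close>; summing over i turns the 4 into 8.\<close>
    have y_le: "nrm (y i) \<le> 4 * (1/2)^k * (1/2)^i" for i
    proof -
      have "nrm (y i) \<le> 2^(i + k) * nrm (\<lambda>x. \<bar>v (i + k) x\<bar>) + nrm (\<lambda>x. \<bar>w (i + k) k x\<bar>)"
        unfolding y_def
        using A.N_triangle[OF A.scale[OF av(1)] aw(1), of "2^(i + k)" "i + k" "i + k" k]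
          A.N_scale[OF av(1), of "2^(i + k)" "i + k"] by simp
      also have "\<dots> \<le> 2^(i + k) * (2 * (1/4)^(i + k)) + 2 * (1/2)^(i + k)"
      proof (intro add_mono mult_left_mono)
        show "nrm (\<lambda>x. \<bar>v (i + k) x\<bar>) \<le> 2 * (1/4)^(i + k)"
          using av(2)[of "i + k"] v(2)[of "i + k"] by linarith
        have "(1/2 :: real)^(i + k + k) \<le> (1/2)^(i + k)" by (rule power_decreasing) auto
        then show "nrm (\<lambda>x. \<bar>w (i + k) k x\<bar>) \<le> 2 * (1/2)^(i + k)"
          using aw(2)[of "i + k" k] w(2)[of "i + k" k] by linarith
      qed simp
      also have "2^(i + k) * (2 * (1/4)^(i + k)) = 2 * (1/2 :: real)^(i + k)"
        by (simp add: power_divide power_mult_distrib[symmetric] field_simps)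
      finally show ?thesis by (simp add: power_add mult_ac)
    qed
    have sm: "summable (\<lambda>i. 4 * (1/2 :: real)^k * (1/2)^i)" by (intro summable_mult summable_geometric) simp
    have ys: "summable (\<lambda>i. nrm (y i))"
      by (rule summable_comparison_test'[OF sm, of 0]) (use y_le yD in auto)
    from dominated_series[OF yD y0 ys] obtain W
      where W: "W \<in> D" "nrm W \<le> (\<Sum>i. nrm (y i))" "AE x in m. \<forall>i. y i x \<le> W x" by blast
    have "(\<Sum>i. nrm (y i)) \<le> (\<Sum>i. 4 * (1/2)^k * (1/2)^i)" by (intro suminf_le y_le ys sm)
    also have "\<dots> = 8 * (1/2)^k" by (simp add: suminf_mult suminf_geometric)
    finally have "nrm W \<le> 8 * (1/2)^k" using W(2) by linarith
    moreover have "AE x in m. x \<notin> H k \<longrightarrow> e x \<le> W x"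
    proof -
      have 1: "AE x in m. \<forall>n. g n x = v n x"
        using g unfolding qc_version_def by (auto simp: AE_all_countable)
      have 2: "AE x in m. \<forall>n. x \<notin> F n (L n k) \<longrightarrow> e x \<le> w n k x"
        using w(3) by (auto simp: AE_all_countable)
      from 1 2 W(3) show ?thesis
      proof eventually_elim
        fix x assume *: "\<forall>n. g n x = v n x" "\<forall>n. x \<notin> F n (L n k) \<longrightarrow> e x \<le> w n k x" "\<forall>i. y i x \<le> W x"
        show "x \<notin> H k \<longrightarrow> e x \<le> W x"
        proof
          assume "x \<notin> H k"
          then obtain n where n: "k \<le> n" "x \<notin> F n (L n k) \<or> (1/2)^n < \<bar>g n x\<bar>"
            unfolding H_def by (auto simp: not_le)
          have yW: "2^n * \<bar>v n x\<bar> + \<bar>w n k x\<bar> \<le> W x"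
            using *(3)[rule_format, of "n - k"] n(1) unfolding y_def by simp
          have "0 \<le> 2^n * \<bar>v n x\<bar>" by simp
          from n(2) show "e x \<le> W x"
          proof
            assume "x \<notin> F n (L n k)"
            then have "e x \<le> w n k x" using *(2) by blast
            then show ?thesis using yW \<open>0 \<le> 2^n * \<bar>v n x\<bar>\<close> by linarith
          next
            assume "(1/2)^n < \<bar>g n x\<bar>"
            then have "1 \<le> 2^n * \<bar>v n x\<bar>" using *(1) by (simp add: power_divide field_simps)
            then show ?thesis using yW e_le_1[of x] by linarith
          qed
        qed
      qed
    qed
    ultimately show ?thesis using W(1) by blast
  qed
  have "nest m D \<E> G"
  proof (rule nest_if_gauge_small)
    show "closed (G k)" for k unfolding G_def using H by (intro closed_UN) auto
    show "incseq G" unfolding incseq_def G_def by (auto intro: order_trans)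
    fix \<eta> :: real assume \<eta>: "0 < \<eta>"
    have "(\<lambda>k. 8 * (1/2 :: real)^k) \<longlonglongrightarrow> 8 * 0" by (intro tendsto_intros LIMSEQ_power_zero) simp
    then have "\<forall>\<^sub>F k in sequentially. 8 * (1/2 :: real)^k < \<eta>" using \<eta> by (intro order_tendstoD) auto
    then obtain k where k: "8 * (1/2 :: real)^k < \<eta>" by (auto simp: eventually_sequentially)
    obtain W where W: "W \<in> D" "nrm W \<le> 8 * (1/2)^k" "AE x in m. x \<notin> H k \<longrightarrow> e x \<le> W x"
      using W by blast
    have "AE x in m. x \<notin> G k \<longrightarrow> e x \<le> W x"
      using W(3) by eventually_elim (auto simp: G_def)
    then show "\<exists>k. \<exists>w\<in>D. nrm w < \<eta> \<and> (AE x in m. x \<notin> G k \<longrightarrow> e x \<le> w x)"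
      using W(1,2) k by (meson le_less_trans)
  qed
  moreover have "{x. \<forall>k. \<exists>n\<ge>k. (1/2)^n < \<bar>g n x\<bar>} \<subseteq> (\<Inter>k. - G k)"
    unfolding G_def H_def by (force simp: not_le)
  ultimately show ?thesis unfolding exceptional_def by blast
qed

end


section \<open>Integrability and completeness for finite measures\<close>

text \<open>By monotone convergence the sum of the absolute values has finite integral.\<close>

lemma AE_summable_if_integrals_summable:
  fixes f :: "nat \<Rightarrow> 'a \<Rightarrow> real"
  assumes f: "\<And>n. integrable M (f n)" and s: "summable (\<lambda>n. \<integral>x. \<bar>f n x\<bar> \<partial>M)"
  shows "AE x in M. summable (\<lambda>n. \<bar>f n x\<bar>)"
proof -
  have fm [measurable]: "f n \<in> borel_measurable M" for n
    using f[of n] by (rule borel_measurable_integrable)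
  have eq: "(\<integral>\<^sup>+x. ennreal \<bar>f n x\<bar> \<partial>M) = ennreal (\<integral>x. \<bar>f n x\<bar> \<partial>M)" for n
    by (rule nn_integral_eq_integral[OF integrable_abs[OF f]]) simp
  have "(\<integral>\<^sup>+x. (\<Sum>n. ennreal \<bar>f n x\<bar>) \<partial>M) = (\<Sum>n. \<integral>\<^sup>+x. ennreal \<bar>f n x\<bar> \<partial>M)"
    by (rule nn_integral_suminf) measurable
  also have "\<dots> \<noteq> top"
    unfolding eq by (rule ennreal_suminf_neq_top[OF s]) (simp add: Bochner_Integration.integral_nonneg)
  finally have fin: "(\<integral>\<^sup>+x. (\<Sum>n. ennreal \<bar>f n x\<bar>) \<partial>M) \<noteq> \<infinity>" by simp
  have "AE x in M. (\<Sum>n. ennreal \<bar>f n x\<bar>) \<noteq> \<infinity>"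
    by (rule nn_integral_PInf_AE[OF _ fin]) measurable
  then show ?thesis
  proof eventually_elim
    fix x assume "(\<Sum>n. ennreal \<bar>f n x\<bar>) \<noteq> \<infinity>"
    then show "summable (\<lambda>n. \<bar>f n x\<bar>)" by (intro summable_suminf_not_top) simp_all
  qed
qed

context finite_measure
begin

lemma const_L2: "(\<lambda>x. c) \<in> L2 M"
  unfolding L2_def mem_Collect_eq by (intro conjI borel_measurable_const integrable_const)

lemma bounded_L2:
  assumes "f \<in> borel_measurable M" "\<And>x. \<bar>f x\<bar> \<le> C" shows "f \<in> L2 M"
proof (rule L2_bound[OF const_L2[of C] assms(1)])
  show "AE x in M. \<bar>f x\<bar> \<le> \<bar>C\<bar>" using order_trans[OF assms(2) abs_ge_self] by simp
qed

lemma L2_integrable: "f \<in> L2 M \<Longrightarrow> integrable M f"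
  using L2_mult[OF _ const_L2[of 1], of f] by simp

lemma L2_abs: "f \<in> L2 M \<Longrightarrow> (\<lambda>x. \<bar>f x\<bar>) \<in> L2 M" "l2norm M (\<lambda>x. \<bar>f x\<bar>) = l2norm M f"
  by (auto simp: L2_def l2norm_eq)

lemma integral_abs_le_l2norm:
  assumes "f \<in> L2 M" shows "(\<integral>x. \<bar>f x\<bar> \<partial>M) \<le> l2norm M (\<lambda>x. 1) * l2norm M f"
  using L2.cauchy_schwarz[OF const_L2[of 1] L2_abs(1)[OF assms]] L2_abs(2)[of f] by simp

text \<open>The rate makes the L^1 norms of the increments summable, as the measure is finite, so
  the whole sequence converges almost everywhere without passing to a subsequence. Fatou's lemma
  then bounds the L^2 distance to the limit.\<close>

lemma L2_complete:
  assumes f: "\<And>n. f n \<in> L2 M"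
    and cauchy: "\<And>i j. l2norm M (\<lambda>x. f i x - f j x) \<le> (1/2)^i + (1/2)^(j::nat)"
  obtains g where "g \<in> L2 M" "(\<lambda>n. l2norm M (\<lambda>x. f n x - g x)) \<longlonglongrightarrow> 0"
proof -
  have fm [measurable]: "f n \<in> borel_measurable M" for n using f by (rule L2_measurable)
  define g where "g x = lim (\<lambda>n. f n x)" for x
  have gm [measurable]: "g \<in> borel_measurable M"
    unfolding g_def using fm by (rule borel_measurable_lim_metric)
  have dL: "(\<lambda>x. f i x - f j x) \<in> L2 M" for i j by (rule L2.diff[OF f f])
  let ?c = "l2norm M (\<lambda>x. 1)"
  have c: "0 \<le> ?c" by (rule L2.N_nonneg[OF const_L2])
  have "summable (\<lambda>n. \<integral>x. \<bar>f (Suc n) x - f n x\<bar> \<partial>M)"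
  proof (rule summable_comparison_test'[of "\<lambda>n. ?c * (2 * (1/2)^n)" 0])
    show "summable (\<lambda>n. ?c * (2 * (1/2)^n))" by (intro summable_mult summable_geometric) simp
    fix n
    have "(\<integral>x. \<bar>f (Suc n) x - f n x\<bar> \<partial>M) \<le> ?c * l2norm M (\<lambda>x. f (Suc n) x - f n x)"
      by (rule integral_abs_le_l2norm[OF dL])
    also have "\<dots> \<le> ?c * (2 * (1/2)^n)"
      using c cauchy[of "Suc n" n] zero_le_power[of "1/2 :: real" n]
      by (intro mult_left_mono) (simp_all add: field_simps)
    finally show "norm (\<integral>x. \<bar>f (Suc n) x - f n x\<bar> \<partial>M) \<le> ?c * (2 * (1/2)^n)"
      by (simp add: Bochner_Integration.integral_nonneg)
  qed
  from AE_summable_if_integrals_summable[OF L2_integrable[OF dL] this]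
  have lim: "AE x in M. (\<lambda>n. f n x) \<longlonglongrightarrow> g x"
  proof eventually_elim
    fix x assume "summable (\<lambda>n. \<bar>f (Suc n) x - f n x\<bar>)"
    then have "summable (\<lambda>n. f (Suc n) x - f n x)" by (rule summable_rabs_cancel)
    then have "convergent (\<lambda>n. \<Sum>i<n. f (Suc i) x - f i x)" by (rule summable_iff_convergent[THEN iffD1])
    then have "convergent (\<lambda>n. f 0 x + (\<Sum>i<n. f (Suc i) x - f i x))"
      by (intro convergent_add convergent_const)
    then have "convergent (\<lambda>n. f n x)" by (simp add: sum_lessThan_telescope[of "\<lambda>i. f i x"])
    then show "(\<lambda>n. f n x) \<longlonglongrightarrow> g x" unfolding g_def by (rule convergent_LIMSEQ_iff[THEN iffD1])
  qed
  have bound: "(\<lambda>x. f n x - g x) \<in> L2 M \<and> l2norm M (\<lambda>x. f n x - g x) \<le> 2 * (1/2)^n" for n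
  proof -
    have "(\<integral>\<^sup>+x. ennreal ((f n x - g x)\<^sup>2) \<partial>M)
        = (\<integral>\<^sup>+x. liminf (\<lambda>j. ennreal ((f n x - f (n + j) x)\<^sup>2)) \<partial>M)"
    proof (rule nn_integral_cong_AE)
      show "AE x in M. ennreal ((f n x - g x)\<^sup>2) = liminf (\<lambda>j. ennreal ((f n x - f (n + j) x)\<^sup>2))"
        using lim
      proof eventually_elim
        fix x assume "(\<lambda>n. f n x) \<longlonglongrightarrow> g x"
        then have "(\<lambda>j. f (j + n) x) \<longlonglongrightarrow> g x" by (rule LIMSEQ_ignore_initial_segment)
        then have "(\<lambda>j. ennreal ((f n x - f (n + j) x)\<^sup>2)) \<longlonglongrightarrow> ennreal ((f n x - g x)\<^sup>2)"
          by (intro tendsto_intros tendsto_ennrealI) (simp add: add.commute)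
        then show "ennreal ((f n x - g x)\<^sup>2) = liminf (\<lambda>j. ennreal ((f n x - f (n + j) x)\<^sup>2))"
          by (intro lim_imp_Liminf[symmetric]) auto
      qed
    qed
    also have "\<dots> \<le> liminf (\<lambda>j. \<integral>\<^sup>+x. ennreal ((f n x - f (n + j) x)\<^sup>2) \<partial>M)"
      by (rule nn_integral_liminf) measurable
    also have "\<dots> \<le> liminf (\<lambda>j::nat. ennreal ((2 * (1/2)^n)\<^sup>2))"
    proof (intro Liminf_mono always_eventually allI)
      fix j
      have "(\<integral>\<^sup>+x. ennreal ((f n x - f (n + j) x)\<^sup>2) \<partial>M) = ennreal ((l2norm M (\<lambda>x. f n x - f (n + j) x))\<^sup>2)"
        unfolding l2norm_power2 by (rule nn_integral_eq_integral[OF L2_square[OF dL]]) simp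
      also have "\<dots> \<le> ennreal ((2 * (1/2)^n)\<^sup>2)"
      proof (intro ennreal_leI power_mono L2.N_nonneg[OF dL])
        have "(1/2 :: real)^(n + j) \<le> (1/2)^n" by (rule power_decreasing) auto
        then show "l2norm M (\<lambda>x. f n x - f (n + j) x) \<le> 2 * (1/2)^n"
          using cauchy[of n "n + j"] by linarith
      qed
      finally show "(\<integral>\<^sup>+x. ennreal ((f n x - f (n + j) x)\<^sup>2) \<partial>M) \<le> ennreal ((2 * (1/2)^n)\<^sup>2)" .
    qed
    also have "\<dots> = ennreal ((2 * (1/2)^n)\<^sup>2)" by (rule Liminf_const) simp
    finally have le: "(\<integral>\<^sup>+x. ennreal ((f n x - g x)\<^sup>2) \<partial>M) \<le> ennreal ((2 * (1/2)^n)\<^sup>2)" .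
    have int: "integrable M (\<lambda>x. (f n x - g x)\<^sup>2)"
      by (rule integrableI_bounded) (use le_less_trans[OF le ennreal_less_top] in auto)
    then have L: "(\<lambda>x. f n x - g x) \<in> L2 M" by (simp add: L2_def)
    have "ennreal (\<integral>x. (f n x - g x)\<^sup>2 \<partial>M) \<le> ennreal ((2 * (1/2)^n)\<^sup>2)"
      using le nn_integral_eq_integral[OF int] by simp
    then have "(l2norm M (\<lambda>x. f n x - g x))\<^sup>2 \<le> (2 * (1/2)^n)\<^sup>2"
      unfolding l2norm_power2 by (simp add: ennreal_le_iff)
    then show ?thesis using L by (auto intro: power2_le_imp_le)
  qed
  have gL: "g \<in> L2 M"
    using L2.diff[OF f[of 0] conjunct1[OF bound[of 0]]] by simp
  have "(\<lambda>n. l2norm M (\<lambda>x. f n x - g x)) \<longlonglongrightarrow> 0"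
  proof (rule Lim_null_comparison)
    have "norm (l2norm M (\<lambda>x. f n x - g x)) \<le> 2 * (1/2)^n" for n
      using conjunct2[OF bound[of n]] L2.N_nonneg[OF conjunct1[OF bound[of n]]] by simp
    then show "\<forall>\<^sub>F n in sequentially. norm (l2norm M (\<lambda>x. f n x - g x)) \<le> 2 * (1/2)^n"
      by (intro always_eventually allI)
    show "(\<lambda>n. 2 * (1/2 :: real)^n) \<longlonglongrightarrow> 0"
      by (intro tendsto_mult_right_zero LIMSEQ_power_zero) simp
  qed
  with gL show thesis by (rule that)
qed

end


section \<open>Finite measures that charge no exceptional sets\<close>

locale smooth_finite_measure = topological_dirichlet_space m D \<E> + M: finite_measure M
  for m :: "'a::topological_space measure" and D :: "('a \<Rightarrow> real) set" and \<E> :: "'a form"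
    and M :: "'a measure" +
  assumes sets_M: "sets M = sets borel"
    and null: "\<And>B. B \<in> sets borel \<Longrightarrow> exceptional m D \<E> B \<Longrightarrow> emeasure M B = 0"
begin

lemma measurable_M: "g \<in> borel_measurable borel \<Longrightarrow> g \<in> borel_measurable M"
  using measurable_cong_sets[OF sets_M refl] by blast

lemma bqc_L2:
  assumes "bqc v g" shows "g \<in> L2 M"
proof -
  obtain C where "\<And>x. \<bar>g x\<bar> \<le> C" using bqc_bounded[OF assms] by blast
  then show ?thesis by (rule M.bounded_L2[OF measurable_M[OF bqc_measurable[OF assms]]])
qed

text \<open>This says that the map from \<open>D\<close> to \<open>L\<^sup>2(M)\<close> that sends a bounded function to its
  quasi-continuous version is closable.\<close>

lemma small_norm_small_integral:
  assumes \<eta>: "0 < \<eta>" and C: "0 \<le> C"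
  shows "\<exists>\<theta>>0. \<forall>v g. bqc v g \<longrightarrow> nrm v \<le> \<theta> \<longrightarrow> (\<integral>x. (g x)\<^sup>2 \<partial>M) \<le> C \<longrightarrow> (\<integral>x. \<bar>g x\<bar> \<partial>M) < \<eta>"
proof (rule ccontr)
  assume neg: "\<not> ?thesis"
  \<comment> \<open>Counterexamples of norm at most 4^-n, the rate at which
    \<open>limsup_exceptional\<close> applies.\<close>
  have "\<forall>n. \<exists>p. bqc (fst p) (snd p) \<and> nrm (fst p) \<le> (1/4)^n \<and>
    (\<integral>x. (snd p x)\<^sup>2 \<partial>M) \<le> C \<and> \<eta> \<le> (\<integral>x. \<bar>snd p x\<bar> \<partial>M)"
  proof
    fix n :: nat
    have "(0 :: real) < (1/4)^n" by simp
    then obtain v g where "bqc v g" "nrm v \<le> (1/4)^n" "(\<integral>x. (g x)\<^sup>2 \<partial>M) \<le> C"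
      "\<not> (\<integral>x. \<bar>g x\<bar> \<partial>M) < \<eta>" using neg by blast
    then show "\<exists>p. bqc (fst p) (snd p) \<and> nrm (fst p) \<le> (1/4)^n \<and>
      (\<integral>x. (snd p x)\<^sup>2 \<partial>M) \<le> C \<and> \<eta> \<le> (\<integral>x. \<bar>snd p x\<bar> \<partial>M)"
      by (intro exI[of _ "(v, g)"]) simp
  qed
  from choice[OF this] obtain p where p: "\<And>n :: nat. bqc (fst (p n)) (snd (p n)) \<and>
    nrm (fst (p n)) \<le> (1/4)^n \<and> (\<integral>x. (snd (p n) x)\<^sup>2 \<partial>M) \<le> C \<and>
    \<eta> \<le> (\<integral>x. \<bar>snd (p n) x\<bar> \<partial>M)" by blast
  define g where "g n = snd (p n)" for n
  have g: "bqc (fst (p n)) (g n)" "nrm (fst (p n)) \<le> (1/4)^n"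
    "(\<integral>x. (g n x)\<^sup>2 \<partial>M) \<le> C" "\<eta> \<le> (\<integral>x. \<bar>g n x\<bar> \<partial>M)" for n
    using p[of n] unfolding g_def by auto
  have gb [measurable]: "g n \<in> borel_measurable borel" for n using g(1) by (rule bqc_measurable)
  have gm: "g n \<in> borel_measurable M" for n by (rule measurable_M[OF gb])
  note gL = bqc_L2[OF g(1)]
  let ?N = "{x. \<forall>k. \<exists>n\<ge>k. (1/2)^n < \<bar>g n x\<bar>}"
  have ex: "exceptional m D \<E> ?N"
    using g(1,2) by (intro limsup_exceptional[of "\<lambda>n. fst (p n)"]) (auto intro: bqc_D bqc_qc)
  have N: "?N \<in> sets borel" by measurable
  have "AE x in M. x \<notin> ?N"
    using null[OF N ex] N by (intro AE_I'[of ?N]) (auto simp: null_sets_def sets_M)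
  then have lim: "AE x in M. (\<lambda>n. g n x) \<longlonglongrightarrow> 0"
  proof eventually_elim
    fix x assume "x \<notin> ?N"
    then obtain k where k: "\<And>n. k \<le> n \<Longrightarrow> \<bar>g n x\<bar> \<le> (1/2)^n" by (auto simp: not_less)
    show "(\<lambda>n. g n x) \<longlonglongrightarrow> 0"
    proof (rule Lim_null_comparison)
      show "\<forall>\<^sub>F n in sequentially. norm (g n x) \<le> (1/2)^n"
        using k by (auto simp: eventually_sequentially)
      show "(\<lambda>n. (1/2 :: real)^n) \<longlonglongrightarrow> 0" by (rule LIMSEQ_power_zero) simp
    qed
  qed
  \<comment> \<open>Uniform integrability from the L^2 bound: |g| is at most min |g| c + g^2 / c.
    The first part tends to 0 by dominated convergence, the second has integral at most C / c <
    \<eta> / 2. The 1 keeps c positive when C = 0.\<close>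
  define c where "c = 2 * C / \<eta> + 1"
  have c: "0 < c" "C / c < \<eta> / 2"
  proof -
    show "0 < c" unfolding c_def using \<eta> C by (intro add_nonneg_pos) auto
    then show "C / c < \<eta> / 2" unfolding c_def using \<eta> by (simp add: field_simps)
  qed
  have "(\<lambda>n. \<integral>x. min \<bar>g n x\<bar> c \<partial>M) \<longlonglongrightarrow> (\<integral>x. 0 \<partial>M)"
  proof (rule integral_dominated_convergence[where w="\<lambda>x. c"])
    show "AE x in M. (\<lambda>n. min \<bar>g n x\<bar> c) \<longlonglongrightarrow> 0"
      using lim
    proof eventually_elim
      fix x assume "(\<lambda>n. g n x) \<longlonglongrightarrow> 0"
      then have "(\<lambda>n. min \<bar>g n x\<bar> c) \<longlonglongrightarrow> min \<bar>0\<bar> c" by (intro tendsto_intros)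
      then show "(\<lambda>n. min \<bar>g n x\<bar> c) \<longlonglongrightarrow> 0" using c by simp
    qed
    show "(\<lambda>x. min \<bar>g n x\<bar> c) \<in> borel_measurable M" for n using gm by measurable
    show "AE x in M. norm (min \<bar>g n x\<bar> c) \<le> c" for n using c by auto
  qed auto
  then have "\<forall>\<^sub>F n in sequentially. (\<integral>x. min \<bar>g n x\<bar> c \<partial>M) < \<eta> / 2"
    using \<eta> by (intro order_tendstoD(2)) auto
  then obtain n where n: "(\<integral>x. min \<bar>g n x\<bar> c \<partial>M) < \<eta> / 2" by (auto simp: eventually_sequentially)
  have im: "integrable M (\<lambda>x. min \<bar>g n x\<bar> c)"
    using M.L2_integrable[OF gL] by (intro integrable_min) auto
  have iq: "integrable M (\<lambda>x. (g n x)\<^sup>2 / c)" using L2_square[OF gL] by simp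
  have "(\<integral>x. \<bar>g n x\<bar> \<partial>M) \<le> (\<integral>x. min \<bar>g n x\<bar> c + (g n x)\<^sup>2 / c \<partial>M)"
  proof (rule integral_mono)
    show "integrable M (\<lambda>x. \<bar>g n x\<bar>)" using M.L2_integrable[OF gL] by simp
    show "integrable M (\<lambda>x. min \<bar>g n x\<bar> c + (g n x)\<^sup>2 / c)" using im iq by simp
    fix x
    show "\<bar>g n x\<bar> \<le> min \<bar>g n x\<bar> c + (g n x)\<^sup>2 / c"
    proof (cases "\<bar>g n x\<bar> \<le> c")
      case False
      then have "c * \<bar>g n x\<bar> \<le> \<bar>g n x\<bar> * \<bar>g n x\<bar>" by (intro mult_right_mono) auto
      then have "\<bar>g n x\<bar> \<le> (g n x)\<^sup>2 / c" using c by (simp add: field_simps power2_eq_square)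
      then show ?thesis using c by simp
    qed (use c in simp)
  qed
  also have "\<dots> = (\<integral>x. min \<bar>g n x\<bar> c \<partial>M) + (\<integral>x. (g n x)\<^sup>2 \<partial>M) / c" using im iq by simp
  also have "\<dots> < \<eta> / 2 + \<eta> / 2"
  proof (rule add_strict_mono[OF n])
    have "(\<integral>x. (g n x)\<^sup>2 \<partial>M) / c \<le> C / c" using g(3) c by (intro divide_right_mono) auto
    then show "(\<integral>x. (g n x)\<^sup>2 \<partial>M) / c < \<eta> / 2" using c(2) by linarith
  qed
  finally show False using g(4)[of n] by simp
qed

text \<open>Minimise \<open>\<parallel>v\<parallel>\<^sup>2 + r\<^sup>2 \<parallel>g - 1\<parallel>\<^sup>2\<close> over the graph of \<open>v \<mapsto> g\<close>. At a minimiser \<open>(v, g)\<close> the function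
  \<open>k = 1 - g\<close> satisfies \<open>r\<^sup>2 \<integral> k h dM = a v u\<close> for all \<open>(u, h)\<close> in the graph, and by closability
  \<open>g\<close> is small when \<open>r\<close> is.\<close>

lemma finite_energy_dense:
  assumes \<eta>: "0 < \<eta>"
  obtains k C where "k \<in> L2 M" "0 \<le> C" "\<And>v g. bqc v g \<Longrightarrow> \<bar>\<integral>x. k x * g x \<partial>M\<bar> \<le> C * nrm v"
    "l2norm M (\<lambda>x. 1 - k x) < \<eta>"
proof -
  define c where "c = l2norm M (\<lambda>x. 1)"
  have one: "(\<lambda>x. 1) \<in> L2 M" by (rule M.const_L2)
  have c: "0 \<le> c" unfolding c_def by (rule L2.N_nonneg[OF one])
  have "0 < \<eta>\<^sup>2 / 4" using \<eta> by simp
  from small_norm_small_integral[OF this zero_le_power2, of "c + 1"]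
  obtain \<theta> where \<theta>: "0 < \<theta>" "\<And>v g. bqc v g \<Longrightarrow> nrm v \<le> \<theta> \<Longrightarrow> (\<integral>x. (g x)\<^sup>2 \<partial>M) \<le> (c + 1)\<^sup>2 \<Longrightarrow>
    (\<integral>x. \<bar>g x\<bar> \<partial>M) < \<eta>\<^sup>2 / 4" by blast
  \<comment> \<open>The almost minimisers will have graph norm at most r (c + 1). This equals
    \<theta>, so \<open>small_norm_small_integral\<close> applies to them, and dividing by r bounds
    their second components by c + 1 in L^2(M).\<close>
  define r where "r = \<theta> / (c + 1)"
  have r: "0 < r" "r * (c + 1) = \<theta>" unfolding r_def using \<theta>(1) c by auto
  \<comment> \<open>Relative tolerance of the almost minimisers: their defect adds at most r \<tau>
    \<theta> = r^2 \<tau> (c + 1) to the energy, which is at most r^2 \<eta>^2 / 4.\<close>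
  define \<tau> where "\<tau> = min 1 (\<eta>\<^sup>2 / 4 / (c + 1))"
  have \<tau>: "0 < \<tau>" "\<tau> \<le> 1" "\<tau> * (c + 1) \<le> \<eta>\<^sup>2 / 4"
  proof -
    show "0 < \<tau>" "\<tau> \<le> 1" unfolding \<tau>_def using \<eta> c by auto
    have "\<tau> \<le> \<eta>\<^sup>2 / 4 / (c + 1)" unfolding \<tau>_def by simp
    then show "\<tau> * (c + 1) \<le> \<eta>\<^sup>2 / 4" using c by (subst (asm) pos_le_divide_eq) auto
  qed
  \<comment> \<open>The vectors of \<open>approximate_riesz\<close> are here pairs (v, g), and
    \<open>pl p t q\<close> stands for p + t q.\<close>
  define X where "X = {p. bqc (fst p) (snd p)}"
  define B where "B p q = a (fst p) (fst q) + r\<^sup>2 * (\<integral>x. snd p x * snd q x \<partial>M)" for p q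
  \<comment> \<open>The pairing with the vector (0, 1), which need not lie in the graph: B p p - 2 l
    p is the functional to be minimised, up to the constant r^2 times the mass of M.\<close>
  define l where "l p = r\<^sup>2 * (\<integral>x. snd p x \<partial>M)" for p :: "('a \<Rightarrow> real) \<times> ('a \<Rightarrow> real)"
  define pl where "pl p t q = ((\<lambda>x. fst p x + t * fst q x), (\<lambda>x. snd p x + t * snd q x))"
    for p q :: "('a \<Rightarrow> real) \<times> ('a \<Rightarrow> real)" and t
  have XD: "fst p \<in> D" "snd p \<in> L2 M" if "p \<in> X" for p
    using that unfolding X_def by (auto intro: bqc_D bqc_L2)
  have plX: "pl p t q \<in> X" if "p \<in> X" "q \<in> X" for p q t
    using that bqc_linear unfolding X_def pl_def by auto
  have B_pl: "B (pl p t q) (pl p t q) = B p p + 2 * t * B p q + t\<^sup>2 * B q q"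
    if "p \<in> X" "q \<in> X" for p q t
    using A.B_expand[OF XD(1)[OF that(1)] XD(1)[OF that(2)], of t]
      L2.B_expand[OF XD(2)[OF that(1)] XD(2)[OF that(2)], of t]
    unfolding B_def pl_def by (simp add: algebra_simps)
  have B_diff: "B (pl p (-1) q) s = B p s - B q s" if "p \<in> X" "q \<in> X" "s \<in> X" for p q s
  proof -
    have "a (\<lambda>x. fst p x - fst q x) (fst s) = a (fst p) (fst s) - a (fst q) (fst s)"
      by (rule A.B_diff1[OF XD(1)[OF that(1)] XD(1)[OF that(2)] XD(1)[OF that(3)]])
    moreover have "(\<integral>x. (snd p x - snd q x) * snd s x \<partial>M)
        = (\<integral>x. snd p x * snd s x \<partial>M) - (\<integral>x. snd q x * snd s x \<partial>M)"
      by (rule L2.B_diff1[OF XD(2)[OF that(1)] XD(2)[OF that(2)] XD(2)[OF that(3)]])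
    ultimately show ?thesis unfolding B_def pl_def by (simp add: right_diff_distrib)
  qed
  define b where "b p = sqrt (B p p)" for p
  have B_eq: "B p p = (nrm (fst p))\<^sup>2 + (r * l2norm M (snd p))\<^sup>2" if "p \<in> X" for p
    using A.N_sq[OF XD(1)[OF that]] L2.N_sq[OF XD(2)[OF that]]
    unfolding B_def by (simp add: power_mult_distrib)
  have B0: "0 \<le> B p p" if "p \<in> X" for p unfolding B_eq[OF that] by simp
  have b_sq: "(b p)\<^sup>2 = B p p" and b0: "0 \<le> b p" if "p \<in> X" for p
    unfolding b_def using B0[OF that] by auto
  have nb: "nrm (fst p) \<le> b p" and gb: "r * l2norm M (snd p) \<le> b p" if "p \<in> X" for p
    using real_le_rsqrt[of "nrm (fst p)"  "B p p"] real_le_rsqrt[of "r * l2norm M (snd p)" "B p p"]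
      B_eq[OF that] unfolding b_def by simp_all
  have int_le: "\<bar>\<integral>x. g x \<partial>M\<bar> \<le> c * l2norm M g" if "g \<in> L2 M" for g
    using L2.cauchy_schwarz[OF one that] unfolding c_def by simp
  have l_le: "\<bar>l p\<bar> \<le> (r * c) * b p" if "p \<in> X" for p
  proof -
    have "\<bar>l p\<bar> = r * (r * \<bar>\<integral>x. snd p x \<partial>M\<bar>)"
      unfolding l_def abs_mult by (simp add: power2_eq_square)
    also have "\<dots> \<le> r * (r * (c * l2norm M (snd p)))"
      using r(1) int_le[OF XD(2)[OF that]] by (intro mult_left_mono) auto
    also have "\<dots> = (r * c) * (r * l2norm M (snd p))" by simp
    also have "\<dots> \<le> (r * c) * b p" using gb[OF that] r(1) c by (intro mult_left_mono) auto
    finally show ?thesis .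
  qed
  have l_pl: "l (pl p t q) = l p + t * l q" if "p \<in> X" "q \<in> X" for p t q
    using L2.B_add2[OF XD(2)[OF that(1)] L2.scale[OF XD(2)[OF that(2)]] one, of t]
      L2.B_scale2[OF XD(2)[OF that(2)] one, of t]
    unfolding l_def pl_def by (simp add: algebra_simps)
  \<comment> \<open>Three bounds at once: r for the a priori norm \<theta>, r \<tau> for the energy
    estimate, r 2^-n for the Cauchy rate of the second components.\<close>
  define \<epsilon> where "\<epsilon> n = r * \<tau> * (1/2)^n" for n :: nat
  have \<epsilon>: "0 < \<epsilon> n" "\<epsilon> n \<le> r * \<tau>" "\<epsilon> n \<le> r" "\<epsilon> n \<le> r * (1/2)^n" for n
  proof -
    show "0 < \<epsilon> n" unfolding \<epsilon>_def using r \<tau> by simp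
    have h: "(1/2 :: real)^n \<le> 1" by (rule power_le_one) auto
    then show 1: "\<epsilon> n \<le> r * \<tau>" unfolding \<epsilon>_def using r \<tau> by (intro mult_left_le) auto
    have "r * \<tau> \<le> r" using r \<tau> by (intro mult_left_le) auto
    then show "\<epsilon> n \<le> r" using 1 by linarith
    have "r * \<tau> * (1/2)^n \<le> r * 1 * (1/2)^n" using r \<tau> by (intro mult_right_mono mult_left_mono) auto
    then show "\<epsilon> n \<le> r * (1/2)^n" unfolding \<epsilon>_def by simp
  qed
  have "\<exists>p\<in>X. \<forall>q\<in>X. \<bar>B p q - l q\<bar> \<le> \<epsilon> n * sqrt (B q q)" for n
  proof (rule approximate_riesz[where add=pl and C="r * c"])
    show "((\<lambda>x. 0), (\<lambda>x. 0)) \<in> X" unfolding X_def using bqc_zero by simp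
  qed (use plX B_pl B0 l_pl l_le \<epsilon> in \<open>auto simp: b_def\<close>)
  then have "\<exists>p. p \<in> X \<and> (\<forall>q\<in>X. \<bar>B p q - l q\<bar> \<le> \<epsilon> n * b q)" for n
    unfolding b_def by blast
  then have "\<forall>n. \<exists>p. p \<in> X \<and> (\<forall>q\<in>X. \<bar>B p q - l q\<bar> \<le> \<epsilon> n * b q)" by blast
  from choice[OF this] obtain p where p: "\<And>n. p n \<in> X" "\<And>n q. q \<in> X \<Longrightarrow> \<bar>B (p n) q - l q\<bar> \<le> \<epsilon> n * b q"
    by blast
  have cancel: "s \<le> t" if "s * s \<le> t * s" "0 \<le> s" "0 \<le> t" for s t :: real
    using that by (cases "s = 0") (auto simp: mult_le_cancel_right)
  have bp: "b (p n) \<le> \<theta>" for n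
  proof -
    have "b (p n) * b (p n) \<le> (r * c + \<epsilon> n) * b (p n)"
      using p(2)[OF p(1), of n n] l_le[OF p(1), of n] b_sq[OF p(1), of n]
      by (simp add: power2_eq_square distrib_right)
    then have "b (p n) \<le> r * c + \<epsilon> n"
      by (rule cancel) (use b0 p(1) r(1) c \<epsilon>(1)[of n] in \<open>auto intro: less_imp_le\<close>)
    also have "\<dots> \<le> r * c + r" using \<epsilon>(3) by simp
    also have "\<dots> = \<theta>" using r(2) by (simp add: distrib_left)
    finally show ?thesis .
  qed
  define g where "g n = snd (p n)" for n
  have gL: "g n \<in> L2 M" for n unfolding g_def using XD(2) p(1) by blast
  have g_le: "l2norm M (g n) \<le> c + 1" for n
  proof -
    have "r * l2norm M (g n) \<le> r * (c + 1)" using gb[OF p(1), of n] bp[of n] r(2) unfolding g_def by simp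
    then show ?thesis using r(1) by simp
  qed
  \<comment> \<open>Testing an almost minimiser with itself bounds r^2 |g|^2 by r^2 times the
    integral of g plus an error of the same order in r. The weight cancels, and closability has made
    the integral of g small.\<close>
  have g_sq: "(l2norm M (g n))\<^sup>2 \<le> \<eta>\<^sup>2 / 2" for n
  proof -
    have "(\<integral>x. (g n x)\<^sup>2 \<partial>M) \<le> (c + 1)\<^sup>2"
      unfolding l2norm_power2[symmetric] using g_le L2.N_nonneg[OF gL] by (intro power_mono) auto
    moreover have "bqc (fst (p n)) (g n)" using p(1)[of n] unfolding X_def g_def by simp
    moreover have "nrm (fst (p n)) \<le> \<theta>" using nb[OF p(1), of n] bp[of n] by linarith
    ultimately have "(\<integral>x. \<bar>g n x\<bar> \<partial>M) < \<eta>\<^sup>2 / 4" using \<theta>(2) by blast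
    then have "(\<integral>x. g n x \<partial>M) \<le> \<eta>\<^sup>2 / 4" using integral_abs_bound[of M "g n"] by linarith
    then have l1: "l (p n) \<le> r\<^sup>2 * (\<eta>\<^sup>2 / 4)" unfolding l_def g_def by (intro mult_left_mono) auto
    have "r\<^sup>2 * (l2norm M (g n))\<^sup>2 \<le> B (p n) (p n)"
      unfolding B_eq[OF p(1)] g_def by (simp add: power_mult_distrib)
    also have "\<dots> \<le> l (p n) + \<epsilon> n * b (p n)" using p(2)[OF p(1), of n n] by linarith
    also have "\<epsilon> n * b (p n) \<le> (r * \<tau>) * \<theta>"
      using \<epsilon>(2)[of n] bp[of n] b0[OF p(1), of n] r(1) \<tau>(1) by (intro mult_mono) auto
    also have "(r * \<tau>) * \<theta> = r\<^sup>2 * (\<tau> * (c + 1))" using r(2) by (simp add: power2_eq_square)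
    also have "\<dots> \<le> r\<^sup>2 * (\<eta>\<^sup>2 / 4)" using \<tau>(3) by (intro mult_left_mono) auto
    finally have "r\<^sup>2 * (l2norm M (g n))\<^sup>2 \<le> r\<^sup>2 * (\<eta>\<^sup>2 / 2)" using l1 by simp
    then show ?thesis using r(1) by simp
  qed
  have "l2norm M (\<lambda>x. g i x - g j x) \<le> (1/2)^i + (1/2)^j" for i j
  proof -
    let ?q = "pl (p i) (-1) (p j)"
    have q: "?q \<in> X" by (rule plX[OF p(1) p(1)])
    have "b ?q * b ?q = B (p i) ?q - B (p j) ?q"
      using b_sq[OF q] B_diff[OF p(1) p(1) q, of i j] by (simp add: power2_eq_square)
    also have "\<dots> \<le> (\<epsilon> i + \<epsilon> j) * b ?q"
      using p(2)[OF q, of i] p(2)[OF q, of j] by (simp add: distrib_right)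
    finally have "b ?q \<le> \<epsilon> i + \<epsilon> j"
      by (rule cancel) (use b0[OF q] \<epsilon>(1)[of i] \<epsilon>(1)[of j] in auto)
    then have "r * l2norm M (\<lambda>x. g i x - g j x) \<le> r * ((1/2)^i + (1/2)^j)"
      using gb[OF q] \<epsilon>(4)[of i] \<epsilon>(4)[of j] by (simp add: pl_def g_def distrib_left)
    then show ?thesis using r(1) by simp
  qed
  from M.L2_complete[OF gL this] obtain G where G: "G \<in> L2 M" "(\<lambda>n. l2norm M (\<lambda>x. g n x - G x)) \<longlonglongrightarrow> 0"
    by blast
  have "(l2norm M G)\<^sup>2 \<le> \<eta>\<^sup>2 / 2"
    by (rule LIMSEQ_le_const2[OF tendsto_power[OF L2.N_tendsto[OF gL G]]]) (use g_sq in blast)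
  also have "\<dots> < \<eta>\<^sup>2" using \<eta> by simp
  finally have G_less: "l2norm M G < \<eta>" using \<eta> by (auto intro: power2_less_imp_less)
  let ?k = "\<lambda>x. 1 - G x"
  show thesis
  \<comment> \<open>Cauchy-Schwarz bounds \<open>a (fst (p n)) v\<close> by \<theta> * nrm v
    uniformly in n; dividing by the weight r^2 gives the constant. Only the second components have
    to converge.\<close>
  proof (rule that[of ?k "\<theta> / r\<^sup>2"])
    show "?k \<in> L2 M" using one G(1) by (rule L2.diff)
    show "0 \<le> \<theta> / r\<^sup>2" using \<theta>(1) by simp
    show "l2norm M (\<lambda>x. 1 - ?k x) < \<eta>" using G_less by simp
    fix v h assume vh: "bqc v h"
    let ?q = "(v, h)"
    have q: "?q \<in> X" using vh unfolding X_def by simp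
    note hL = bqc_L2[OF vh] and vD = bqc_D[OF vh]
    have le: "r\<^sup>2 * \<bar>(\<integral>x. h x \<partial>M) - (\<integral>x. g n x * h x \<partial>M)\<bar> \<le> \<theta> * nrm v + \<epsilon> n * b ?q" for n
    proof -
      have "\<bar>a (fst (p n)) v\<bar> \<le> nrm (fst (p n)) * nrm v"
        by (rule A.cauchy_schwarz[OF XD(1)[OF p(1)] vD])
      also have "\<dots> \<le> \<theta> * nrm v" using nb[OF p(1), of n] bp[of n] vD by (intro mult_right_mono) auto
      finally have "\<bar>a (fst (p n)) v\<bar> \<le> \<theta> * nrm v" .
      moreover have "\<bar>a (fst (p n)) v + r\<^sup>2 * (\<integral>x. g n x * h x \<partial>M) - r\<^sup>2 * (\<integral>x. h x \<partial>M)\<bar> \<le> \<epsilon> n * b ?q"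
        using p(2)[OF q, of n] unfolding B_def l_def g_def by simp
      ultimately have "\<bar>r\<^sup>2 * ((\<integral>x. h x \<partial>M) - (\<integral>x. g n x * h x \<partial>M))\<bar> \<le> \<theta> * nrm v + \<epsilon> n * b ?q"
        by (simp add: right_diff_distrib)
      then show ?thesis by (simp add: abs_mult)
    qed
    have "(\<lambda>n. r\<^sup>2 * \<bar>(\<integral>x. h x \<partial>M) - (\<integral>x. g n x * h x \<partial>M)\<bar>) \<longlonglongrightarrow>
        r\<^sup>2 * \<bar>(\<integral>x. h x \<partial>M) - (\<integral>x. G x * h x \<partial>M)\<bar>"
      by (intro tendsto_intros L2.B_tendsto[OF gL G(1) hL G(2)])
    moreover have "\<epsilon> \<longlonglongrightarrow> r * \<tau> * 0"
      unfolding \<epsilon>_def by (intro tendsto_intros LIMSEQ_power_zero) simp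
    then have "(\<lambda>n. \<theta> * nrm v + \<epsilon> n * b ?q) \<longlonglongrightarrow> \<theta> * nrm v + (r * \<tau> * 0) * b ?q"
      by (intro tendsto_intros)
    ultimately have "r\<^sup>2 * \<bar>(\<integral>x. h x \<partial>M) - (\<integral>x. G x * h x \<partial>M)\<bar> \<le> \<theta> * nrm v + (r * \<tau> * 0) * b ?q"
      by (rule LIMSEQ_le) (use le in blast)
    moreover have "(\<integral>x. ?k x * h x \<partial>M) = (\<integral>x. h x \<partial>M) - (\<integral>x. G x * h x \<partial>M)"
      using L2.B_diff1[OF one G(1) hL] by simp
    ultimately have "r\<^sup>2 * \<bar>\<integral>x. ?k x * h x \<partial>M\<bar> \<le> \<theta> * nrm v" by simp
    then have "\<bar>\<integral>x. ?k x * h x \<partial>M\<bar> \<le> (\<theta> * nrm v) / r\<^sup>2"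
      using r(1) by (subst pos_le_divide_eq) (simp_all add: mult.commute)
    then show "\<bar>\<integral>x. ?k x * h x \<partial>M\<bar> \<le> \<theta> / r\<^sup>2 * nrm v" by simp
  qed
qed

end


section \<open>Potentials of finite-energy densities and their summation\<close>

context smooth_finite_measure
begin

text \<open>With \<open>w\<close> the \<open>(\<alpha> + 1)\<close>-potential of \<open>k M\<close> and \<open>f = \<alpha> w\<close>, the remainder is the functional \<open>a w\<close>.
  It vanishes as \<open>\<alpha> \<rightarrow> \<infinity>\<close>, and testing with \<open>w\<close> clipped at a small height bounds the \<open>L\<^sup>1\<close> norm.\<close>

lemma finite_energy_approx:
  assumes k: "k \<in> L2 M" and C: "0 \<le> C" "\<And>v g. bqc v g \<Longrightarrow> \<bar>\<integral>x. k x * g x \<partial>M\<bar> \<le> C * nrm v"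
    and \<epsilon>: "0 < \<epsilon>"
  obtains f w where "integrable m f" "(\<integral>x. \<bar>f x\<bar> \<partial>m) \<le> (\<integral>x. \<bar>k x\<bar> \<partial>M)" "w \<in> D" "nrm w \<le> \<epsilon>"
    "\<And>v g. bqc v g \<Longrightarrow> (\<integral>x. k x * g x \<partial>M) = (\<integral>x. f x * v x \<partial>m) + a w v"
proof -
  define X where "X = {v. \<exists>g. bqc v g}"
  \<comment> \<open>The choice of version is immaterial: two versions of v differ by a version of v
    - v, where the bound C * nrm is 0.\<close>
  define \<rho> where "\<rho> v = (\<integral>x. k x * (SOME g. bqc v g) x \<partial>M)" for v
  have \<rho>: "\<rho> v = (\<integral>x. k x * g x \<partial>M)" if vg: "bqc v g" for v g
  proof -
    let ?h = "SOME g. bqc v g"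
    have vh: "bqc v ?h" using vg by (rule someI[of "bqc v"])
    have "\<bar>\<integral>x. k x * (g x - ?h x) \<partial>M\<bar> \<le> C * nrm (\<lambda>x. v x - v x)"
      by (rule C(2)[OF bqc_diff[OF vg vh]])
    then have "(\<integral>x. k x * (g x - ?h x) \<partial>M) = 0" by simp
    then show ?thesis
      unfolding \<rho>_def using L2.B_diff2[OF bqc_L2[OF vg] bqc_L2[OF vh] k] by simp
  qed
  have XD: "X \<subseteq> D" unfolding X_def using bqc_D by blast
  have X0: "(\<lambda>x. 0) \<in> X" unfolding X_def using bqc_zero by blast
  have Xl: "(\<lambda>x. u x + t * v x) \<in> X" if "u \<in> X" "v \<in> X" for u v t
    using that bqc_linear unfolding X_def by blast
  have \<rho>l: "\<rho> (\<lambda>x. u x + t * v x) = \<rho> u + t * \<rho> v" if uv: "u \<in> X" "v \<in> X" for u v t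
  proof -
    obtain g h where gh: "bqc u g" "bqc v h" using uv unfolding X_def by blast
    note L = bqc_L2[OF gh(1)] bqc_L2[OF gh(2)]
    have "\<rho> (\<lambda>x. u x + t * v x) = (\<integral>x. k x * (g x + t * h x) \<partial>M)" by (rule \<rho>[OF bqc_linear[OF gh]])
    also have "\<dots> = (\<integral>x. k x * g x \<partial>M) + t * (\<integral>x. k x * h x \<partial>M)"
      using L2.B_add2[OF L(1) L2.scale[OF L(2)] k, of t] L2.B_scale2[OF L(2) k, of t] by simp
    finally show ?thesis using \<rho>[OF gh(1)] \<rho>[OF gh(2)] by simp
  qed
  have \<rho>b: "\<bar>\<rho> u\<bar> \<le> C * nrm u" if u: "u \<in> X" for u
  proof -
    obtain g where "bqc u g" using u unfolding X_def by blast
    then show ?thesis using \<rho> C(2) by simp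
  qed
  have riesz': "\<exists>w s. w \<in> D \<and> (\<forall>v\<in>X. a w v + \<beta> * (\<integral>x. w x * v x \<partial>m) = \<rho> v) \<and>
      (\<forall>n::nat. s n \<in> X) \<and> (\<lambda>n. nrm (\<lambda>x. s n x - w x)) \<longlonglongrightarrow> 0" if \<beta>: "0 \<le> \<beta>" for \<beta>
    by (rule riesz[OF XD X0 Xl \<rho>l \<rho>b C(1) \<beta>]) blast+
  obtain w0 s0 where w0: "w0 \<in> D" "\<And>v. v \<in> X \<Longrightarrow> a w0 v + 0 * (\<integral>x. w0 x * v x \<partial>m) = \<rho> v"
    "\<And>n::nat. s0 n \<in> X" "(\<lambda>n. nrm (\<lambda>x. s0 n x - w0 x)) \<longlonglongrightarrow> 0"
    using riesz'[OF order_refl] by blast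
  have a_w0: "a w0 v = \<rho> v" if "v \<in> X" for v using w0(2)[OF that] by simp
  define K where "K = nrm w0"
  have K: "0 \<le> K" unfolding K_def using w0(1) by simp
  have "0 < \<epsilon>\<^sup>2" using \<epsilon> by simp
  from weakly_null[OF w0(1) this K] obtain \<theta>
    where \<theta>: "0 < \<theta>" "\<And>x. x \<in> D \<Longrightarrow> nrm x \<le> K \<Longrightarrow> l2norm m x < \<theta> \<Longrightarrow> a w0 x < \<epsilon>\<^sup>2" by blast
  \<comment> \<open>The energy identity yields \<alpha> |w|^2 \<le> K^2 with the L^2 norm, so this
    \<alpha> forces \<open>l2norm m w < \<theta>\<close>. The 1 makes the inequality strict and
    \<alpha> positive.\<close>
  define \<alpha> where "\<alpha> = (K\<^sup>2 + 1) / \<theta>\<^sup>2"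
  have \<alpha>: "0 < \<alpha>" unfolding \<alpha>_def using \<theta>(1) by (simp add: add_nonneg_pos)
  obtain w s where w: "w \<in> D" "\<And>v. v \<in> X \<Longrightarrow> a w v + \<alpha> * (\<integral>x. w x * v x \<partial>m) = \<rho> v"
    and s: "\<And>n::nat. s n \<in> X" "(\<lambda>n. nrm (\<lambda>x. s n x - w x)) \<longlonglongrightarrow> 0"
    using riesz'[OF less_imp_le[OF \<alpha>]] by blast
  have sD: "s n \<in> D" for n using s(1) XD by blast
  note wL = D_L2[OF w(1)] and sL = D_L2[OF sD]
  have s_l2: "(\<lambda>n. l2norm m (\<lambda>x. s n x - w x)) \<longlonglongrightarrow> 0" by (rule l2norm_tendsto[OF sD w(1) s(2)])
  \<comment> \<open>The equation of w tested with w, reached through \<open>s n\<close>; a w0 w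
    replaces \<rho> w, which is meaningless unless w has a version. It bounds the squared norm of w
    by a w0 w, which \<open>weakly_null\<close> makes less than \<epsilon>^2.\<close>
  have energy: "(nrm w)\<^sup>2 + \<alpha> * (l2norm m w)\<^sup>2 = a w0 w"
  proof -
    have eq: "a (s n) w + \<alpha> * (\<integral>x. s n x * w x \<partial>m) = a (s n) w0" for n
      using w(2)[OF s(1)] a_w0[OF s(1)] A.sym[OF sD w(1)] A.sym[OF sD w0(1)] by (simp add: mult.commute)
    have "(\<lambda>n. a (s n) w + \<alpha> * (\<integral>x. s n x * w x \<partial>m)) \<longlonglongrightarrow> a w w + \<alpha> * (\<integral>x. w x * w x \<partial>m)"
      by (intro tendsto_intros A.B_tendsto[OF sD w(1) w(1) s(2)] L2.B_tendsto[OF sL wL wL s_l2])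
    moreover have "(\<lambda>n. a (s n) w0) \<longlonglongrightarrow> a w w0" by (rule A.B_tendsto[OF sD w(1) w0(1) s(2)])
    ultimately have "a w w + \<alpha> * (\<integral>x. w x * w x \<partial>m) = a w w0" unfolding eq by (rule LIMSEQ_unique)
    then show ?thesis using A.N_sq[OF w(1)] L2.N_sq[OF wL] A.sym[OF w(1) w0(1)] by simp
  qed
  have nw: "nrm w \<le> K"
  proof -
    have "0 \<le> \<alpha> * (l2norm m w)\<^sup>2" using \<alpha> by simp
    then have "nrm w * nrm w \<le> a w0 w" using energy unfolding power2_eq_square by linarith
    also have "\<dots> \<le> K * nrm w" using A.cauchy_schwarz[OF w0(1) w(1)] unfolding K_def by linarith
    finally have le: "nrm w * nrm w \<le> K * nrm w" .
    show ?thesis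
    proof (cases "nrm w = 0")
      case False
      then have "0 < nrm w" using A.N_nonneg[OF w(1)] by linarith
      then show ?thesis using le by simp
    qed (use K in simp)
  qed
  have lw: "l2norm m w < \<theta>"
  proof (rule power2_less_imp_less)
    have "a w0 w \<le> K * nrm w" using A.cauchy_schwarz[OF w0(1) w(1)] unfolding K_def by linarith
    also have "\<dots> \<le> K * K" using nw K by (rule mult_left_mono)
    finally have "\<alpha> * (l2norm m w)\<^sup>2 \<le> K * K" using energy zero_le_power2[of "nrm w"] by linarith
    then have "\<alpha> * (l2norm m w)\<^sup>2 < K\<^sup>2 + 1" by (simp add: power2_eq_square)
    also have "K\<^sup>2 + 1 = \<alpha> * \<theta>\<^sup>2" unfolding \<alpha>_def using \<theta>(1) by simp
    finally show "(l2norm m w)\<^sup>2 < \<theta>\<^sup>2" using \<alpha> by simp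
  qed (use \<theta>(1) in simp)
  have w_small: "nrm w \<le> \<epsilon>"
  proof (rule power2_le_imp_le)
    have "0 \<le> \<alpha> * (l2norm m w)\<^sup>2" using \<alpha> by simp
    then show "(nrm w)\<^sup>2 \<le> \<epsilon>\<^sup>2" using energy \<theta>(2)[OF w(1) nw lw] by linarith
  qed (use \<epsilon> in simp)
  define I where "I = (\<integral>x. \<bar>k x\<bar> \<partial>M)"
  have I: "0 \<le> I" unfolding I_def by (simp add: Bochner_Integration.integral_nonneg)
  \<comment> \<open>The admissible test function is the clipped \<open>s n\<close>, whose version is
    bounded by \<delta>. The term a (s n) (clipped s n) is nonnegative and is dropped; replacing w
    by \<open>s n\<close> in the first argument costs at most |s n - w| times 2 |s n|.\<close>
  have clip_le: "\<alpha> * (\<integral>x. w x * max (min (w x) \<delta>) (- \<delta>) \<partial>m) \<le> \<delta> * I" if \<delta>: "0 < \<delta>" for \<delta>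
  proof -
    let ?c = "\<lambda>u x. max (min (u x) \<delta>) (- \<delta> :: real)"
    have cD: "?c (s n) \<in> D" for n by (rule clip[OF sD \<delta>])
    have cwD: "?c w \<in> D" by (rule clip[OF w(1) \<delta>])
    have le: "\<alpha> * (\<integral>x. ?c (s n) x * w x \<partial>m) \<le> \<delta> * I + nrm (\<lambda>x. s n x - w x) * (2 * nrm (s n))" for n
    proof -
      obtain g where g: "bqc (s n) g" using s(1)[of n] unfolding X_def by blast
      note cg = bqc_clip[OF g \<delta>]
      have "?c (s n) \<in> X" using cg unfolding X_def by blast
      then have "a w (?c (s n)) + \<alpha> * (\<integral>x. w x * ?c (s n) x \<partial>m) = (\<integral>x. k x * ?c g x \<partial>M)"
        using w(2) \<rho>[OF cg] by simp
      also have "\<dots> \<le> (\<integral>x. \<delta> * \<bar>k x\<bar> \<partial>M)"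
      proof (rule integral_mono[OF L2_mult[OF k bqc_L2[OF cg]]])
        show "integrable M (\<lambda>x. \<delta> * \<bar>k x\<bar>)" using M.L2_integrable[OF k] by simp
        fix x
        have "\<bar>?c g x\<bar> \<le> \<delta>" using \<delta> by (simp add: abs_le_iff min_def max_def)
        then have "\<bar>k x\<bar> * \<bar>?c g x\<bar> \<le> \<bar>k x\<bar> * \<delta>" by (intro mult_left_mono) auto
        then show "k x * ?c g x \<le> \<delta> * \<bar>k x\<bar>"
          using abs_ge_self[of "k x * ?c g x"] by (simp add: abs_mult mult.commute)
      qed
      also have "\<dots> = \<delta> * I" unfolding I_def by simp
      finally have 1: "a w (?c (s n)) + \<alpha> * (\<integral>x. w x * ?c (s n) x \<partial>m) \<le> \<delta> * I" .
      have "a (s n) (?c (s n)) - a w (?c (s n)) = a (\<lambda>x. s n x - w x) (?c (s n))"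
        by (rule A.B_diff1[OF sD w(1) cD, symmetric])
      also have "\<dots> \<le> nrm (\<lambda>x. s n x - w x) * nrm (?c (s n))"
        using A.cauchy_schwarz[OF A.diff[OF sD w(1)] cD, of n n] by linarith
      also have "\<dots> \<le> nrm (\<lambda>x. s n x - w x) * (2 * nrm (s n))"
        by (rule mult_left_mono[OF clip(2)[OF sD \<delta>] A.N_nonneg[OF A.diff[OF sD w(1)]]])
      finally have "- a w (?c (s n)) \<le> nrm (\<lambda>x. s n x - w x) * (2 * nrm (s n))"
        using clip(3)[OF sD \<delta>, of n] by linarith
      then show ?thesis using 1 by (simp add: mult.commute)
    qed
    have c_l2: "(\<lambda>n. l2norm m (\<lambda>x. ?c (s n) x - ?c w x)) \<longlonglongrightarrow> 0"
    proof (rule Lim_null_comparison[OF always_eventually[OF allI] s_l2])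
      fix n
      have "l2norm m (\<lambda>x. ?c (s n) x - ?c w x) \<le> l2norm m (\<lambda>x. s n x - w x)"
      proof (rule l2norm_mono[OF L2.diff[OF sL wL] L2_measurable[OF L2.diff[OF D_L2[OF cD] D_L2[OF cwD]]]])
        show "AE x in m. \<bar>?c (s n) x - ?c w x\<bar> \<le> \<bar>s n x - w x\<bar>"
          by (rule AE_I2) (use \<delta> in \<open>simp add: min_def max_def\<close>)
      qed
      then show "norm (l2norm m (\<lambda>x. ?c (s n) x - ?c w x)) \<le> l2norm m (\<lambda>x. s n x - w x)"
        using L2.N_nonneg[OF L2.diff[OF D_L2[OF cD] D_L2[OF cwD]], of n] by simp
    qed
    have "(\<lambda>n. \<alpha> * (\<integral>x. ?c (s n) x * w x \<partial>m)) \<longlonglongrightarrow> \<alpha> * (\<integral>x. ?c w x * w x \<partial>m)"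
      by (intro tendsto_mult_left L2.B_tendsto[OF D_L2[OF cD] D_L2[OF cwD] wL c_l2])
    moreover have "(\<lambda>n. \<delta> * I + nrm (\<lambda>x. s n x - w x) * (2 * nrm (s n))) \<longlonglongrightarrow> \<delta> * I + 0 * (2 * nrm w)"
      by (intro tendsto_intros s(2) A.N_tendsto[OF sD w(1) s(2)])
    ultimately have "\<alpha> * (\<integral>x. ?c w x * w x \<partial>m) \<le> \<delta> * I + 0 * (2 * nrm w)"
      by (rule LIMSEQ_le) (use le in blast)
    then show ?thesis by (simp add: mult.commute)
  qed
  \<comment> \<open>For height \<delta> = 1 / (j + 1), the product of w with w clipped at \<delta>,
    divided by \<delta>, tends pointwise to |w|. Fatou's lemma transfers the bound, and with it the
    integrability of \<alpha> w.\<close>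
  define y where "y j x = \<alpha> * (real (Suc j) * (w x * max (min (w x) (1 / real (Suc j))) (- (1 / real (Suc j)))))"
    for j x
  have y_nonneg: "0 \<le> y j x" for j x
  proof -
    have "0 \<le> t * max (min t d) (- d)" if "0 < d" for t d :: real
      using that by (cases "0 \<le> t") (auto simp: zero_le_mult_iff min_def max_def)
    from this[of "1 / real (Suc j)" "w x"]
    have "0 \<le> w x * max (min (w x) (1 / real (Suc j))) (- (1 / real (Suc j)))" by simp
    from mult_nonneg_nonneg[OF less_imp_le[OF \<alpha>] mult_nonneg_nonneg[OF of_nat_0_le_iff this]]
    show ?thesis unfolding y_def .
  qed
  have y_int: "integrable m (y j)" and y_le: "(\<integral>x. y j x \<partial>m) \<le> I" for j
  proof -
    have d: "0 < 1 / real (Suc j)" by simp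
    let ?z = "\<lambda>x. w x * max (min (w x) (1 / real (Suc j))) (- (1 / real (Suc j)))"
    have z: "integrable m ?z" by (rule L2_mult[OF wL D_L2[OF clip(1)[OF w(1) d]]])
    then show "integrable m (y j)" unfolding y_def by (intro integrable_mult_right)
    have "(\<integral>x. y j x \<partial>m) = real (Suc j) * (\<alpha> * (\<integral>x. ?z x \<partial>m))"
      unfolding y_def by simp
    also have "\<dots> \<le> real (Suc j) * (1 / real (Suc j) * I)" using clip_le[OF d] by (rule mult_left_mono) simp
    finally show "(\<integral>x. y j x \<partial>m) \<le> I" by simp
  qed
  let ?f = "\<lambda>x. \<alpha> * w x"
  have fm: "?f \<in> borel_measurable m" by (rule L2_measurable[OF L2.scale[OF wL]])
  have y_lim: "(\<lambda>j. y j x) \<longlonglongrightarrow> \<bar>?f x\<bar>" for x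
  proof (cases "w x = 0")
    case False
    obtain N where N: "1 / real (Suc N) < \<bar>w x\<bar>"
      using reals_Archimedean[of "\<bar>w x\<bar>"] False by (auto simp: inverse_eq_divide)
    have "y j x = \<bar>?f x\<bar>" if "N \<le> j" for j
    proof -
      have "1 / real (Suc j) \<le> 1 / real (Suc N)" using that by (intro divide_left_mono) auto
      then have less: "1 / real (Suc j) < \<bar>w x\<bar>" using N by linarith
      have pos: "0 < 1 / real (Suc j)" by simp
      have "w x * max (min (w x) (1 / real (Suc j))) (- (1 / real (Suc j))) = \<bar>w x\<bar> * (1 / real (Suc j))"
      proof -
        have "t * max (min t d) (- d) = \<bar>t\<bar> * d" if "0 < d" "d < \<bar>t\<bar>" for t d :: real
          using that by (cases "0 \<le> t") (auto simp: min_def max_def)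
        from this[OF pos less] show ?thesis .
      qed
      then have "y j x = \<alpha> * \<bar>w x\<bar>" unfolding y_def by simp
      then show ?thesis using \<alpha> by (simp add: abs_mult)
    qed
    then show ?thesis by (intro tendsto_eventually) (auto simp: eventually_sequentially)
  qed (simp add: y_def)
  have "(\<integral>\<^sup>+x. ennreal \<bar>?f x\<bar> \<partial>m) = (\<integral>\<^sup>+x. liminf (\<lambda>j. ennreal (y j x)) \<partial>m)"
  proof (rule nn_integral_cong)
    fix x
    have "(\<lambda>j. ennreal (y j x)) \<longlonglongrightarrow> ennreal \<bar>?f x\<bar>" by (rule tendsto_ennrealI[OF y_lim])
    then show "ennreal \<bar>?f x\<bar> = liminf (\<lambda>j. ennreal (y j x))"
      by (intro lim_imp_Liminf[symmetric]) auto
  qed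
  also have "\<dots> \<le> liminf (\<lambda>j. \<integral>\<^sup>+x. ennreal (y j x) \<partial>m)"
    using borel_measurable_integrable[OF y_int] by (intro nn_integral_liminf) measurable
  also have "\<dots> \<le> liminf (\<lambda>j::nat. ennreal I)"
  proof (intro Liminf_mono always_eventually allI)
    fix j
    have "(\<integral>\<^sup>+x. ennreal (y j x) \<partial>m) = ennreal (\<integral>x. y j x \<partial>m)"
      using y_nonneg by (intro nn_integral_eq_integral[OF y_int]) simp
    then show "(\<integral>\<^sup>+x. ennreal (y j x) \<partial>m) \<le> ennreal I" using ennreal_leI[OF y_le] by simp
  qed
  also have "\<dots> = ennreal I" by (rule Liminf_const) simp
  finally have nn: "(\<integral>\<^sup>+x. ennreal \<bar>?f x\<bar> \<partial>m) \<le> ennreal I" .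
  have f_int: "integrable m ?f"
    by (rule integrableI_bounded[OF fm]) (use le_less_trans[OF nn ennreal_less_top] in simp)
  have "ennreal (\<integral>x. \<bar>?f x\<bar> \<partial>m) \<le> ennreal I"
    using nn nn_integral_eq_integral[OF integrable_abs[OF f_int]] by simp
  then have f_le: "(\<integral>x. \<bar>?f x\<bar> \<partial>m) \<le> I" using I by (simp add: ennreal_le_iff)
  have "(\<integral>x. k x * g x \<partial>M) = (\<integral>x. ?f x * v x \<partial>m) + a w v" if vg: "bqc v g" for v g
  proof -
    have "v \<in> X" using vg unfolding X_def by blast
    then have "a w v + \<alpha> * (\<integral>x. w x * v x \<partial>m) = (\<integral>x. k x * g x \<partial>M)" using w(2) \<rho>[OF vg] by simp
    then show ?thesis by (simp add: mult.assoc)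
  qed
  from that[OF f_int f_le[unfolded I_def] w(1) w_small this] show thesis .
qed

text \<open>The \<open>f n\<close> are summed in L^1(m) and the \<open>w n\<close> in D, both
  absolutely. The identity survives the limit because g is bounded: u is then essentially bounded
  and can be integrated against L^1 functions. The functional obtained is \<open>a W\<close> for an
  element W of D.\<close>

lemma decomposition:
  obtains f \<nu> where "integrable m f" "\<nu> \<in> form_dual m D \<E>"
    "\<And>u g. bqc u g \<Longrightarrow> (\<integral>x. g x \<partial>M) = (\<integral>x. f x * u x \<partial>m) + \<nu> u"
proof -
  define fin where "fin k \<longleftrightarrow> k \<in> L2 M \<and>
    (\<exists>C\<ge>0. \<forall>v g. bqc v g \<longrightarrow> \<bar>\<integral>x. k x * g x \<partial>M\<bar> \<le> C * nrm v)" for k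
  have one: "(\<lambda>x. 1) \<in> L2 M" by (rule M.const_L2)
  have "\<forall>n. \<exists>k. fin k \<and> l2norm M (\<lambda>x. 1 - k x) < (1/2)^n"
  proof
    fix n :: nat
    have "(0 :: real) < (1/2)^n" by simp
    then obtain k C where "k \<in> L2 M" "0 \<le> C" "\<And>v g. bqc v g \<Longrightarrow> \<bar>\<integral>x. k x * g x \<partial>M\<bar> \<le> C * nrm v"
      "l2norm M (\<lambda>x. 1 - k x) < (1/2)^n" by (rule finite_energy_dense) blast
    then show "\<exists>k. fin k \<and> l2norm M (\<lambda>x. 1 - k x) < (1/2)^n" unfolding fin_def by blast
  qed
  from choice[OF this] obtain k where k: "\<And>n. fin (k n)" "\<And>n. l2norm M (\<lambda>x. 1 - k n x) < (1/2)^n"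
    by blast
  \<comment> \<open>Shifting k by one and starting at 0 makes the increments telescope to
    \<open>K n\<close> without a leftover initial term.\<close>
  define K where "K n = (case n of 0 \<Rightarrow> (\<lambda>x. 0) | Suc i \<Rightarrow> k i)" for n
  have K_simps [simp]: "K 0 = (\<lambda>x. 0)" "K (Suc n) = k n" for n unfolding K_def by simp_all
  have "fin (\<lambda>x. 0)"
    unfolding fin_def using A.N_nonneg bqc_D by (auto intro!: exI[of _ 0])
  then have K: "fin (K n)" for n using k(1) by (cases n) simp_all
  have KL: "K n \<in> L2 M" for n using K unfolding fin_def by blast
  define r where "r n x = K (Suc n) x - K n x" for n x
  have rL: "r n \<in> L2 M" for n unfolding r_def by (rule L2.diff[OF KL KL])
  have r_sum: "(\<Sum>i<n. r i x) = K n x" for n x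
    unfolding r_def using sum_lessThan_telescope[of "\<lambda>i. K i x" n] by simp
  have "\<forall>n. \<exists>p. integrable m (fst p) \<and> (\<integral>x. \<bar>fst p x\<bar> \<partial>m) \<le> (\<integral>x. \<bar>r n x\<bar> \<partial>M) \<and>
      snd p \<in> D \<and> nrm (snd p) \<le> (1/2)^n \<and>
      (\<forall>v g. bqc v g \<longrightarrow> (\<integral>x. r n x * g x \<partial>M) = (\<integral>x. fst p x * v x \<partial>m) + a (snd p) v)"
  proof
    fix n :: nat
    obtain C where C: "0 \<le> C" "\<And>v g. bqc v g \<Longrightarrow> \<bar>\<integral>x. K n x * g x \<partial>M\<bar> \<le> C * nrm v"
      using K[of n] unfolding fin_def by blast
    obtain C' where C': "0 \<le> C'" "\<And>v g. bqc v g \<Longrightarrow> \<bar>\<integral>x. K (Suc n) x * g x \<partial>M\<bar> \<le> C' * nrm v"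
      using K[of "Suc n"] unfolding fin_def by blast
    have "\<bar>\<integral>x. r n x * g x \<partial>M\<bar> \<le> (C + C') * nrm v" if vg: "bqc v g" for v g
      using L2.B_diff1[OF KL KL bqc_L2[OF vg], of "Suc n" n] C(2)[OF vg] C'(2)[OF vg]
      unfolding r_def distrib_right by linarith
    from finite_energy_approx[OF rL add_nonneg_nonneg[OF C(1) C'(1)] this, of "(1/2)^n"]
    obtain f w where "integrable m f" "(\<integral>x. \<bar>f x\<bar> \<partial>m) \<le> (\<integral>x. \<bar>r n x\<bar> \<partial>M)" "w \<in> D" "nrm w \<le> (1/2)^n"
      "\<And>v g. bqc v g \<Longrightarrow> (\<integral>x. r n x * g x \<partial>M) = (\<integral>x. f x * v x \<partial>m) + a w v" by auto
    then show "\<exists>p. integrable m (fst p) \<and> (\<integral>x. \<bar>fst p x\<bar> \<partial>m) \<le> (\<integral>x. \<bar>r n x\<bar> \<partial>M) \<and>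
      snd p \<in> D \<and> nrm (snd p) \<le> (1/2)^n \<and>
      (\<forall>v g. bqc v g \<longrightarrow> (\<integral>x. r n x * g x \<partial>M) = (\<integral>x. fst p x * v x \<partial>m) + a (snd p) v)"
      by (intro exI[of _ "(f, w)"]) simp
  qed
  from choice[OF this] obtain p where p: "\<And>n. integrable m (fst (p n)) \<and>
      (\<integral>x. \<bar>fst (p n) x\<bar> \<partial>m) \<le> (\<integral>x. \<bar>r n x\<bar> \<partial>M) \<and> snd (p n) \<in> D \<and> nrm (snd (p n)) \<le> (1/2)^n \<and>
      (\<forall>v g. bqc v g \<longrightarrow> (\<integral>x. r n x * g x \<partial>M) = (\<integral>x. fst (p n) x * v x \<partial>m) + a (snd (p n)) v)"
    by blast
  define f w where "f n = fst (p n)" and "w n = snd (p n)" for n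
  have f: "integrable m (f n)" "(\<integral>x. \<bar>f n x\<bar> \<partial>m) \<le> (\<integral>x. \<bar>r n x\<bar> \<partial>M)"
    and w: "w n \<in> D" "nrm (w n) \<le> (1/2)^n"
    and fw: "bqc v g \<Longrightarrow> (\<integral>x. r n x * g x \<partial>M) = (\<integral>x. f n x * v x \<partial>m) + a (w n) v" for n v g
    using p[of n] unfolding f_def w_def by auto
  let ?c = "l2norm M (\<lambda>x. 1)"
  have c: "0 \<le> ?c" by (rule L2.N_nonneg[OF one])
  have r_le: "l2norm M (r (Suc n)) \<le> 2 * (1/2)^n" for n
  proof -
    have "l2norm M (\<lambda>x. k (Suc n) x - k n x) \<le> l2norm M (\<lambda>x. k (Suc n) x - 1) + l2norm M (\<lambda>x. 1 - k n x)"
      using L2.N_triangle3[OF KL[of "Suc (Suc n)"] one KL[of "Suc n"]] by simp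
    also have "l2norm M (\<lambda>x. k (Suc n) x - 1) = l2norm M (\<lambda>x. 1 - k (Suc n) x)"
      using L2.N_diff_commute[OF KL[of "Suc (Suc n)"] one] by simp
    also have "l2norm M (\<lambda>x. 1 - k (Suc n) x) + l2norm M (\<lambda>x. 1 - k n x) \<le> (1/2)^Suc n + (1/2)^n"
      using k(2)[of n] k(2)[of "Suc n"] by (intro add_mono) auto
    also have "\<dots> \<le> 2 * (1/2)^n" by simp
    finally show ?thesis unfolding r_def by simp
  qed
  \<comment> \<open>The first increment \<open>r 0 = k 0\<close> is not among the small differences,
    so the comparison starts at index 1.\<close>
  have f_sum: "summable (\<lambda>n. \<integral>x. \<bar>f n x\<bar> \<partial>m)"
  proof (rule summable_Suc_iff[THEN iffD1], rule summable_comparison_test'[of "\<lambda>n. ?c * (2 * (1/2)^n)" 0])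
    show "summable (\<lambda>n. ?c * (2 * (1/2)^n))" by (intro summable_mult summable_geometric) simp
    fix n
    have "(\<integral>x. \<bar>f (Suc n) x\<bar> \<partial>m) \<le> ?c * l2norm M (r (Suc n))"
      using f(2) M.integral_abs_le_l2norm[OF rL] by (rule order_trans)
    also have "\<dots> \<le> ?c * (2 * (1/2)^n)" using r_le c by (rule mult_left_mono)
    finally show "norm (\<integral>x. \<bar>f (Suc n) x\<bar> \<partial>m) \<le> ?c * (2 * (1/2)^n)"
      by (simp add: Bochner_Integration.integral_nonneg)
  qed
  note f_AE = AE_summable_if_integrals_summable[OF f(1) f_sum]
  define F where "F x = (\<Sum>n. f n x)" for x
  have F: "integrable m F"
    unfolding F_def
  proof (rule integrable_suminf[OF f(1)])
    show "AE x in m. summable (\<lambda>i. norm (f i x))" using f_AE by simp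
    show "summable (\<lambda>i. \<integral>x. norm (f i x) \<partial>m)" using f_sum by simp
  qed
  have "summable (\<lambda>i. nrm (w i))"
  proof (rule summable_comparison_test'[of "\<lambda>i. (1/2)^i" 0])
    show "summable (\<lambda>i. (1/2 :: real)^i)" by (rule summable_geometric) simp
    show "norm (nrm (w n)) \<le> (1/2)^n" for n using w[of n] by simp
  qed
  from series_converges[OF w(1) this]
  obtain W where W: "W \<in> D" "(\<lambda>n. nrm (\<lambda>x. (\<Sum>i<n. w i x) - W x)) \<longlonglongrightarrow> 0" by blast
  have wsD: "(\<lambda>x. \<Sum>i<n. w i x) \<in> D" for n by (rule A.sum) (rule w(1))
  have dual: "(\<lambda>u. a W u) \<in> form_dual m D \<E>"
  proof -
    have "linear_functional D (a W)"
      using A.bilinear W(1) unfolding bilinear_form_def by blast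
    moreover have "\<bar>a W u\<bar> \<le> nrm W * form_norm m \<E> u" if "u \<in> D" for u
      unfolding form_norm_eq by (rule A.cauchy_schwarz[OF W(1) that])
    ultimately show ?thesis unfolding form_dual_def by blast
  qed
  have "(\<integral>x. g x \<partial>M) = (\<integral>x. F x * u x \<partial>m) + a W u" if ug: "bqc u g" for u g
  proof -
    note uD = bqc_D[OF ug] and gL = bqc_L2[OF ug]
    have um [measurable]: "u \<in> borel_measurable m" by (rule D_measurable[OF uD])
    have fm [measurable]: "f n \<in> borel_measurable m" for n by (rule borel_measurable_integrable[OF f(1)])
    obtain C where C: "0 \<le> C" "\<And>x. \<bar>g x\<bar> \<le> C" using bqc_bounded[OF ug] by blast
    have uC: "AE x in m. \<bar>u x\<bar> \<le> C"
    proof -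
      have "AE x in m. g x = u x" using bqc_qc[OF ug] unfolding qc_version_def by blast
      then show ?thesis by eventually_elim (use C(2) in metis)
    qed
    have fu_le: "AE x in m. \<bar>f n x * u x\<bar> \<le> C * \<bar>f n x\<bar>" for n
      using uC
    proof eventually_elim
      fix x assume "\<bar>u x\<bar> \<le> C"
      then have "\<bar>f n x\<bar> * \<bar>u x\<bar> \<le> \<bar>f n x\<bar> * C" by (rule mult_left_mono) simp
      then show "\<bar>f n x * u x\<bar> \<le> C * \<bar>f n x\<bar>" by (simp add: abs_mult mult.commute)
    qed
    have Cf: "integrable m (\<lambda>x. C * \<bar>f n x\<bar>)" for n using f(1) by simp
    have fu: "integrable m (\<lambda>x. f n x * u x)" for n
    proof (rule Bochner_Integration.integrable_bound[OF Cf])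
      show "AE x in m. norm (f n x * u x) \<le> norm (C * \<bar>f n x\<bar>)"
        using fu_le[of n] by eventually_elim (use C(1) in \<open>simp add: abs_mult\<close>)
    qed measurable
    have fu_AE: "AE x in m. summable (\<lambda>n. norm (f n x * u x))"
      using f_AE
    proof eventually_elim
      fix x assume "summable (\<lambda>n. \<bar>f n x\<bar>)"
      from summable_mult2[OF this, of "\<bar>u x\<bar>"] show "summable (\<lambda>n. norm (f n x * u x))"
        by (simp add: abs_mult)
    qed
    have fu_sum: "summable (\<lambda>n. \<integral>x. norm (f n x * u x) \<partial>m)"
    proof (rule summable_comparison_test'[OF summable_mult[OF f_sum, of C], of 0])
      fix n
      have "(\<integral>x. \<bar>f n x * u x\<bar> \<partial>m) \<le> (\<integral>x. C * \<bar>f n x\<bar> \<partial>m)"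
        by (rule integral_mono_AE[OF integrable_abs[OF fu] Cf fu_le])
      then show "norm (\<integral>x. norm (f n x * u x) \<partial>m) \<le> C * (\<integral>x. \<bar>f n x\<bar> \<partial>m)"
        by (simp add: Bochner_Integration.integral_nonneg)
    qed
    have "(\<lambda>n. \<integral>x. f n x * u x \<partial>m) sums (\<integral>x. (\<Sum>n. f n x * u x) \<partial>m)"
      by (rule sums_integral[OF fu fu_AE fu_sum])
    also have "(\<integral>x. (\<Sum>n. f n x * u x) \<partial>m) = (\<integral>x. F x * u x \<partial>m)"
    proof (rule integral_cong_AE)
      show "(\<lambda>x. \<Sum>n. f n x * u x) \<in> borel_measurable m" by measurable
      show "(\<lambda>x. F x * u x) \<in> borel_measurable m" unfolding F_def by measurable
      show "AE x in m. (\<Sum>n. f n x * u x) = F x * u x"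
        using f_AE
      proof eventually_elim
        fix x assume "summable (\<lambda>n. \<bar>f n x\<bar>)"
        then have "summable (\<lambda>n. f n x)" by (rule summable_rabs_cancel)
        from suminf_mult2[OF this, of "u x"] show "(\<Sum>n. f n x * u x) = F x * u x"
          unfolding F_def by simp
      qed
    qed
    finally have 1: "(\<lambda>n. \<Sum>i<n. \<integral>x. f i x * u x \<partial>m) \<longlonglongrightarrow> (\<integral>x. F x * u x \<partial>m)"
      unfolding sums_def .
    have 2: "(\<lambda>n. \<Sum>i<n. a (w i) u) \<longlonglongrightarrow> a W u"
      using A.B_tendsto[OF wsD W(1) uD W(2)] A.B_sum1[OF w(1) uD] by simp
    have K_eq: "(\<integral>x. K n x * g x \<partial>M) = (\<Sum>i<n. \<integral>x. f i x * u x \<partial>m) + (\<Sum>i<n. a (w i) u)" for n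
    proof -
      have "(\<integral>x. K n x * g x \<partial>M) = (\<integral>x. (\<Sum>i<n. r i x) * g x \<partial>M)" by (simp only: r_sum)
      also have "\<dots> = (\<Sum>i<n. \<integral>x. r i x * g x \<partial>M)" by (rule L2.B_sum1[OF rL gL])
      also have "\<dots> = (\<Sum>i<n. \<integral>x. f i x * u x \<partial>m) + (\<Sum>i<n. a (w i) u)"
        by (simp add: fw[OF ug] sum.distrib)
      finally show ?thesis .
    qed
    have "(\<lambda>n. l2norm M (\<lambda>x. K n x - 1)) \<longlonglongrightarrow> 0"
    proof (rule LIMSEQ_imp_Suc, rule Lim_null_comparison)
      have "norm (l2norm M (\<lambda>x. K (Suc n) x - 1)) \<le> (1/2)^n" for n
        using L2.N_diff_commute[OF KL[of "Suc n"] one] k(2)[of n]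
          L2.N_nonneg[OF L2.diff[OF one KL[of "Suc n"]]] by simp
      then show "\<forall>\<^sub>F n in sequentially. norm (l2norm M (\<lambda>x. K (Suc n) x - 1)) \<le> (1/2)^n"
        by (intro always_eventually allI)
      show "(\<lambda>n. (1/2 :: real)^n) \<longlonglongrightarrow> 0" by (rule LIMSEQ_power_zero) simp
    qed
    from L2.B_tendsto[OF KL one gL this]
    have "(\<lambda>n. (\<Sum>i<n. \<integral>x. f i x * u x \<partial>m) + (\<Sum>i<n. a (w i) u)) \<longlonglongrightarrow> (\<integral>x. g x \<partial>M)"
      unfolding K_eq by simp
    from LIMSEQ_unique[OF this tendsto_add[OF 1 2]] show ?thesis .
  qed
  from that[OF F dual this] show thesis .
qed

end


section \<open>Signed measures\<close>

text \<open>Avoids a Hahn set: for B in A, \<mu> B = \<mu> A - \<mu> (A - B) is at most \<mu> A plus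
  the negative variation of A; then take the supremum over B.\<close>

lemma measure_pos_variation_le:
  assumes \<mu>: "signed_measure \<mu>" and A: "A \<in> sets borel"
    and fin: "emeasure (neg_variation \<mu>) A < \<infinity>"
  shows "measure (pos_variation \<mu>) A \<le> \<mu> A + measure (neg_variation \<mu>) A"
proof -
  let ?n = "measure (neg_variation \<mu>) A"
  have n: "emeasure (neg_variation \<mu>) A = ennreal ?n"
    using fin by (intro emeasure_eq_ennreal_measure) auto
  have le: "\<mu> B \<le> \<mu> A + ?n" if B: "B \<in> sets borel" "B \<subseteq> A" for B
  proof -
    have AB: "A - B \<in> sets borel" using A B(1) by (rule sets.Diff)
    have "\<mu> (B \<union> (A - B)) = \<mu> B + \<mu> (A - B)" by (rule signed_measure_Un[OF \<mu> B(1) AB]) auto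
    also have "B \<union> (A - B) = A" using B(2) by auto
    finally have eq: "\<mu> A = \<mu> B + \<mu> (A - B)" .
    have "ennreal (- \<mu> (A - B)) \<le> emeasure (neg_variation \<mu>) A"
      unfolding neg_variation_def emeasure_pos_variation[OF signed_measure_uminus[OF \<mu>] A]
      using AB by (intro SUP_upper) auto
    then have "- \<mu> (A - B) \<le> ?n" unfolding n by (simp add: ennreal_le_iff)
    then show ?thesis using eq by simp
  qed
  have 0: "0 \<le> \<mu> A + ?n" using le[of "{}"] signed_measure_empty[OF \<mu>] by simp
  have "emeasure (pos_variation \<mu>) A \<le> ennreal (\<mu> A + ?n)"
    unfolding emeasure_pos_variation[OF \<mu> A] using le by (intro SUP_least ennreal_leI) auto
  then show ?thesis unfolding measure_def[of "pos_variation \<mu>"] using 0 by (intro enn2real_leI) auto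
qed

text \<open>The preceding inequality for \<mu> and for -\<mu>, whose variations are
  interchanged.\<close>

lemma jordan_decomposition:
  assumes \<mu>: "signed_measure \<mu>" and A: "A \<in> sets borel"
    and fin: "emeasure (pos_variation \<mu>) A < \<infinity>" "emeasure (neg_variation \<mu>) A < \<infinity>"
  shows "\<mu> A = measure (pos_variation \<mu>) A - measure (neg_variation \<mu>) A"
proof -
  have "measure (neg_variation \<mu>) A \<le> - \<mu> A + measure (pos_variation \<mu>) A"
    using measure_pos_variation_le[OF signed_measure_uminus[OF \<mu>] A] fin(1)
    by (simp add: neg_variation_def)
  then show ?thesis using measure_pos_variation_le[OF \<mu> A fin(2)] by simp
qed

lemma M_b_finite:
  assumes "\<mu> \<in> M_b"
  shows "signed_measure \<mu>" "finite_measure (pos_variation \<mu>)" "finite_measure (neg_variation \<mu>)"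
proof -
  have sp: "space (pos_variation \<mu>) = UNIV" "space (neg_variation \<mu>) = UNIV"
    using sets_eq_imp_space_eq[OF sets_variation(1)[of \<mu>]] sets_eq_imp_space_eq[OF sets_variation(2)[of \<mu>]]
    by simp_all
  have "emeasure (pos_variation \<mu>) UNIV + emeasure (neg_variation \<mu>) UNIV < \<infinity>"
    using assms emeasure_total_variation[of UNIV \<mu>] unfolding M_b_def by simp
  then have "emeasure (pos_variation \<mu>) UNIV \<noteq> \<infinity>" "emeasure (neg_variation \<mu>) UNIV \<noteq> \<infinity>"
    by (auto simp: top_unique)
  then show "finite_measure (pos_variation \<mu>)" "finite_measure (neg_variation \<mu>)"
    by (auto intro!: finite_measureI simp: sp)
  show "signed_measure \<mu>" using assms unfolding M_b_def by blast
qed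

context topological_dirichlet_space
begin

text \<open>A nest witnessing that B is exceptional avoids B, so on each of its sets the indicator
  is constantly 0.\<close>

lemma bqc_indicator:
  assumes B: "B \<in> sets borel" and ex: "exceptional m D \<E> B"
  shows "bqc (\<lambda>x. 0) (indicator B)"
proof -
  obtain F where F: "nest m D \<E> F" "B \<subseteq> (\<Inter>k. - F k)" using ex unfolding exceptional_def by blast
  show ?thesis
  proof (rule bqcI[OF A.zero _ _ F(1)])
    show "indicator B \<in> borel_measurable borel" using B by (rule borel_measurable_indicator)
    show "\<bar>indicator B x\<bar> \<le> (1 :: real)" for x by (simp add: indicator_def)
    show "continuous_on (F k) (indicator B :: 'a \<Rightarrow> real)" for k
    proof -
      have "continuous_on (F k) (\<lambda>x. 0 :: real)" by (rule continuous_on_const)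
      also have "?this \<longleftrightarrow> ?thesis"
        by (intro continuous_on_cong refl) (use F(2) in \<open>auto simp: indicator_def\<close>)
      finally show ?thesis .
    qed
    show "AE x in m. indicator B x = (0 :: real)"
      using exceptional_AE[OF ex] by eventually_elim (simp add: indicator_def)
  qed
qed

lemma exceptional_subset: "exceptional m D \<E> N \<Longrightarrow> B \<subseteq> N \<Longrightarrow> exceptional m D \<E> B"
  unfolding exceptional_def by blast

text \<open>Passes from \<mu> to its variations: Borel subsets of N are exceptional too, so the
  supremum runs over zeros. Applied to -\<mu> it covers the negative variation.\<close>

lemma pos_variation_exceptional:
  assumes \<mu>: "signed_measure \<mu>" and N: "N \<in> sets borel" "exceptional m D \<E> N"
    and null: "\<And>B. B \<in> sets borel \<Longrightarrow> exceptional m D \<E> B \<Longrightarrow> \<mu> B = 0"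
  shows "emeasure (pos_variation \<mu>) N = 0"
proof -
  have "emeasure (pos_variation \<mu>) N \<le> 0"
    unfolding emeasure_pos_variation[OF \<mu> N(1)]
    using null exceptional_subset[OF N(2)] by (intro SUP_least) auto
  then show ?thesis by simp
qed

lemma smooth_finite_measureI:
  assumes "smooth m D \<E> T" "finite_measure P" "sets P = sets borel"
    "\<And>B. B \<in> sets borel \<Longrightarrow> emeasure P B \<le> emeasure T B"
  shows "smooth_finite_measure m D \<E> P"
proof -
  interpret P: finite_measure P by fact
  show ?thesis
  proof unfold_locales
    fix B :: "'a set" assume B: "B \<in> sets borel" "exceptional m D \<E> B"
    then have "emeasure T B = 0" using assms(1) unfolding smooth_def by blast
    then show "emeasure P B = 0" using assms(4)[OF B(1)] by simp
  qed (rule assms(3))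
qed

end

section \<open>The characterisation for signed measures\<close>

theorem corollary3p3:
  fixes m :: "'a::metric_space measure"
    and D :: "('a \<Rightarrow> real) set"
    and \<E> :: "'a form"
    and \<mu> :: "'a set \<Rightarrow> real"
  assumes "lusin_space (euclidean :: 'a topology)"
    and "sets m = sets borel" "sigma_finite_measure m" "full_support m"
    and "dirichlet_form m D \<E>" "quasi_regular m D \<E>"
    and "\<mu> \<in> M_b"
  shows "\<mu> \<in> M_0b m D \<E> \<longleftrightarrow>
    (\<exists>f \<nu>. integrable m f \<and> \<nu> \<in> form_dual m D \<E> \<and>
      (\<forall>u\<in>D. (\<exists>C. AE x in m. \<bar>u x\<bar> \<le> C) \<longrightarrow>
        (\<forall>g. g \<in> borel_measurable borel \<and> bounded (range g) \<and> qc_version m D \<E> u g \<longrightarrow>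
          signed_integral \<mu> g = (\<integral>x. f x * u x \<partial>m) + \<nu> u)))"
proof -
  interpret topological_dirichlet_space m D \<E>
    using assms
    by (intro topological_dirichlet_space.intro dirichlet_space.intro
        topological_dirichlet_space_axioms.intro)
  note \<mu> = M_b_finite[OF assms(7)]
  interpret P: finite_measure "pos_variation \<mu>" by (rule \<mu>)
  interpret N: finite_measure "neg_variation \<mu>" by (rule \<mu>)
  show ?thesis
  proof
    assume "\<mu> \<in> M_0b m D \<E>"
    then have sm: "smooth m D \<E> (total_variation \<mu>)" unfolding M_0b_def by blast
    interpret P': smooth_finite_measure m D \<E> "pos_variation \<mu>"
      by (rule smooth_finite_measureI[OF sm \<mu>(2)]) (simp_all add: emeasure_total_variation)
    interpret N': smooth_finite_measure m D \<E> "neg_variation \<mu>"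
      by (rule smooth_finite_measureI[OF sm \<mu>(3)]) (simp_all add: emeasure_total_variation)
    obtain f \<nu> where f: "integrable m f" "\<nu> \<in> form_dual m D \<E>"
      "\<And>u g. bqc u g \<Longrightarrow> (\<integral>x. g x \<partial>pos_variation \<mu>) = (\<integral>x. f x * u x \<partial>m) + \<nu> u"
      by (rule P'.decomposition) blast
    obtain f' \<nu>' where f': "integrable m f'" "\<nu>' \<in> form_dual m D \<E>"
      "\<And>u g. bqc u g \<Longrightarrow> (\<integral>x. g x \<partial>neg_variation \<mu>) = (\<integral>x. f' x * u x \<partial>m) + \<nu>' u"
      by (rule N'.decomposition) blast
    have dual: "(\<lambda>u. \<nu> u - \<nu>' u) \<in> form_dual m D \<E>"
    proof -
      obtain C where C: "\<And>u. u \<in> D \<Longrightarrow> \<bar>\<nu> u\<bar> \<le> C * form_norm m \<E> u"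
        using f(2) unfolding form_dual_def by blast
      obtain C' where C': "\<And>u. u \<in> D \<Longrightarrow> \<bar>\<nu>' u\<bar> \<le> C' * form_norm m \<E> u"
        using f'(2) unfolding form_dual_def by blast
      have "\<bar>\<nu> u - \<nu>' u\<bar> \<le> (C + C') * form_norm m \<E> u" if "u \<in> D" for u
        using C[OF that] C'[OF that] unfolding distrib_right by linarith
      then show ?thesis
        using f(2) f'(2) unfolding form_dual_def linear_functional_def
        by (auto simp: right_diff_distrib)
    qed
    have "signed_integral \<mu> g = (\<integral>x. (f x - f' x) * u x \<partial>m) + (\<nu> u - \<nu>' u)"
      if u: "u \<in> D" "AE x in m. \<bar>u x\<bar> \<le> C" and ug: "bqc u g" for u g C
    proof -
      have um: "u \<in> borel_measurable m" by (rule D_measurable[OF u(1)])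
      \<comment> \<open>Essential boundedness of u makes both products integrable, so the integral
        of the difference splits.\<close>
      have int: "integrable m (\<lambda>x. h x * u x)" if h: "integrable m h" for h :: "'a \<Rightarrow> real"
      proof (rule Bochner_Integration.integrable_bound)
        show "integrable m (\<lambda>x. C * \<bar>h x\<bar>)" using h by simp
        show "(\<lambda>x. h x * u x) \<in> borel_measurable m"
          using borel_measurable_integrable[OF h] um by (rule borel_measurable_times)
        show "AE x in m. norm (h x * u x) \<le> norm (C * \<bar>h x\<bar>)"
          using u(2)
        proof eventually_elim
          fix x assume "\<bar>u x\<bar> \<le> C"
          then have "\<bar>h x\<bar> * \<bar>u x\<bar> \<le> \<bar>h x\<bar> * \<bar>C\<bar>" by (intro mult_left_mono) auto
          then show "norm (h x * u x) \<le> norm (C * \<bar>h x\<bar>)" by (simp add: abs_mult mult.commute)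
        qed
      qed
      show ?thesis
        unfolding signed_integral_def f(3)[OF ug] f'(3)[OF ug]
        using int[OF f(1)] int[OF f'(1)] by (simp add: left_diff_distrib)
    qed
    then show "\<exists>f \<nu>. integrable m f \<and> \<nu> \<in> form_dual m D \<E> \<and>
      (\<forall>u\<in>D. (\<exists>C. AE x in m. \<bar>u x\<bar> \<le> C) \<longrightarrow>
        (\<forall>g. g \<in> borel_measurable borel \<and> bounded (range g) \<and> qc_version m D \<E> u g \<longrightarrow>
          signed_integral \<mu> g = (\<integral>x. f x * u x \<partial>m) + \<nu> u))"
      using f(1) f'(1) dual unfolding bqc_def
      by (intro exI[of _ "\<lambda>x. f x - f' x"] exI[of _ "\<lambda>u. \<nu> u - \<nu>' u"]) auto
  next
    assume "\<exists>f \<nu>. integrable m f \<and> \<nu> \<in> form_dual m D \<E> \<and>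
      (\<forall>u\<in>D. (\<exists>C. AE x in m. \<bar>u x\<bar> \<le> C) \<longrightarrow>
        (\<forall>g. g \<in> borel_measurable borel \<and> bounded (range g) \<and> qc_version m D \<E> u g \<longrightarrow>
          signed_integral \<mu> g = (\<integral>x. f x * u x \<partial>m) + \<nu> u))"
    then obtain f \<nu> where \<nu>: "\<nu> \<in> form_dual m D \<E>"
      and rep: "\<And>u g C. bqc u g \<Longrightarrow> AE x in m. \<bar>u x\<bar> \<le> C \<Longrightarrow>
        signed_integral \<mu> g = (\<integral>x. f x * u x \<partial>m) + \<nu> u"
      unfolding bqc_def by blast
    have \<nu>0: "\<nu> (\<lambda>x. 0) = 0"
    proof -
      have "\<forall>u\<in>D. \<forall>c. \<nu> (\<lambda>x. c * u x) = c * \<nu> u"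
        using \<nu> unfolding form_dual_def linear_functional_def by blast
      from bspec[OF this A.zero, THEN spec, of 0] show ?thesis by simp
    qed
    have null: "\<mu> B = 0" if B: "B \<in> sets borel" "exceptional m D \<E> B" for B
    proof -
      have "signed_integral \<mu> (indicator B) = 0"
        using rep[OF bqc_indicator[OF B], of 0] \<nu>0 by simp
      moreover have "signed_integral \<mu> (indicator B) = \<mu> B"
        unfolding signed_integral_def
        using jordan_decomposition[OF \<mu>(1) B(1)] P.emeasure_finite[of B] N.emeasure_finite[of B] B(1)
        by (simp flip: less_top)
      ultimately show ?thesis by simp
    qed
    have "emeasure (total_variation \<mu>) B = 0" if B: "B \<in> sets borel" "exceptional m D \<E> B" for B
      using pos_variation_exceptional[OF \<mu>(1) B null]
        pos_variation_exceptional[OF signed_measure_uminus[OF \<mu>(1)] B] null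
      by (simp add: emeasure_total_variation[OF B(1)] neg_variation_def)
    \<comment> \<open>Quasi-regularity supplies the compact nest; |\<mu>| is finite on its sets
      because its total mass is finite.\<close>
    moreover obtain F where F: "nest m D \<E> F" "\<And>k. compact (F k)"
      using assms(6) unfolding quasi_regular_def by blast
    moreover have "emeasure (total_variation \<mu>) (F k) < \<infinity>" for k
    proof -
      have "emeasure (total_variation \<mu>) (F k) \<le> emeasure (total_variation \<mu>) UNIV"
        by (rule emeasure_mono) simp_all
      then show ?thesis using assms(7) unfolding M_b_def by (auto intro: le_less_trans)
    qed
    ultimately have "smooth m D \<E> (total_variation \<mu>)" unfolding smooth_def by auto
    then show "\<mu> \<in> M_0b m D \<E>" using assms(7) unfolding M_0b_def by blast
  qed
qed

end
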